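(* Let $G$ be a group of orientation-preserving piecewise linear or piecewise projective homeomorphisms of the circle. Suppose that $G$ has an orbit $Y$ such that the action of $G$ on circularly ordered pairs and triples in $Y$ is transitive. Then $H^2_b(G;\mathbf{R})$ is one-dimensional, spanned by the real Euler class.
   Context: $H^2_b(G;\mathbf{R})$ is the second bounded cohomology of the discrete group $G$ with trivial real coefficients: bounded functions $\omega:G^2\to\mathbf{R}$ with $\omega(g_2,g_3)-\omega(g_1g_2,g_3)+\omega(g_1,g_2g_3)-\omega(g_1,g_2)=0$, modulo functions $(g,h)\mapsto\phi(g)+\phi(h)-\phi(gh)$ with $\phi:G\to\mathbf{R}$ bounded. Piecewise linear homeomorphisms of the circle act on $\mathbf{R}/\mathbf{Z}$ and are affine on each of finitely many arcs; piecewise projective homeomorphisms act on $\mathbf{R}\cup\{\infty\}$ (identified with the circle) and agree on each of finitely many arcs with an element of $\mathrm{PSL}_2(\mathbf{R})$. A circularly ordered $k$-tuple in $Y$ is a $k$-tuple of distinct points of $Y$ that appear in this order when travelling once around the circle in the positive direction (for $k=2$, any ordered pair of distinct points). Real Euler class (of the given action of $G$ on the circle): let $\overline{\mathrm{Homeo}^+(\mathbf{R}/\mathbf{Z})}$ be the group of orientation-preserving homeomorphisms of $\mathbf{R}$ commuting with integer translations, a central extension of $\mathrm{Homeo}^+(\mathbf{R}/\mathbf{Z})$ by $\mathbf{Z}$ (integer translations). For $f\in\mathrm{Homeo}^+(\mathbf{R}/\mathbf{Z})$ let $\sigma(f)$ be the lift with $0\cdot\sigma(f)\in[0,1)$. Then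 $\sigma(f)\sigma(g)\sigma(fg)^{-1}$ is translation by an integer $c(f,g)$ and $c$ is a bounded 2-cocycle (group actions are on the right). The real Euler class of a circle action $G\to\mathrm{Homeo}^+(\mathbf{R}/\mathbf{Z})$ is the class in $H^2_b(G;\mathbf{R})$ of the pullback of $c$. *)

theory Defs
  imports
    "HOL-Analysis.Elementary_Topology"
    "HOL-Algebra.AbelCoset"
    "Jordan_Normal_Form.VS_Connect"
begin

section \<open>The circle and its orientation-preserving homeomorphisms\<close>

quotient_type circle = real / "\<lambda>x y :: real. x - y \<in> \<int>"
  morphisms circle_rep circle_proj
proof (rule equivpI)
  show "reflp (\<lambda>x y :: real. x - y \<in> \<int>)"
    by (simp add: reflp_def)
  show "symp (\<lambda>x y :: real. x - y \<in> \<int>)"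
    by (metis (no_types, lifting) Ints_minus minus_diff_eq sympI)
  show "transp (\<lambda>x y :: real. x - y \<in> \<int>)"
  proof (rule transpI)
    fix x y z :: real
    assume "x - y \<in> \<int>" "y - z \<in> \<int>"
    from Ints_add[OF this] show "x - z \<in> \<int>" by simp
  qed
qed

instantiation circle :: topological_space
begin

definition open_circle :: "circle set \<Rightarrow> bool" where
  "open_circle U \<longleftrightarrow> open (circle_proj -` U)"

instance
proof
  show "open (UNIV :: circle set)"
    by (simp add: open_circle_def)
next
  fix S T :: "circle set"
  assume "open S" "open T"
  then show "open (S \<inter> T)"
    by (simp add: open_circle_def vimage_Int open_Int)
next
  fix K :: "circle set set"
  assume "\<forall>S\<in>K. open S"
  then show "open (\<Union>K)"
    by (auto simp: open_circle_def vimage_Union)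
qed

end

text \<open>Groups of homeomorphisms act on the right, so the product \<open>f g\<close> is \<open>g \<circ> f\<close>.\<close>

definition homeo_real_lifts :: "(real \<Rightarrow> real) monoid" where
  "homeo_real_lifts =
     \<lparr>carrier = {F. (\<exists>F'. homeomorphism UNIV UNIV F F') \<and> strict_mono F \<and>
                    (\<forall>x. \<forall>n::int. F (x + of_int n) = F x + of_int n)},
      mult = (\<lambda>F H. H \<circ> F),
      one = id\<rparr>"

definition is_lift :: "(real \<Rightarrow> real) \<Rightarrow> (circle \<Rightarrow> circle) \<Rightarrow> bool" where
  "is_lift F f \<longleftrightarrow> F \<in> carrier homeo_real_lifts \<and> (\<forall>x. f (circle_proj x) = circle_proj (F x))"

definition homeo_circle :: "(circle \<Rightarrow> circle) monoid" where
  "homeo_circle =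
     \<lparr>carrier = {f. (\<exists>f'. homeomorphism UNIV UNIV f f') \<and> (\<exists>F. is_lift F f)},
      mult = (\<lambda>f g. g \<circ> f),
      one = id\<rparr>"


section \<open>Piecewise linear and piecewise projective homeomorphisms\<close>

text \<open>
  \<open>P f s e\<close> expresses a property of the restriction of \<open>f\<close> to the arc that is the image
  of \<open>{s..e}\<close> in the circle.
\<close>

definition piecewise ::
  "((circle \<Rightarrow> circle) \<Rightarrow> real \<Rightarrow> real \<Rightarrow> bool) \<Rightarrow> (circle \<Rightarrow> circle) \<Rightarrow> bool" where
  "piecewise P f \<longleftrightarrow>
     (\<exists>I. finite I \<and> (\<forall>(s, e)\<in>I. s < e \<and> e \<le> s + 1 \<and> P f s e) \<and>
          (\<Union>(s, e)\<in>I. circle_proj ` {s..e}) = UNIV)"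

definition affine_on_arc :: "(circle \<Rightarrow> circle) \<Rightarrow> real \<Rightarrow> real \<Rightarrow> bool" where
  "affine_on_arc f s e \<longleftrightarrow>
     (\<exists>a b. \<forall>t\<in>{s..e}. f (circle_proj t) = circle_proj (a * t + b))"

definition piecewise_linear :: "(circle \<Rightarrow> circle) \<Rightarrow> bool" where
  "piecewise_linear = piecewise affine_on_arc"

datatype projline = Point real | Infty

fun moebius :: "real \<Rightarrow> real \<Rightarrow> real \<Rightarrow> real \<Rightarrow> projline \<Rightarrow> projline" where
  "moebius a b c d (Point x) =
     (if c * x + d = 0 then Infty else Point ((a * x + b) / (c * x + d)))"
| "moebius a b c d Infty = (if c = 0 then Infty else Point (a / c))"

text \<open>
  The identification of \<open>\<real>/\<int>\<close> with \<open>\<real> \<union> {\<infinity>}\<close> is \<open>t \<mapsto> tan (\<pi> t)\<close>, which is increasing on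
  \<open>(-1/2, 1/2)\<close> and sends \<open>1/2\<close> to \<open>\<infinity>\<close>.
\<close>

lemma sin_cos_pi_of_int_add:
  fixes t :: real and n :: int
  shows "cos (pi * (t + of_int n)) = cos (pi * of_int n) * cos (pi * t)"
    and "sin (pi * (t + of_int n)) = cos (pi * of_int n) * sin (pi * t)"
    and "cos (pi * of_int n :: real) \<noteq> 0"
proof -
  have s: "sin (pi * of_int n :: real) = 0"
    by (metis mult.commute sin_zero_iff_int2)
  show "cos (pi * (t + of_int n)) = cos (pi * of_int n) * cos (pi * t)"
    "sin (pi * (t + of_int n)) = cos (pi * of_int n) * sin (pi * t)"
    by (simp_all add: distrib_left cos_add sin_add s)
  show "cos (pi * of_int n :: real) \<noteq> 0"
    using s sin_zero_abs_cos_one by fastforce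
qed

lift_definition circle_to_projline :: "circle \<Rightarrow> projline" is
  "\<lambda>t. if cos (pi * t) = 0 then Infty else Point (tan (pi * t))"
proof -
  fix s t :: real
  assume "s - t \<in> \<int>"
  then obtain n where n: "s = t + of_int n"
    by (metis Ints_cases add.commute diff_add_cancel)
  show "(if cos (pi * s) = 0 then Infty else Point (tan (pi * s))) =
        (if cos (pi * t) = 0 then Infty else Point (tan (pi * t)))"
    using sin_cos_pi_of_int_add(1,2)[of t n] sin_cos_pi_of_int_add(3)[of n] unfolding n by (simp add: tan_def)
qed

lemma bij_circle_to_projline: "bij circle_to_projline"
proof (rule bijI)
  show "inj circle_to_projline"
  proof (rule injI)
    fix x y assume eq: "circle_to_projline x = circle_to_projline y"
    obtain s t where st: "x = circle_proj s" "y = circle_proj t"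
      by (metis Quotient_abs_rep Quotient_circle)
    have "sin (pi * s) * cos (pi * t) = cos (pi * s) * sin (pi * t)"
      using eq unfolding st circle_to_projline.abs_eq
      by (auto simp: tan_def field_simps split: if_splits)
    then have "sin (pi * (s - t)) = 0"
      by (simp add: right_diff_distrib sin_diff)
    then obtain n :: int where "pi * (s - t) = of_int n * pi"
      by (auto simp: sin_zero_iff_int2)
    then have "s - t = of_int n" by simp
    then show "x = y"
      unfolding st by (simp add: circle.abs_eq_iff)
  qed
  show "surj circle_to_projline"
  proof (unfold surj_def, intro allI)
    fix p show "\<exists>x. p = circle_to_projline x"
    proof (cases p)
      case (Point u)
      have "circle_to_projline (circle_proj (arctan u / pi)) = p"
        by (simp add: circle_to_projline.abs_eq Point tan_arctan)
      then show ?thesis by metis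
    next
      case Infty
      have "circle_to_projline (circle_proj (1 / 2)) = p"
        by (simp add: circle_to_projline.abs_eq Infty)
      then show ?thesis by metis
    qed
  qed
qed

definition projective_on_arc :: "(circle \<Rightarrow> circle) \<Rightarrow> real \<Rightarrow> real \<Rightarrow> bool" where
  "projective_on_arc f s e \<longleftrightarrow>
     (\<exists>a b c d. a * d - b * c = 1 \<and>
        (\<forall>t\<in>{s..e}. circle_to_projline (f (circle_proj t)) =
                    moebius a b c d (circle_to_projline (circle_proj t))))"

definition piecewise_projective :: "(circle \<Rightarrow> circle) \<Rightarrow> bool" where
  "piecewise_projective = piecewise projective_on_arc"


section \<open>Orbits and circularly ordered tuples\<close>

definition is_orbit :: "(circle \<Rightarrow> circle) set \<Rightarrow> circle set \<Rightarrow> bool" where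
  "is_orbit G Y \<longleftrightarrow> (\<exists>y. Y = {g y | g. g \<in> G})"

text \<open>
  Travelling once around the circle from the first point lifts the tuple to an increasing
  sequence of reals contained in an interval \<open>{t..<t + 1}\<close>.
\<close>

definition circularly_ordered :: "circle list \<Rightarrow> bool" where
  "circularly_ordered xs \<longleftrightarrow>
     (\<exists>ts. xs = map circle_proj ts \<and> sorted_wrt (<) ts \<and> (\<forall>t\<in>set ts. t < hd ts + 1))"

definition circ_tuples :: "nat \<Rightarrow> circle set \<Rightarrow> circle list set" where
  "circ_tuples k Y = {xs. length xs = k \<and> set xs \<subseteq> Y \<and> circularly_ordered xs}"

text \<open>
  As usual, a transitive action has exactly one orbit; in particular the set acted on is
  not empty. This excludes orbits with at most two points.
\<close>

definition transitive_on_circ_tuples :: "(circle \<Rightarrow> circle) set \<Rightarrow> nat \<Rightarrow> circle set \<Rightarrow> bool" where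
  "transitive_on_circ_tuples G k Y \<longleftrightarrow>
     circ_tuples k Y \<noteq> {} \<and>
     (\<forall>xs\<in>circ_tuples k Y. \<forall>ys\<in>circ_tuples k Y. \<exists>g\<in>G. map g xs = ys)"


section \<open>Second bounded cohomology with trivial real coefficients\<close>

text \<open>Functions on \<open>G \<times> G\<close> are represented by functions vanishing outside \<open>G \<times> G\<close>.\<close>

definition bounded_cocycles2 :: "('a, 'm) monoid_scheme \<Rightarrow> ('a \<Rightarrow> 'a \<Rightarrow> real) set" where
  "bounded_cocycles2 G =
     {\<omega>. (\<forall>g h. \<not> (g \<in> carrier G \<and> h \<in> carrier G) \<longrightarrow> \<omega> g h = 0) \<and>
         (\<exists>C. \<forall>g h. \<bar>\<omega> g h\<bar> \<le> C) \<and>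
         (\<forall>g\<^sub>1\<in>carrier G. \<forall>g\<^sub>2\<in>carrier G. \<forall>g\<^sub>3\<in>carrier G.
            \<omega> g\<^sub>2 g\<^sub>3 - \<omega> (g\<^sub>1 \<otimes>\<^bsub>G\<^esub> g\<^sub>2) g\<^sub>3 + \<omega> g\<^sub>1 (g\<^sub>2 \<otimes>\<^bsub>G\<^esub> g\<^sub>3) - \<omega> g\<^sub>1 g\<^sub>2 = 0)}"

definition coboundary2 :: "('a, 'm) monoid_scheme \<Rightarrow> ('a \<Rightarrow> real) \<Rightarrow> 'a \<Rightarrow> 'a \<Rightarrow> real" where
  "coboundary2 G \<phi> =
     (\<lambda>g h. if g \<in> carrier G \<and> h \<in> carrier G then \<phi> g + \<phi> h - \<phi> (g \<otimes>\<^bsub>G\<^esub> h) else 0)"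

definition bounded_coboundaries2 :: "('a, 'm) monoid_scheme \<Rightarrow> ('a \<Rightarrow> 'a \<Rightarrow> real) set" where
  "bounded_coboundaries2 G = {coboundary2 G \<phi> | \<phi>. \<exists>C. \<forall>g\<in>carrier G. \<bar>\<phi> g\<bar> \<le> C}"

text \<open>The fields \<open>mult\<close> and \<open>one\<close> of a module record play no role for vector spaces.\<close>

definition cocycle_space :: "('a, 'm) monoid_scheme \<Rightarrow> (real, 'a \<Rightarrow> 'a \<Rightarrow> real) module" where
  "cocycle_space G =
     \<lparr>carrier = bounded_cocycles2 G, mult = undefined, one = undefined,
      zero = (\<lambda>g h. 0), add = (\<lambda>\<omega> \<eta> g h. \<omega> g h + \<eta> g h),
      smult = (\<lambda>r \<omega> g h. r * \<omega> g h)\<rparr>"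

lemma cocycle_space_simps:
  "carrier (cocycle_space G) = bounded_cocycles2 G"
  "zero (cocycle_space G) = (\<lambda>g h. 0)"
  "add (cocycle_space G) = (\<lambda>\<omega> \<eta> g h. \<omega> g h + \<eta> g h)"
  "smult (cocycle_space G) = (\<lambda>r \<omega> g h. r * \<omega> g h)"
  by (simp_all add: cocycle_space_def)

lemma bounded_cocycles2I:
  assumes "\<And>g h. \<not> (g \<in> carrier G \<and> h \<in> carrier G) \<Longrightarrow> \<omega> g h = 0"
    and "\<forall>g h. \<bar>\<omega> g h\<bar> \<le> C"
    and "\<And>a b c. \<lbrakk>a \<in> carrier G; b \<in> carrier G; c \<in> carrier G\<rbrakk> \<Longrightarrow>
           \<omega> b c - \<omega> (a \<otimes>\<^bsub>G\<^esub> b) c + \<omega> a (b \<otimes>\<^bsub>G\<^esub> c) - \<omega> a b = 0"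
  shows "\<omega> \<in> bounded_cocycles2 G"
  unfolding bounded_cocycles2_def using assms by blast

lemma bounded_cocycles2D:
  assumes "\<omega> \<in> bounded_cocycles2 G"
  shows "\<not> (g \<in> carrier G \<and> h \<in> carrier G) \<Longrightarrow> \<omega> g h = 0"
    and "\<lbrakk>a \<in> carrier G; b \<in> carrier G; c \<in> carrier G\<rbrakk> \<Longrightarrow>
           \<omega> b c - \<omega> (a \<otimes>\<^bsub>G\<^esub> b) c + \<omega> a (b \<otimes>\<^bsub>G\<^esub> c) - \<omega> a b = 0"
  using assms unfolding bounded_cocycles2_def by blast+

lemma bounded_cocycles2_add:
  assumes "\<omega> \<in> bounded_cocycles2 G" "\<eta> \<in> bounded_cocycles2 G"
  shows "(\<lambda>g h. \<omega> g h + \<eta> g h) \<in> bounded_cocycles2 G"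
proof -
  obtain C D where "\<forall>g h. \<bar>\<omega> g h\<bar> \<le> C" "\<forall>g h. \<bar>\<eta> g h\<bar> \<le> D"
    using assms unfolding bounded_cocycles2_def by blast
  then have "\<forall>g h. \<bar>\<omega> g h + \<eta> g h\<bar> \<le> C + D"
    by (meson abs_triangle_ineq add_mono order_trans)
  then show ?thesis
  proof (rule bounded_cocycles2I[rotated])
    fix g h assume "\<not> (g \<in> carrier G \<and> h \<in> carrier G)"
    then show "\<omega> g h + \<eta> g h = 0"
      using assms[THEN bounded_cocycles2D(1)] by simp
  next
    fix a b c assume "a \<in> carrier G" "b \<in> carrier G" "c \<in> carrier G"
    then show "(\<omega> b c + \<eta> b c) - (\<omega> (a \<otimes>\<^bsub>G\<^esub> b) c + \<eta> (a \<otimes>\<^bsub>G\<^esub> b) c)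
        + (\<omega> a (b \<otimes>\<^bsub>G\<^esub> c) + \<eta> a (b \<otimes>\<^bsub>G\<^esub> c)) - (\<omega> a b + \<eta> a b) = 0"
      using assms[THEN bounded_cocycles2D(2), of a b c] by linarith
  qed
qed

lemma bounded_cocycles2_smult:
  assumes "\<omega> \<in> bounded_cocycles2 G"
  shows "(\<lambda>g h. r * \<omega> g h) \<in> bounded_cocycles2 G"
proof -
  obtain C where "\<forall>g h. \<bar>\<omega> g h\<bar> \<le> C"
    using assms unfolding bounded_cocycles2_def by blast
  then have "\<forall>g h. \<bar>r * \<omega> g h\<bar> \<le> \<bar>r\<bar> * C"
    by (simp add: abs_mult mult_left_mono)
  then show ?thesis
  proof (rule bounded_cocycles2I[rotated])
    fix g h assume "\<not> (g \<in> carrier G \<and> h \<in> carrier G)"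
    then show "r * \<omega> g h = 0"
      using assms[THEN bounded_cocycles2D(1)] by simp
  next
    fix a b c assume "a \<in> carrier G" "b \<in> carrier G" "c \<in> carrier G"
    then have "r * (\<omega> b c - \<omega> (a \<otimes>\<^bsub>G\<^esub> b) c + \<omega> a (b \<otimes>\<^bsub>G\<^esub> c) - \<omega> a b) = 0"
      using assms[THEN bounded_cocycles2D(2), of a b c] by simp
    then show "r * \<omega> b c - r * \<omega> (a \<otimes>\<^bsub>G\<^esub> b) c + r * \<omega> a (b \<otimes>\<^bsub>G\<^esub> c) - r * \<omega> a b = 0"
      by (simp add: algebra_simps)
  qed
qed

lemma cocycle_space_vectorspace:
  "vectorspace class_ring (cocycle_space G)"
proof -
  have zero: "(\<lambda>g h. 0) \<in> bounded_cocycles2 G"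
    by (auto simp: bounded_cocycles2_def)
  have uminus: "(\<lambda>g h. - \<omega> g h) \<in> bounded_cocycles2 G"
    if "\<omega> \<in> bounded_cocycles2 G" for \<omega>
    using bounded_cocycles2_smult[OF that, of "-1"] by simp
  have ab: "abelian_group (cocycle_space G)"
  proof (rule abelian_groupI)
    fix x assume "x \<in> carrier (cocycle_space G)"
    then show "\<exists>y\<in>carrier (cocycle_space G). y \<oplus>\<^bsub>cocycle_space G\<^esub> x = \<zero>\<^bsub>cocycle_space G\<^esub>"
      using uminus[of x] by (intro bexI[of _ "\<lambda>g h. - x g h"]) (auto simp: cocycle_space_simps)
  qed (auto simp: cocycle_space_simps zero bounded_cocycles2_add algebra_simps)
  have "module class_ring (cocycle_space G)"
    by (rule moduleI[OF class_cring.cring_axioms ab])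
       (auto simp: cocycle_space_simps bounded_cocycles2_smult algebra_simps)
  then show ?thesis
    using class_field by (simp add: vectorspace_def)
qed

lemma bounded_coboundaries2I:
  assumes "\<omega> = coboundary2 G \<phi>" "\<forall>g\<in>carrier G. \<bar>\<phi> g\<bar> \<le> C"
  shows "\<omega> \<in> bounded_coboundaries2 G"
  using assms unfolding bounded_coboundaries2_def by blast

lemma coboundary2_linear:
  "coboundary2 G (\<lambda>g. \<phi> g + \<psi> g) = (\<lambda>g h. coboundary2 G \<phi> g h + coboundary2 G \<psi> g h)"
  "coboundary2 G (\<lambda>g. r * \<phi> g) = (\<lambda>g h. r * coboundary2 G \<phi> g h)"
  by (auto simp: coboundary2_def algebra_simps fun_eq_iff)

lemma (in group) bounded_coboundaries2_submodule:
  "submodule class_ring (bounded_coboundaries2 G) (cocycle_space G)"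
proof -
  interpret Z: vectorspace class_ring "cocycle_space G"
    by (rule cocycle_space_vectorspace)
  show ?thesis
  proof (unfold_locales)
    show "bounded_coboundaries2 G \<subseteq> carrier (cocycle_space G)"
    proof
      fix \<omega> assume "\<omega> \<in> bounded_coboundaries2 G"
      then obtain \<phi> C where \<omega>: "\<omega> = coboundary2 G \<phi>" and C: "\<forall>g\<in>carrier G. \<bar>\<phi> g\<bar> \<le> C"
        by (auto simp: bounded_coboundaries2_def)
      have C0: "0 \<le> C" using C one_closed by (meson abs_ge_zero order_trans)
      have "\<bar>\<omega> g h\<bar> \<le> 3 * C" for g h
      proof (cases "g \<in> carrier G \<and> h \<in> carrier G")
        case True
        then have "\<bar>\<phi> g\<bar> \<le> C" "\<bar>\<phi> h\<bar> \<le> C" "\<bar>\<phi> (g \<otimes> h)\<bar> \<le> C" using C by auto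
        then show ?thesis using True unfolding \<omega> coboundary2_def by auto
      qed (use C0 in \<open>auto simp: \<omega> coboundary2_def\<close>)
      then have "\<forall>g h. \<bar>\<omega> g h\<bar> \<le> 3 * C" by blast
      then show "\<omega> \<in> carrier (cocycle_space G)"
        unfolding cocycle_space_simps
        by (rule bounded_cocycles2I[rotated]) (auto simp: \<omega> coboundary2_def m_assoc)
    qed
  next
    show "\<zero>\<^bsub>cocycle_space G\<^esub> \<in> bounded_coboundaries2 G"
      unfolding bounded_coboundaries2_def
      by (auto intro!: exI[of _ "\<lambda>g. 0"] simp: cocycle_space_simps coboundary2_def fun_eq_iff)
  next
    fix v w assume "v \<in> bounded_coboundaries2 G" "w \<in> bounded_coboundaries2 G"
    then obtain \<phi> \<psi> C D where v: "v = coboundary2 G \<phi>" "\<forall>g\<in>carrier G. \<bar>\<phi> g\<bar> \<le> C"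
      and w: "w = coboundary2 G \<psi>" "\<forall>g\<in>carrier G. \<bar>\<psi> g\<bar> \<le> D"
      unfolding bounded_coboundaries2_def by blast
    have "\<forall>g\<in>carrier G. \<bar>\<phi> g + \<psi> g\<bar> \<le> C + D"
      using v(2) w(2) by (meson abs_triangle_ineq add_mono order_trans)
    then show "v \<oplus>\<^bsub>cocycle_space G\<^esub> w \<in> bounded_coboundaries2 G"
      by (intro bounded_coboundaries2I[of _ G "\<lambda>g. \<phi> g + \<psi> g"])
         (auto simp: cocycle_space_simps v(1) w(1) coboundary2_linear)
  next
    fix r :: real and v assume "v \<in> bounded_coboundaries2 G"
    then obtain \<phi> C where v: "v = coboundary2 G \<phi>" "\<forall>g\<in>carrier G. \<bar>\<phi> g\<bar> \<le> C"
      unfolding bounded_coboundaries2_def by blast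
    have "\<forall>g\<in>carrier G. \<bar>r * \<phi> g\<bar> \<le> \<bar>r\<bar> * C"
      using v(2) by (simp add: abs_mult mult_left_mono)
    then show "r \<odot>\<^bsub>cocycle_space G\<^esub> v \<in> bounded_coboundaries2 G"
      by (intro bounded_coboundaries2I[of _ G "\<lambda>g. r * \<phi> g"])
         (auto simp: cocycle_space_simps v(1) coboundary2_linear)
  qed
qed

definition bounded_H2 :: "('a, 'm) monoid_scheme \<Rightarrow> (real, ('a \<Rightarrow> 'a \<Rightarrow> real) set) module" where
  "bounded_H2 G =
     (let Z = cocycle_space G; B = bounded_coboundaries2 G in
      \<lparr>carrier = a_rcosets\<^bsub>Z\<^esub> B, mult = undefined, one = undefined,
       zero = B, add = set_add Z,
       smult = (\<lambda>r X. \<Union>\<omega>\<in>X. B +>\<^bsub>Z\<^esub> (r \<odot>\<^bsub>Z\<^esub> \<omega>))\<rparr>)"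

lemma (in group) bounded_H2_vectorspace:
  "vectorspace class_ring (bounded_H2 G)"
proof -
  define Z where "Z = cocycle_space G"
  define B where "B = bounded_coboundaries2 G"
  interpret Z: vectorspace class_ring Z
    unfolding Z_def by (rule cocycle_space_vectorspace)
  interpret B: submodule class_ring B Z
    unfolding Z_def B_def by (rule bounded_coboundaries2_submodule)
  interpret B: abelian_subgroup B Z
  proof (rule abelian_subgroupI3)
    show "additive_subgroup B Z"
    proof
      fix x assume x: "x \<in> B"
      then have xZ: "x \<in> carrier Z" using B.subset by auto
      have "(-1) \<odot>\<^bsub>Z\<^esub> x \<oplus>\<^bsub>Z\<^esub> x = \<zero>\<^bsub>Z\<^esub>"
        by (simp add: Z_def cocycle_space_simps)
      then have "\<ominus>\<^bsub>Z\<^esub> x = (-1) \<odot>\<^bsub>Z\<^esub> x"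
        using Z.minus_equality xZ by simp
      then have "\<ominus>\<^bsub>Z\<^esub> x \<in> B" using B.smult_closed[of "-1" x] x by simp
      then show "inv\<^bsub>add_monoid Z\<^esub> x \<in> B" by (simp add: a_inv_def)
    qed (use B.subset in auto)
  qed (rule Z.abelian_group_axioms)
  have H: "carrier (bounded_H2 G) = A_RCOSETS Z B" "zero (bounded_H2 G) = B"
    "add (bounded_H2 G) = set_add Z"
    "smult (bounded_H2 G) = (\<lambda>r X. \<Union>\<omega>\<in>X. B +>\<^bsub>Z\<^esub> (r \<odot>\<^bsub>Z\<^esub> \<omega>))"
    by (simp_all add: bounded_H2_def Let_def Z_def B_def)
  have cos: "A_RCOSETS Z B = (\<lambda>\<omega>. B +>\<^bsub>Z\<^esub> \<omega>) ` carrier Z"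
    by (auto simp: A_RCOSETS_def')
  have add: "(B +>\<^bsub>Z\<^esub> x) <+>\<^bsub>Z\<^esub> (B +>\<^bsub>Z\<^esub> y) = B +>\<^bsub>Z\<^esub> (x \<oplus>\<^bsub>Z\<^esub> y)"
    if "x \<in> carrier Z" "y \<in> carrier Z" for x y
    using that by (rule B.a_rcos_sum)
  have sm: "(\<Union>\<omega>\<in>B +>\<^bsub>Z\<^esub> x. B +>\<^bsub>Z\<^esub> (r \<odot>\<^bsub>Z\<^esub> \<omega>)) = B +>\<^bsub>Z\<^esub> (r \<odot>\<^bsub>Z\<^esub> x)"
    if x: "x \<in> carrier Z" for x r
  proof -
    have "B +>\<^bsub>Z\<^esub> (r \<odot>\<^bsub>Z\<^esub> \<omega>) = B +>\<^bsub>Z\<^esub> (r \<odot>\<^bsub>Z\<^esub> x)" if "\<omega> \<in> B +>\<^bsub>Z\<^esub> x" for \<omega>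
    proof -
      obtain b where b: "b \<in> B" "\<omega> = b \<oplus>\<^bsub>Z\<^esub> x"
        using \<open>\<omega> \<in> B +>\<^bsub>Z\<^esub> x\<close> by (auto simp: a_r_coset_def')
      have bZ: "b \<in> carrier Z" using b B.subset by auto
      have "r \<odot>\<^bsub>Z\<^esub> \<omega> = r \<odot>\<^bsub>Z\<^esub> b \<oplus>\<^bsub>Z\<^esub> r \<odot>\<^bsub>Z\<^esub> x"
        unfolding b(2) by (rule Z.smult_r_distr) (use bZ x in auto)
      moreover have "r \<odot>\<^bsub>Z\<^esub> b \<in> B" using b by simp
      ultimately have "r \<odot>\<^bsub>Z\<^esub> \<omega> \<in> B +>\<^bsub>Z\<^esub> (r \<odot>\<^bsub>Z\<^esub> x)"
        by (auto simp: a_r_coset_def')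
      then show ?thesis using B.a_repr_independence' x by simp
    qed
    moreover have "x \<in> B +>\<^bsub>Z\<^esub> x" using B.a_rcos_self x by blast
    ultimately show ?thesis by blast
  qed
  have B0: "B = B +>\<^bsub>Z\<^esub> \<zero>\<^bsub>Z\<^esub>"
    by (metis B.a_subset Z.a_coset_add_zero)
  have ab: "abelian_group (bounded_H2 G)"
  proof (rule abelian_groupI)
    fix x assume "x \<in> carrier (bounded_H2 G)"
    then obtain \<omega> where w: "\<omega> \<in> carrier Z" "x = B +>\<^bsub>Z\<^esub> \<omega>" unfolding H cos by auto
    show "\<exists>y\<in>carrier (bounded_H2 G). y \<oplus>\<^bsub>bounded_H2 G\<^esub> x = \<zero>\<^bsub>bounded_H2 G\<^esub>"
    proof
      show "B +>\<^bsub>Z\<^esub> (\<ominus>\<^bsub>Z\<^esub> \<omega>) \<in> carrier (bounded_H2 G)" using w unfolding H cos by auto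
      show "(B +>\<^bsub>Z\<^esub> (\<ominus>\<^bsub>Z\<^esub> \<omega>)) \<oplus>\<^bsub>bounded_H2 G\<^esub> x = \<zero>\<^bsub>bounded_H2 G\<^esub>"
        using w B0 unfolding H by (simp add: add Z.l_neg)
    qed
  next
    fix x assume "x \<in> carrier (bounded_H2 G)"
    then show "\<zero>\<^bsub>bounded_H2 G\<^esub> \<oplus>\<^bsub>bounded_H2 G\<^esub> x = x"
      unfolding H cos by (subst B0) (auto simp: add)
  next
    show "\<zero>\<^bsub>bounded_H2 G\<^esub> \<in> carrier (bounded_H2 G)"
      unfolding H cos by (subst B0) auto
  qed (auto simp: H cos add Z.a_ac)
  have smH: "r \<odot>\<^bsub>bounded_H2 G\<^esub> (B +>\<^bsub>Z\<^esub> x) = B +>\<^bsub>Z\<^esub> (r \<odot>\<^bsub>Z\<^esub> x)"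
    if "x \<in> carrier Z" for x r
    using sm[OF that] by (simp add: H)
  have smZ: "r \<odot>\<^bsub>Z\<^esub> x \<in> carrier Z" if "x \<in> carrier Z" for x r
    using that by simp
  have "module class_ring (bounded_H2 G)"
    by (rule moduleI[OF class_cring.cring_axioms ab])
       (use Z.smult_l_distr Z.smult_r_distr Z.smult_assoc1 Z.smult_one
        in \<open>auto simp: H(1,3) cos add smH smZ\<close>)
  then show ?thesis
    using class_field by (simp add: vectorspace_def)
qed

definition bounded_class2 ::
  "('a, 'm) monoid_scheme \<Rightarrow> ('a \<Rightarrow> 'a \<Rightarrow> real) \<Rightarrow> ('a \<Rightarrow> 'a \<Rightarrow> real) set" where
  "bounded_class2 G \<omega> = bounded_coboundaries2 G +>\<^bsub>cocycle_space G\<^esub> \<omega>"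


section \<open>The real Euler class\<close>

definition canonical_lift :: "(circle \<Rightarrow> circle) \<Rightarrow> real \<Rightarrow> real" where
  "canonical_lift f = (THE F. is_lift F f \<and> 0 \<le> F 0 \<and> F 0 < 1)"

definition euler_cocycle :: "(circle \<Rightarrow> circle) \<Rightarrow> (circle \<Rightarrow> circle) \<Rightarrow> int" where
  "euler_cocycle f g =
     (THE n. canonical_lift f \<otimes>\<^bsub>homeo_real_lifts\<^esub> canonical_lift g \<otimes>\<^bsub>homeo_real_lifts\<^esub>
             inv\<^bsub>homeo_real_lifts\<^esub> (canonical_lift (f \<otimes>\<^bsub>homeo_circle\<^esub> g)) =
             (\<lambda>x. x + of_int n))"

text \<open>The action of \<open>G\<close> on the circle is given by a homomorphism \<open>\<rho>\<close> into \<open>homeo_circle\<close>.\<close>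

definition real_euler_class ::
  "('a, 'm) monoid_scheme \<Rightarrow> ('a \<Rightarrow> circle \<Rightarrow> circle) \<Rightarrow> ('a \<Rightarrow> 'a \<Rightarrow> real) set" where
  "real_euler_class G \<rho> =
     bounded_class2 G (\<lambda>g h. if g \<in> carrier G \<and> h \<in> carrier G
                             then of_int (euler_cocycle (\<rho> g) (\<rho> h)) else 0)"

end

theory Submission
  imports Defs "HOL-Analysis.Analysis"
begin

text \<open>
  Fix \<open>y\<close> in the orbit and let \<open>H\<close> be its stabiliser. A bounded cocycle \<open>\<omega>\<close> on \<open>G\<close> defines a central
  extension \<open>E\<close> of \<open>G\<close> by \<open>\<real>\<close>, and the projection to \<open>\<real>\<close> is within bounded distance of a
  homogeneous quasimorphism \<open>q\<close> on \<open>E\<close>. The key point is that \<open>q\<close> is a homomorphism over \<open>H\<close>. Given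
  two elements of \<open>H\<close>, their common fixed points leave finitely many gaps. One-sided germs at a fixed
  point lie in an affine group, which is metabelian, so it suffices to treat elements supported in
  compact subsets of the gaps. These are handled gap by gap: on a single gap a compact set can be
  displaced from itself, and commuting conjugates force the defect of \<open>q\<close> to vanish.

  Conjugation invariance of \<open>q\<close> then produces a section of \<open>E\<close> that is equivariant under \<open>H\<close> on both
  sides, so \<open>\<omega>\<close> is cohomologous to an invariant function on triples of the orbit. By transitivity such
  functions that are cocycles form a plane, spanned by a coboundary and by the Euler cocycle based at
  \<open>y\<close>. Finally, if the latter had a bounded primitive, it would take the value \<open>1 / 2\<close>, although it is
  integer-valued.
\<close>

section \<open>Homogeneous quasimorphisms\<close>

text \<open>A primitive of \<omega> over \<open>H\<close> alone would not suffice. A cocycle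
  invariant on triples has to vanish on pairs with either entry in \<open>H\<close>, so the copy of
  \<open>H\<close> inside \<open>E\<close> must be compatible with every coincidence s^-1 m s = m'
  between elements of \<open>H\<close>, where s lies outside \<open>H\<close>. A copy cut out by a
  function invariant under conjugation in all of \<open>E\<close> has this property automatically;
  this is why the argument runs through \<open>q\<close> and not through primitives over
  \<open>H\<close>.

  Additivity of \<open>q\<close> over \<open>H\<close> cannot be deduced from amenability, since
  stabilisers in piecewise projective groups may be non-amenable. Rigidity of affine germs replaces
  it: a non-identity germ fixes nothing close to its base point, so fixed sets have finitely many
  gaps and finitely many displacements suffice.

  The value \<open>1 / 2\<close> arises as follows. The values of a relative cocycle on the two
  orientations of distinct triples add up to its value on a degenerate triple
  \<open>(y, z, y)\<close>, which is 1 for the based Euler cocycle. A relative cocycle with a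
  bounded primitive takes the same value on both orientations.\<close>

lemma bounded_multiples_imp_zero:
  fixes r B :: real
  assumes "\<And>n::nat. \<bar>real n * r\<bar> \<le> B"
  shows "r = 0"
proof (rule ccontr)
  assume "r \<noteq> 0"
  then obtain n :: nat where "B < real n * \<bar>r\<bar>"
    using reals_Archimedean3[of "\<bar>r\<bar>"] by auto
  with assms[of n] show False by (simp add: abs_mult)
qed

definition commut :: "('a, 'm) monoid_scheme \<Rightarrow> 'a \<Rightarrow> 'a \<Rightarrow> 'a" where
  "commut G x y = inv\<^bsub>G\<^esub> x \<otimes>\<^bsub>G\<^esub> inv\<^bsub>G\<^esub> y \<otimes>\<^bsub>G\<^esub> x \<otimes>\<^bsub>G\<^esub> y"

lemma (in group) commut_closed [simp]:
  "x \<in> carrier G \<Longrightarrow> y \<in> carrier G \<Longrightarrow> commut G x y \<in> carrier G"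
  by (simp add: commut_def)

lemma (in group) inv_cancel:
  assumes "x \<in> carrier G" "y \<in> carrier G"
  shows "x \<otimes> (inv x \<otimes> y) = y" "inv x \<otimes> (x \<otimes> y) = y"
  using assms by (simp_all flip: m_assoc)

lemma (in group) mult_commut:
  "x \<in> carrier G \<Longrightarrow> y \<in> carrier G \<Longrightarrow> y \<otimes> x \<otimes> commut G x y = x \<otimes> y"
  by (simp add: commut_def m_assoc inv_cancel)

lemma (in group) pow_conj:
  assumes "x \<in> carrier G" "y \<in> carrier G"
  shows "(inv x \<otimes> y \<otimes> x) [^] (n::nat) = inv x \<otimes> y [^] n \<otimes> x"
proof (induction n)
  case (Suc n)
  then show ?case using assms by (simp add: m_assoc inv_cancel)
qed (use assms in simp)

locale homogeneous_quasimorphism = group G for G (structure) +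
  fixes q :: "'a \<Rightarrow> real" and D :: real
  assumes defect: "\<lbrakk>x \<in> carrier G; y \<in> carrier G\<rbrakk> \<Longrightarrow> \<bar>q (x \<otimes> y) - q x - q y\<bar> \<le> D"
    and q_pow: "x \<in> carrier G \<Longrightarrow> q (x [^] (n::nat)) = real n * q x"
begin

definition additive_on :: "'a set \<Rightarrow> bool" where
  "additive_on M \<longleftrightarrow> (\<forall>x\<in>M. \<forall>y\<in>M. q (x \<otimes> y) = q x + q y)"

lemma q_one: "q \<one> = 0"
  using q_pow[of \<one> 0] by simp

lemma q_inv:
  assumes x: "x \<in> carrier G"
  shows "q (inv x) = - q x"
proof -
  have "q x + q (inv x) = 0"
  proof (rule bounded_multiples_imp_zero)
    fix n :: nat
    have "x [^] n \<otimes> inv x [^] n = \<one>"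
      using x by (simp add: nat_pow_inv)
    then show "\<bar>real n * (q x + q (inv x))\<bar> \<le> D"
      using defect[of "x [^] n" "inv x [^] n"] x by (simp add: q_pow q_one algebra_simps)
  qed
  then show ?thesis by simp
qed

text \<open>Conjugation changes \<open>q\<close> by at most \<open>2 * D\<close> and commutes with
  taking powers. Applied to \<open>n\<close>-th powers, the same bound holds for \<open>n\<close>
  times the difference, which must then be 0.\<close>

lemma q_conj:
  assumes x: "x \<in> carrier G" and y: "y \<in> carrier G"
  shows "q (inv x \<otimes> y \<otimes> x) = q y"
proof -
  have "q (inv x \<otimes> y \<otimes> x) - q y = 0"
  proof (rule bounded_multiples_imp_zero)
    fix n :: nat
    have "\<bar>q (inv x \<otimes> y [^] n \<otimes> x) - q (y [^] n)\<bar> \<le> 2 * D"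
      using defect[of "inv x \<otimes> y [^] n" x] defect[of "inv x" "y [^] n"] x y q_inv[OF x] by simp
    then show "\<bar>real n * (q (inv x \<otimes> y \<otimes> x) - q y)\<bar> \<le> 2 * D"
      using x y by (simp add: right_diff_distrib q_pow flip: pow_conj)
  qed
  then show ?thesis by simp
qed

text \<open>Collecting the factors \<open>n\<close> of \<open>(x \<otimes> n) [^] p\<close> on the
  right turns them into conjugates. Their product lies in \<open>N\<close> and has value
  \<open>real p * q n\<close> by additivity and invariance, so the defect at \<open>x [^] p\<close>
  and this product is bounded independently of \<open>p\<close>.\<close>

lemma q_mult_normal:
  assumes N: "N \<lhd> G" "additive_on N" and x: "x \<in> carrier G" and n: "n \<in> N"
  shows "q (x \<otimes> n) = q x + q n"
proof -
  interpret N: normal N G by (rule N)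
  have nc: "n \<in> carrier G" using n by auto
  have pow: "\<exists>m\<in>N. (x \<otimes> n) [^] p = x [^] p \<otimes> m \<and> q m = real p * q n" for p :: nat
  proof (induction p)
    case 0
    show ?case by (rule bexI[of _ \<one>]) (auto simp: q_one)
  next
    case (Suc p)
    then obtain m where m: "m \<in> N" "(x \<otimes> n) [^] p = x [^] p \<otimes> m" "q m = real p * q n" by auto
    have mc: "m \<in> carrier G" using m by auto
    have c: "inv x \<otimes> m \<otimes> x \<in> N" using N.inv_op_closed1[OF x m(1)] .
    have "q (inv x \<otimes> m \<otimes> x \<otimes> n) = real (Suc p) * q n"
      using N(2) c n m(3) q_conj[OF x mc] by (simp add: additive_on_def algebra_simps)
    moreover have "(x \<otimes> n) [^] Suc p = x [^] Suc p \<otimes> (inv x \<otimes> m \<otimes> x \<otimes> n)"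
      using x nc mc m(2) by (simp add: m_assoc inv_cancel)
    moreover have "inv x \<otimes> m \<otimes> x \<otimes> n \<in> N" using c n by simp
    ultimately show ?case by blast
  qed
  have "q (x \<otimes> n) - q x - q n = 0"
  proof (rule bounded_multiples_imp_zero)
    fix p :: nat
    obtain m where m: "m \<in> N" "(x \<otimes> n) [^] p = x [^] p \<otimes> m" "q m = real p * q n"
      using pow by blast
    then have "\<bar>q ((x \<otimes> n) [^] p) - q (x [^] p) - real p * q n\<bar> \<le> D"
      using defect[of "x [^] p" m] x N.subset by auto
    then show "\<bar>real p * (q (x \<otimes> n) - q x - q n)\<bar> \<le> D"
      using x nc by (simp add: q_pow algebra_simps)
  qed
  then show ?thesis by simp
qed

lemma normal_kernel:
  assumes "N \<lhd> G" "additive_on N"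
  shows "{n \<in> N. q n = 0} \<lhd> G"
proof -
  interpret N: normal N G by fact
  have "subgroup {n \<in> N. q n = 0} G"
    using assms(2) N.subset
    by (unfold_locales) (auto simp: additive_on_def q_one q_inv)
  moreover have "q (x \<otimes> n \<otimes> inv x) = q n" if "x \<in> carrier G" "n \<in> N" for x n
    using q_conj[of "inv x" n] that by simp
  ultimately show ?thesis
    unfolding normal_inv_iff using N.inv_op_closed2 by auto
qed

text \<open>Multiplying \<open>x\<close> by its commutator with \<open>y\<close> gives a conjugate
  of \<open>x\<close>, which has the same value as \<open>x\<close>.\<close>

lemma q_commut:
  assumes N: "N \<lhd> G" "additive_on N" and x: "x \<in> carrier G" and y: "y \<in> carrier G"
    and c: "commut G x y \<in> N"
  shows "q (commut G x y) = 0"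
proof -
  have "x \<otimes> commut G x y = inv y \<otimes> x \<otimes> y"
    using x y by (simp add: commut_def m_assoc inv_cancel)
  then show ?thesis
    using q_mult_normal[OF N x c] q_conj[OF y x] by simp
qed

text \<open>The zeros of \<open>q\<close> in \<open>N\<close> form a normal subgroup
  \<open>K\<close>, and \<open>q\<close> is constant on its cosets. By \<open>q_commut\<close> the
  elements \<open>x\<close> and \<open>y\<close> commute modulo \<open>K\<close>, so the
  \<open>n\<close>-th power of their product may be replaced by the product of their
  \<open>n\<close>-th powers, and the bounded defect is divided by \<open>n\<close>.\<close>

lemma q_mult_commut:
  assumes N: "N \<lhd> G" "additive_on N" and x: "x \<in> carrier G" and y: "y \<in> carrier G"
    and c: "commut G x y \<in> N"
  shows "q (x \<otimes> y) = q x + q y"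
proof -
  define K where "K = {n \<in> N. q n = 0}"
  have KN: "K \<subseteq> N" by (auto simp: K_def)
  interpret K: normal K G unfolding K_def by (rule normal_kernel[OF N])
  interpret Q: group "G Mod K" by (rule K.factorgroup_is_group)
  have hom: "(\<lambda>a. K #> a) \<in> hom G (G Mod K)" by (rule K.r_coset_hom_Mod)
  have cK: "commut G x y \<in> K" using c q_commut[OF N x y c] by (simp add: K_def)
  have rel: "q a = q b" if "a \<in> carrier G" "b \<in> carrier G" "K #> a = K #> b" for a b
  proof -
    have "a \<in> K #> b" using that rcos_self[OF _ K.subgroup_axioms] by metis
    then obtain k where k: "k \<in> K" "a = k \<otimes> b" by (auto simp: r_coset_def)
    have kc: "k \<in> carrier G" using k by auto
    have "inv b \<otimes> k \<otimes> b \<in> K" using K.inv_op_closed1 that k by auto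
    moreover have "a = b \<otimes> (inv b \<otimes> k \<otimes> b)" using that kc k by (simp add: m_assoc inv_cancel)
    ultimately show "q a = q b"
      using q_mult_normal[OF N, of b "inv b \<otimes> k \<otimes> b"] that KN by (auto simp: K_def)
  qed
  have com: "(K #> x) \<otimes>\<^bsub>G Mod K\<^esub> (K #> y) = (K #> y) \<otimes>\<^bsub>G Mod K\<^esub> (K #> x)"
  proof -
    have e: "inv (y \<otimes> x) \<otimes> (x \<otimes> y) = commut G x y"
      using x y by (simp add: commut_def m_assoc inv_mult_group)
    have "x \<otimes> y \<in> (y \<otimes> x) <# K"
      using cK mult_commut[OF x y] by (force simp: l_coset_def)
    then have "x \<otimes> y \<in> K #> (y \<otimes> x)" using K.coset_eq x y by auto
    then have "K #> (x \<otimes> y) = K #> (y \<otimes> x)"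
      using repr_independence[OF _ _ K.subgroup_axioms] x y by auto
    then show ?thesis using x y by (simp add: K.rcos_sum)
  qed
  have "q (x \<otimes> y) - q x - q y = 0"
  proof (rule bounded_multiples_imp_zero)
    fix n :: nat
    have Kx: "K #> x \<in> carrier (G Mod K)" "K #> y \<in> carrier (G Mod K)"
      using hom x y by (auto simp: hom_def Pi_def)
    have pw: "K #> (a [^] n) = (K #> a) [^]\<^bsub>G Mod K\<^esub> n" if "a \<in> carrier G" for a
      using group_hom.hom_nat_pow[of G "G Mod K" "\<lambda>a. K #> a" a n] hom that group_axioms Q.group_axioms
      by (simp add: group_hom_def group_hom_axioms_def)
    have "K #> ((x \<otimes> y) [^] n) = K #> (x [^] n \<otimes> y [^] n)"
      using pw[of "x \<otimes> y"] pw[OF x] pw[OF y] hom x y Q.pow_mult_distrib[OF com Kx, of n]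
      by (simp add: hom_mult)
    from rel[OF _ _ this] have "q ((x \<otimes> y) [^] n) = q (x [^] n \<otimes> y [^] n)" using x y by simp
    then show "\<bar>real n * (q (x \<otimes> y) - q x - q y)\<bar> \<le> D"
      using defect[of "x [^] n" "y [^] n"] x y by (simp add: q_pow algebra_simps)
  qed
  then show ?thesis by simp
qed

lemma q_mult_commuting:
  assumes "x \<in> carrier G" "y \<in> carrier G" "x \<otimes> y = y \<otimes> x"
  shows "q (x \<otimes> y) = q x + q y"
proof -
  have "y \<otimes> x \<otimes> commut G x y = y \<otimes> x" using mult_commut[of x y] assms by simp
  then have "commut G x y = \<one>" using assms(1,2) by simp
  then show ?thesis
    using q_mult_commut[OF one_is_normal, of x y] assms(1,2) by (simp add: additive_on_def q_one)
qed

lemma additive_on_commut: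
  assumes "N \<lhd> G" "additive_on N" "M \<subseteq> carrier G"
    and "\<And>x y. \<lbrakk>x \<in> M; y \<in> M\<rbrakk> \<Longrightarrow> commut G x y \<in> N"
  shows "additive_on M"
  unfolding additive_on_def using assms q_mult_commut by blast

text \<open>
  A conjugate of \<open>M\<close> commuting with \<open>M\<close> modulo \<open>N\<close> makes \<open>x \<mapsto> x (k\<^sup>-\<^sup>1 x k)\<close> multiplicative
  modulo \<open>N\<close>. As \<open>q\<close> doubles along this map, the defect of \<open>q\<close> on \<open>M\<close> is at most half of itself.
\<close>

lemma additive_on_displaced:
  assumes N: "N \<lhd> G" "additive_on N" and M: "subgroup M G"
    and k: "\<And>x y. \<lbrakk>x \<in> M; y \<in> M\<rbrakk> \<Longrightarrow> \<exists>k\<in>carrier G. \<forall>u\<in>{x, y, x \<otimes> y}.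
               inv k \<otimes> u \<otimes> k \<in> M \<and> (\<forall>v\<in>{x, y, x \<otimes> y}. commut G (inv k \<otimes> u \<otimes> k) v \<in> N)"
  shows "additive_on M"
proof -
  interpret M: subgroup M G by fact
  interpret N: normal N G by fact
  have half: "\<bar>q (x \<otimes> y) - q x - q y\<bar> \<le> B / 2"
    if B: "\<And>x y. x \<in> M \<Longrightarrow> y \<in> M \<Longrightarrow> \<bar>q (x \<otimes> y) - q x - q y\<bar> \<le> B"
      and x: "x \<in> M" and y: "y \<in> M" for x y B
  proof -
    \<comment> \<open>The conjugator may depend on the pair: it only has to displace
      \<open>x\<close>, \<open>y\<close> and their product, not all of \<open>M\<close>.\<close>
    obtain k where kc: "k \<in> carrier G"
      and k: "\<And>u. u \<in> {x, y, x \<otimes> y} \<Longrightarrow> inv k \<otimes> u \<otimes> k \<in> M"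
        "\<And>u v. \<lbrakk>u \<in> {x, y, x \<otimes> y}; v \<in> {x, y, x \<otimes> y}\<rbrakk> \<Longrightarrow> commut G (inv k \<otimes> u \<otimes> k) v \<in> N"
      using assms(4)[OF x y] by blast
    define t where "t = (\<lambda>u. inv k \<otimes> u \<otimes> k)"
    have xc: "x \<in> carrier G" and yc: "y \<in> carrier G" using x y by auto
    have tc: "t x \<in> carrier G" "t y \<in> carrier G" using xc yc kc by (auto simp: t_def)
    have qt: "q (t u \<otimes> u) = 2 * q u" if "u \<in> {x, y, x \<otimes> y}" for u
    proof -
      have "u \<in> carrier G" using that xc yc by auto
      then show ?thesis
        using q_mult_commut[OF N, of "t u" u] k(2)[OF that that] q_conj[OF kc, of u] kc by (simp add: t_def)
    qed
    define c where "c = commut G (t y) x"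
    have cN: "c \<in> N" using k(2)[of y x] by (simp add: c_def t_def)
    have cc: "c \<in> carrier G" using cN by auto
    have q0: "q c = 0" unfolding c_def using q_commut[OF N tc(2) xc] cN by (simp add: c_def)
    have txy: "t (x \<otimes> y) = t x \<otimes> t y" using xc yc kc by (simp add: t_def m_assoc inv_cancel)
    \<comment> \<open>The two products differ by exchanging \<open>t y\<close> and \<open>x\<close>.
      The commutator \<open>c\<close> of this exchange is carried past \<open>y\<close> to the right
      end, where it becomes an element of \<open>N\<close> with value 0.\<close>
    have "t x \<otimes> x \<otimes> (t y \<otimes> y) = t x \<otimes> (x \<otimes> t y) \<otimes> y"
      using xc yc tc by (simp add: m_assoc)
    moreover have "t (x \<otimes> y) \<otimes> (x \<otimes> y) = t x \<otimes> (t y \<otimes> x) \<otimes> y"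
      using xc yc tc by (simp add: m_assoc txy)
    moreover have "t y \<otimes> x = x \<otimes> t y \<otimes> c" using mult_commut[OF tc(2) xc] by (simp add: c_def)
    ultimately have eq: "t (x \<otimes> y) \<otimes> (x \<otimes> y) = (t x \<otimes> x \<otimes> (t y \<otimes> y)) \<otimes> (inv y \<otimes> c \<otimes> y)"
      using xc yc tc cc by (simp add: m_assoc inv_cancel)
    have "inv y \<otimes> c \<otimes> y \<in> N" using N.inv_op_closed1[OF yc cN] .
    then have "q (t (x \<otimes> y) \<otimes> (x \<otimes> y)) = q (t x \<otimes> x \<otimes> (t y \<otimes> y))"
      unfolding eq using q_mult_normal[OF N, of "t x \<otimes> x \<otimes> (t y \<otimes> y)" "inv y \<otimes> c \<otimes> y"]
        xc yc tc cc q0 q_conj[OF yc cc] by simp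
    then have "q (t x \<otimes> x \<otimes> (t y \<otimes> y)) = 2 * q (x \<otimes> y)" using qt by simp
    moreover have "t x \<otimes> x \<in> M" "t y \<otimes> y \<in> M" using k(1) x y by (auto simp: t_def)
    ultimately have "\<bar>2 * q (x \<otimes> y) - 2 * q x - 2 * q y\<bar> \<le> B"
      using B[of "t x \<otimes> x" "t y \<otimes> y"] qt by simp
    then show ?thesis by linarith
  qed
  have bound: "\<bar>q (x \<otimes> y) - q x - q y\<bar> \<le> D / 2 ^ n" if "x \<in> M" "y \<in> M" for x y n
    using that
  proof (induction n arbitrary: x y)
    case 0
    then show ?case using defect by auto
  next
    case (Suc n)
    then show ?case using half[of "D / 2 ^ n" x y] by (simp add: field_simps)
  qed
  show ?thesis
    unfolding additive_on_def
  proof (intro ballI)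
    fix x y assume "x \<in> M" "y \<in> M"
    have "(\<lambda>n. D / 2 ^ n) \<longlonglongrightarrow> 0"
      by (rule LIMSEQ_divide_realpow_zero) simp
    then have "\<bar>q (x \<otimes> y) - q x - q y\<bar> \<le> 0"
      using bound[OF \<open>x \<in> M\<close> \<open>y \<in> M\<close>] by (intro LIMSEQ_le_const) auto
    then show "q (x \<otimes> y) = q x + q y" by simp
  qed
qed

lemma homogeneous_quasimorphism_subgroup:
  assumes "subgroup H G"
  shows "homogeneous_quasimorphism (G\<lparr>carrier := H\<rparr>) q D"
proof -
  interpret H: subgroup H G by fact
  interpret H': group "G\<lparr>carrier := H\<rparr>" by (rule subgroup_imp_group) fact
  show ?thesis
    by unfold_locales (auto simp: defect q_pow simp flip: nat_pow_consistent)
qed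

end

section \<open>Homogenisation of a quasimorphism\<close>

lemma (in group) homogenization:
  fixes f :: "'a \<Rightarrow> real"
  assumes D: "\<And>x y. \<lbrakk>x \<in> carrier G; y \<in> carrier G\<rbrakk> \<Longrightarrow> \<bar>f (x \<otimes> y) - f x - f y\<bar> \<le> D"
  obtains q where "homogeneous_quasimorphism G q (4 * D)"
    and "\<And>x. x \<in> carrier G \<Longrightarrow> \<bar>q x - f x\<bar> \<le> D"
proof -
  have D0: "0 \<le> D" using D[of \<one> \<one>] by (simp) 
  \<comment> \<open>The factor is \<open>n + 1\<close> because the induction starts at the power 0,
    where \<open>f \<one>\<close> already contributes up to \<open>D\<close>.\<close>
  have pw: "\<bar>f (x [^] n) - real n * f x\<bar> \<le> (real n + 1) * D" if x: "x \<in> carrier G" for x and n :: nat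
  proof (induction n)
    case 0
    show ?case using D[of \<one> \<one>] by simp
  next
    case (Suc n)
    then show ?case using D[of "x [^] n" x] x by (simp add: algebra_simps)
  qed
  define a where "a = (\<lambda>x (n::nat). f (x [^] n) / real n)"
  \<comment> \<open>Two averages are compared through the average at the product of their exponents;
    this yields the Cauchy property.\<close>
  have near: "\<bar>a x (n * m) - a x n\<bar> \<le> 2 * D / real n" if x: "x \<in> carrier G" and nm: "0 < n" "0 < m" for x n m
  proof -
    have "\<bar>f (x [^] (n * m)) - real m * f (x [^] n)\<bar> \<le> (real m + 1) * D"
      using pw[of "x [^] n" m] x by (simp add: nat_pow_pow)
    also have "\<dots> \<le> (2 * real m) * D" using nm D0 by (intro mult_right_mono) auto
    finally have "\<bar>f (x [^] (n * m)) - real m * f (x [^] n)\<bar> / (real n * real m) \<le> 2 * real m * D / (real n * real m)"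
      using nm by (intro divide_right_mono) auto
    moreover have "a x (n * m) - a x n = (f (x [^] (n * m)) - real m * f (x [^] n)) / (real n * real m)"
      using nm by (simp add: a_def field_simps)
    ultimately show ?thesis using nm by (simp add: abs_divide)
  qed
  have conv: "convergent (a x)" if x: "x \<in> carrier G" for x
  proof -
    have "Cauchy (a x)"
    proof (rule CauchyI)
      fix e :: real assume e: "0 < e"
      obtain M :: nat where M: "4 * D / e < real M" using reals_Archimedean2 by blast
      have "norm (a x m - a x n) < e" if "m \<ge> max M 1" "n \<ge> max M 1" for m n
      proof -
        have mn: "0 < m" "0 < n" "M \<le> m" "M \<le> n" using that by auto
        have s: "2 * D / real k < e / 2" if "M \<le> k" "0 < k" for k
        proof -
          have "4 * D / e < real k" using M that by linarith
          then show ?thesis using e that by (simp add: field_simps)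
        qed
        have "\<bar>a x (m * n) - a x m\<bar> \<le> 2 * D / real m" using near[OF x mn(1,2)] .
        moreover have "\<bar>a x (m * n) - a x n\<bar> \<le> 2 * D / real n"
          using near[OF x mn(2,1)] by (simp add: mult.commute)
        ultimately show ?thesis using s[OF mn(3,1)] s[OF mn(4,2)] by (simp add: abs_if split: if_splits)
      qed
      then show "\<exists>M. \<forall>m\<ge>M. \<forall>n\<ge>M. norm (a x m - a x n) < e" by blast
    qed
    then show ?thesis by (simp add: Cauchy_convergent_iff)
  qed
  define q where "q = (\<lambda>x. lim (a x))"
  have lim: "a x \<longlonglongrightarrow> q x" if "x \<in> carrier G" for x
    using conv[OF that] by (simp add: q_def convergent_LIMSEQ_iff)
  have close: "\<bar>q x - f x\<bar> \<le> D" if x: "x \<in> carrier G" for x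
  proof -
    have l1: "(\<lambda>n. \<bar>a x n - f x\<bar>) \<longlonglongrightarrow> \<bar>q x - f x\<bar>" by (intro tendsto_intros lim x)
    have l2: "(\<lambda>n. (1 + 1 / real n) * D) \<longlonglongrightarrow> (1 + 0) * D"
      by (intro tendsto_intros lim_const_over_n)
    have "\<bar>a x n - f x\<bar> \<le> (1 + 1 / real n) * D" if "n \<ge> 1" for n
    proof -
      have "a x n - f x = (f (x [^] n) - real n * f x) / real n" using that by (simp add: a_def field_simps)
      then have "\<bar>a x n - f x\<bar> \<le> (real n + 1) * D / real n"
        using pw[OF x, of n] that by (simp add: abs_divide divide_right_mono)
      also have "\<dots> = (1 + 1 / real n) * D" using that by (simp add: field_simps)
      finally show ?thesis .
    qed
    then have "\<bar>q x - f x\<bar> \<le> (1 + 0) * D" by (intro LIMSEQ_le[OF l1 l2]) blast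
    then show ?thesis by simp
  qed
  have hom: "q (x [^] k) = real k * q x" if x: "x \<in> carrier G" for x and k :: nat
  proof (cases "k = 0")
    case True
    have "(\<lambda>n. f \<one> / real n) \<longlonglongrightarrow> 0" by (rule lim_const_over_n)
    then have "q \<one> = 0" using LIMSEQ_unique[OF lim[OF one_closed]] by (simp add: a_def)
    then show ?thesis using True by simp
  next
    case False
    then have "(\<lambda>n. real k * a x (k * n)) \<longlonglongrightarrow> real k * q x"
      by (intro tendsto_intros LIMSEQ_subseq_LIMSEQ[OF lim[OF x], unfolded comp_def] strict_monoI) auto
    moreover have "real k * a x (k * n) = a (x [^] k) n" for n
      using False x by (simp add: a_def nat_pow_pow field_simps)
    ultimately show ?thesis using LIMSEQ_unique[OF lim[of "x [^] k"]] x by simp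
  qed
  \<comment> \<open>One \<open>D\<close> is the defect of \<open>f\<close>, and one more is paid for
    each of the three replacements of \<open>f\<close> by \<open>q\<close>.\<close>
  have "homogeneous_quasimorphism G q (4 * D)"
  proof
    fix x y assume xy: "x \<in> carrier G" "y \<in> carrier G"
    show "\<bar>q (x \<otimes> y) - q x - q y\<bar> \<le> 4 * D"
      using D[OF xy] close[OF xy(1)] close[OF xy(2)] close[of "x \<otimes> y"] xy by simp
  qed (rule hom)
  then show thesis using that close by blast
qed

section \<open>Actions on an interval with affine germs\<close>

text \<open>
  \<open>u\<close> is a coordinate near \<open>0\<close> with a pole at \<open>0\<close>, in which the one-sided germs at fixed points
  become affine: \<open>1 / s\<close> for piecewise linear and \<open>cot (\<pi> s)\<close> for piecewise projective maps.
\<close>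

locale germ_affine_action = group G for G (structure) +
  fixes T :: "'a \<Rightarrow> real \<Rightarrow> real" and u :: "real \<Rightarrow> real" and r lo hi :: real
  assumes T_mult: "\<lbrakk>x \<in> carrier G; y \<in> carrier G\<rbrakk> \<Longrightarrow> T (x \<otimes> y) t = T y (T x t)"
    and T_one: "T \<one> t = t"
    and T_mono: "x \<in> carrier G \<Longrightarrow> strict_mono (T x)"
    and T_cont: "x \<in> carrier G \<Longrightarrow> continuous_on UNIV (T x)"
    and T_ends: "x \<in> carrier G \<Longrightarrow> T x lo = lo" "x \<in> carrier G \<Longrightarrow> T x hi = hi"
    and germ: "\<lbrakk>x \<in> carrier G; T x p = p; F \<in> {at_left p, at_right p}\<rbrakk> \<Longrightarrow>
                 \<exists>\<alpha> \<beta>. \<alpha> \<noteq> 0 \<and> (\<forall>\<^sub>F t in F. u (T x t - p) = \<alpha> * u (t - p) + \<beta>)"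
    and r_pos: "0 < r" and u_inj: "inj_on u ({-r<..<r} - {0})"
begin

definition has_germ :: "real \<Rightarrow> real filter \<Rightarrow> 'a \<Rightarrow> real \<Rightarrow> real \<Rightarrow> bool" where
  "has_germ p F x \<alpha> \<beta> \<longleftrightarrow> \<alpha> \<noteq> 0 \<and> (\<forall>\<^sub>F t in F. u (T x t - p) = \<alpha> * u (t - p) + \<beta>)"

lemma T_inv:
  assumes "x \<in> carrier G"
  shows "T (inv x) (T x t) = t" "T x (T (inv x) t) = t"
  using T_mult[of x "inv x" t] T_mult[of "inv x" x t] assms by (simp_all add: T_one)

lemma T_iff:
  assumes "x \<in> carrier G"
  shows "T x s < T x t \<longleftrightarrow> s < t" "T x s \<le> T x t \<longleftrightarrow> s \<le> t" "T x s = T x t \<longleftrightarrow> s = t"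
  using T_mono[OF assms] by (simp_all add: strict_mono_less strict_mono_less_eq strict_mono_eq)

lemma T_inv_fix: "x \<in> carrier G \<Longrightarrow> T x p = p \<Longrightarrow> T (inv x) p = p"
  by (metis T_inv(1))

lemma T_tendsto:
  assumes x: "x \<in> carrier G"
  shows "(T x \<longlongrightarrow> T x p) (at p within S)"
proof -
  have "isCont (T x) p" using T_cont[OF x] by (simp add: continuous_on_eq_continuous_at)
  then have "(T x \<longlongrightarrow> T x p) (at p)" by (simp add: isCont_def)
  then show ?thesis by (rule tendsto_within_subset) simp
qed

lemma filterlim_T:
  assumes x: "x \<in> carrier G" and p: "T x p = p" and F: "F \<in> {at_left p, at_right p}"
  shows "filterlim (T x) F F"
proof -
  have "filterlim (T x) (at_right p) (at_right p)"
  proof (rule filterlim_at_withinI)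
    show "\<forall>\<^sub>F t in at_right p. T x t \<in> {p<..} - {p}"
      using eventually_at_right_less[of p]
      by eventually_elim (use T_iff(1)[OF x, of p] p in auto)
  qed (use T_tendsto[OF x, of p] p in simp)
  moreover have "filterlim (T x) (at_left p) (at_left p)"
  proof (rule filterlim_at_withinI)
    have "\<forall>\<^sub>F t in at_left p. t < p" by (simp add: eventually_at_filter)
    then show "\<forall>\<^sub>F t in at_left p. T x t \<in> {..<p} - {p}"
      by eventually_elim (use T_iff(1)[OF x, of _ p] p in auto)
  qed (use T_tendsto[OF x, of p] p in simp)
  ultimately show ?thesis using F by auto
qed

lemma filterlim_shift:
  fixes p :: real
  assumes "F \<in> {at_left p, at_right p}"
  shows "filterlim (\<lambda>t. t - p) (at 0) F"
proof (rule filterlim_atI)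
  have "((\<lambda>t. t - p) \<longlongrightarrow> p - p) (at p within S)" for S
    by (rule tendsto_diff[OF tendsto_ident_at tendsto_const])
  then show "((\<lambda>t. t - p) \<longlongrightarrow> 0) F" using assms by auto
  show "\<forall>\<^sub>F t in F. t - p \<noteq> 0" using assms by (auto simp: eventually_at_filter)
qed

lemma u_inj_eventually: "\<forall>\<^sub>F s in at 0. s \<in> {-r<..<r} - {0}"
  using eventually_at_in_open[of "{-r<..<r}" 0] r_pos by simp

lemma has_germ_mult:
  assumes x: "x \<in> carrier G" "T x p = p" and y: "y \<in> carrier G" and F: "F \<in> {at_left p, at_right p}"
    and gx: "has_germ p F x \<alpha> \<beta>" and gy: "has_germ p F y \<gamma> \<delta>"
  shows "has_germ p F (x \<otimes> y) (\<gamma> * \<alpha>) (\<gamma> * \<beta> + \<delta>)"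
proof -
  have "\<forall>\<^sub>F t in F. u (T y (T x t) - p) = \<gamma> * u (T x t - p) + \<delta>"
    by (rule eventually_compose_filterlim[OF conjunct2[OF gy[unfolded has_germ_def]] filterlim_T[OF x F]])
  moreover have "\<forall>\<^sub>F t in F. u (T x t - p) = \<alpha> * u (t - p) + \<beta>" using gx by (simp add: has_germ_def)
  ultimately have "\<forall>\<^sub>F t in F. u (T (x \<otimes> y) t - p) = \<gamma> * \<alpha> * u (t - p) + (\<gamma> * \<beta> + \<delta>)"
    by eventually_elim (simp add: T_mult x y algebra_simps)
  then show ?thesis using gx gy by (simp add: has_germ_def)
qed

lemma has_germ_inv:
  assumes x: "x \<in> carrier G" "T x p = p" and F: "F \<in> {at_left p, at_right p}"
    and gx: "has_germ p F x \<alpha> \<beta>"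
  shows "has_germ p F (inv x) (1 / \<alpha>) (- \<beta> / \<alpha>)"
proof -
  have "\<forall>\<^sub>F t in F. u (T x (T (inv x) t) - p) = \<alpha> * u (T (inv x) t - p) + \<beta>"
    by (rule eventually_compose_filterlim[OF conjunct2[OF gx[unfolded has_germ_def]]
          filterlim_T[OF inv_closed[OF x(1)] T_inv_fix[OF x] F]])
  then have "\<forall>\<^sub>F t in F. u (T (inv x) t - p) = 1 / \<alpha> * u (t - p) + - \<beta> / \<alpha>"
    by eventually_elim (use x gx in \<open>simp add: T_inv has_germ_def field_simps\<close>)
  then show ?thesis using gx by (simp add: has_germ_def)
qed

lemma T_mult_fix: "\<lbrakk>x \<in> carrier G; y \<in> carrier G; T x p = p; T y p = p\<rbrakk> \<Longrightarrow> T (x \<otimes> y) p = p"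
  by (simp add: T_mult)

text \<open>Linear parts multiply, so a commutator has linear part 1. The translation part is
  recorded explicitly because it collapses to 0 when \<alpha> = \<gamma> = 1, which is the second
  step of metabelianity.\<close>

lemma has_germ_commut:
  assumes x: "x \<in> carrier G" "T x p = p" and y: "y \<in> carrier G" "T y p = p"
    and F: "F \<in> {at_left p, at_right p}"
    and gx: "has_germ p F x \<alpha> \<beta>" and gy: "has_germ p F y \<gamma> \<delta>"
  shows "has_germ p F (commut G x y) 1 (\<gamma> * (\<alpha> * (1 / \<gamma> * (- \<beta> / \<alpha>) + - \<delta> / \<gamma>) + \<beta>) + \<delta>)"
proof -
  have nz: "\<alpha> \<noteq> 0" "\<gamma> \<noteq> 0" using gx gy by (auto simp: has_germ_def)
  note fixes_p = T_mult_fix T_inv_fix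
  have "has_germ p F (commut G x y) (\<gamma> * (\<alpha> * (1 / \<gamma> * (1 / \<alpha>))))
     (\<gamma> * (\<alpha> * (1 / \<gamma> * (- \<beta> / \<alpha>) + - \<delta> / \<gamma>) + \<beta>) + \<delta>)"
    unfolding commut_def using x y F
    by (intro has_germ_mult has_germ_inv gx gy) (auto intro!: fixes_p)
  then show ?thesis using nz by simp
qed

lemma has_germ_conj:
  assumes x: "x \<in> carrier G" "T x p = p" and y: "y \<in> carrier G" "T y p = p"
    and F: "F \<in> {at_left p, at_right p}"
    and gx: "has_germ p F x \<alpha> \<beta>" and gy: "has_germ p F y \<gamma> \<delta>"
  shows "\<exists>\<epsilon>. has_germ p F (x \<otimes> y \<otimes> inv x) \<gamma> \<epsilon>"
proof -
  have nz: "\<alpha> \<noteq> 0" using gx by (auto simp: has_germ_def)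
  have "has_germ p F (x \<otimes> y \<otimes> inv x) (1 / \<alpha> * (\<gamma> * \<alpha>)) (1 / \<alpha> * (\<gamma> * \<beta> + \<delta>) + - \<beta> / \<alpha>)"
    using x y F by (intro has_germ_mult has_germ_inv gx gy) (auto intro!: T_mult_fix)
  then show ?thesis using nz by auto
qed

text \<open>Once \<open>t - p\<close> and its image are both close to 0, injectivity of
  \<open>u\<close> allows the coordinate to be cancelled.\<close>

lemma trivial_germ:
  assumes x: "x \<in> carrier G" "T x p = p" and F: "F \<in> {at_left p, at_right p}"
    and g: "has_germ p F x 1 0"
  shows "\<forall>\<^sub>F t in F. T x t = t"
proof -
  have 1: "\<forall>\<^sub>F t in F. t - p \<in> {-r<..<r} - {0}"
    using eventually_compose_filterlim[OF u_inj_eventually filterlim_shift[OF F]] .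
  have 2: "\<forall>\<^sub>F t in F. T x t - p \<in> {-r<..<r} - {0}"
    using eventually_compose_filterlim[OF 1 filterlim_T[OF x F]] .
  have "\<forall>\<^sub>F t in F. u (T x t - p) = u (t - p)" using g by (simp add: has_germ_def)
  with 1 2 show ?thesis
  proof eventually_elim
    case (elim t)
    then have "T x t - p = t - p" using inj_onD[OF u_inj] by blast
    then show ?case by simp
  qed
qed

text \<open>An affine map other than the identity has at most one fixed point, and \<open>u\<close>
  takes that value at most once near 0. If \<open>p\<close> itself is moved, continuity is
  enough.\<close>

lemma fix_or_move:
  assumes x: "x \<in> carrier G" and F: "F \<in> {at_left p, at_right p}"
  shows "(\<forall>\<^sub>F t in F. T x t = t) \<or> (\<forall>\<^sub>F t in F. T x t \<noteq> t)"
proof (cases "T x p = p")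
  case False
  have "((\<lambda>t. T x t - t) \<longlongrightarrow> T x p - p) F"
    using F T_tendsto[OF x, of p] by (auto intro!: tendsto_intros)
  then have "\<forall>\<^sub>F t in F. T x t - t \<noteq> 0"
    by (rule tendsto_imp_eventually_ne) (use False in simp)
  then show ?thesis by simp
next
  case True
  then obtain \<alpha> \<beta> where g: "has_germ p F x \<alpha> \<beta>" using germ[OF x _ F] by (auto simp: has_germ_def)
  show ?thesis
  proof (cases "\<alpha> = 1 \<and> \<beta> = 0")
    case True
    then show ?thesis using trivial_germ[OF x \<open>T x p = p\<close> F] g by auto
  next
    case False
    have avoid: "\<forall>\<^sub>F t in F. u (t - p) \<noteq> v" for v
    proof -
      have "\<forall>\<^sub>F s in at 0. u s \<noteq> v"
      proof (cases "\<exists>s0\<in>{-r<..<r} - {0}. u s0 = v")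
        case True
        then obtain s0 where s0: "s0 \<in> {-r<..<r} - {0}" "u s0 = v" by blast
        then have "\<forall>\<^sub>F s in nhds 0. s \<noteq> s0" by (intro t1_space_nhds) auto
        then have "\<forall>\<^sub>F s in at 0. s \<noteq> s0" by (simp add: eventually_at_filter eventually_mono)
        with u_inj_eventually show ?thesis
          by eventually_elim (use s0 inj_onD[OF u_inj] in blast)
      next
        case False
        from u_inj_eventually show ?thesis by (rule eventually_mono) (use False in blast)
      qed
      then show ?thesis using eventually_compose_filterlim filterlim_shift[OF F] by blast
    qed
    have "\<forall>\<^sub>F t in F. u (T x t - p) = \<alpha> * u (t - p) + \<beta>" using g by (simp add: has_germ_def)
    \<comment> \<open>The avoided value is the fixed point of the affine map. For \<alpha> = 1 the
      quotient is 0 by the convention on division; in that case \<beta> is nonzero, and this alone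
      excludes fixed points.\<close>
    with avoid[of "\<beta> / (1 - \<alpha>)"] have "\<forall>\<^sub>F t in F. T x t \<noteq> t"
    proof eventually_elim
      case (elim t)
      show ?case
      proof
        assume "T x t = t"
        then have "(1 - \<alpha>) * u (t - p) = \<beta>" using elim by (simp add: algebra_simps)
        then show False using elim False by (cases "\<alpha> = 1") (auto simp: field_simps)
      qed
    qed
    then show ?thesis ..
  qed
qed

end

section \<open>One-sided dichotomies and gaps of a fixed set\<close>

lemma eventually_conj_or_not:
  assumes PQ: "(\<forall>\<^sub>F t in F. P t) \<or> (\<forall>\<^sub>F t in F. \<not> P t)" "(\<forall>\<^sub>F t in F. Q t) \<or> (\<forall>\<^sub>F t in F. \<not> Q t)"
  shows "(\<forall>\<^sub>F t in F. P t \<and> Q t) \<or> (\<forall>\<^sub>F t in F. \<not> (P t \<and> Q t))"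
proof -
  consider "(\<forall>\<^sub>F t in F. P t) \<and> (\<forall>\<^sub>F t in F. Q t)" | "\<forall>\<^sub>F t in F. \<not> P t" | "\<forall>\<^sub>F t in F. \<not> Q t"
    using PQ by argo
  then show ?thesis
  proof cases
    case 1
    then show ?thesis by (simp add: eventually_conj_iff)
  next
    case 2
    then have "\<forall>\<^sub>F t in F. \<not> (P t \<and> Q t)" by (rule eventually_mono) simp
    then show ?thesis ..
  next
    case 3
    then have "\<forall>\<^sub>F t in F. \<not> (P t \<and> Q t)" by (rule eventually_mono) simp
    then show ?thesis ..
  qed
qed

lemma eventually_Icc_or_not:
  fixes p :: real
  assumes F: "F \<in> {at_left p, at_right p}"
  shows "(\<forall>\<^sub>F t in F. t \<in> {a..b}) \<or> (\<forall>\<^sub>F t in F. t \<notin> {a..b})"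
proof -
  have ord: "(\<forall>\<^sub>F t in F. t \<le> v) \<or> (\<forall>\<^sub>F t in F. \<not> t \<le> v)" "(\<forall>\<^sub>F t in F. v \<le> t) \<or> (\<forall>\<^sub>F t in F. \<not> v \<le> t)" for v
  proof -
    have id: "((\<lambda>t. t) \<longlongrightarrow> p) F" using F by auto
    consider "p < v" | "v < p" | "v = p" "F = at_left p" | "v = p" "F = at_right p" using F by force
    then have "(\<forall>\<^sub>F t in F. t < v) \<or> (\<forall>\<^sub>F t in F. v < t)"
      by cases (use order_tendstoD[OF id] eventually_at_right_less in \<open>auto simp: eventually_at_filter\<close>)
    then consider "\<forall>\<^sub>F t in F. t < v" | "\<forall>\<^sub>F t in F. v < t" by blast
    then have "((\<forall>\<^sub>F t in F. t \<le> v) \<and> (\<forall>\<^sub>F t in F. \<not> v \<le> t)) \<or> ((\<forall>\<^sub>F t in F. v \<le> t) \<and> (\<forall>\<^sub>F t in F. \<not> t \<le> v))"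
    proof cases
      case 1
      then have "(\<forall>\<^sub>F t in F. t \<le> v) \<and> (\<forall>\<^sub>F t in F. \<not> v \<le> t)" by (auto elim: eventually_mono)
      then show ?thesis by blast
    next
      case 2
      then have "(\<forall>\<^sub>F t in F. v \<le> t) \<and> (\<forall>\<^sub>F t in F. \<not> t \<le> v)" by (auto elim: eventually_mono)
      then show ?thesis by blast
    qed
    then show "(\<forall>\<^sub>F t in F. t \<le> v) \<or> (\<forall>\<^sub>F t in F. \<not> t \<le> v)" "(\<forall>\<^sub>F t in F. v \<le> t) \<or> (\<forall>\<^sub>F t in F. \<not> v \<le> t)"
      by blast+
  qed
  have "(\<forall>\<^sub>F t in F. a \<le> t \<and> t \<le> b) \<or> (\<forall>\<^sub>F t in F. \<not> (a \<le> t \<and> t \<le> b))"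
    by (intro eventually_conj_or_not ord)
  then show ?thesis by simp
qed

definition gaps :: "real set \<Rightarrow> (real \<times> real) set" where
  "gaps A = {(p, q). p \<in> A \<and> q \<in> A \<and> p < q \<and> {p<..<q} \<inter> A = {}}"

lemma gap_cover:
  assumes A: "closed A" "A \<subseteq> {lo..hi}" "lo \<in> A" "hi \<in> A" and t: "t \<in> {lo..hi}" "t \<notin> A"
  obtains p q where "(p, q) \<in> gaps A" "t \<in> {p<..<q}"
proof -
  define p where "p = Sup (A \<inter> {..t})"
  define q where "q = Inf (A \<inter> {t..})"
  have "p \<in> A \<inter> {..t}" unfolding p_def
    by (rule closed_contains_Sup) (use A t in \<open>auto intro!: closed_Int\<close>)
  moreover have "q \<in> A \<inter> {t..}" unfolding q_def
    by (rule closed_contains_Inf) (use A t in \<open>auto intro!: closed_Int\<close>)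
  moreover have "s \<le> p" if "s \<in> A" "s \<le> t" for s
    unfolding p_def by (rule cSup_upper) (use that in \<open>auto intro: bdd_aboveI[of _ t]\<close>)
  moreover have "q \<le> s" if "s \<in> A" "t \<le> s" for s
    unfolding q_def by (rule cInf_lower) (use that in \<open>auto intro: bdd_belowI[of _ t]\<close>)
  ultimately have "(p, q) \<in> gaps A" "t \<in> {p<..<q}"
    using t(2) by (force simp: gaps_def order.strict_iff_order)+
  then show thesis by (rule that)
qed

text \<open>Infinitely many gaps would have left ends accumulating from one side at some point. As
  these ends belong to \<open>A\<close>, the dichotomy puts a whole one-sided neighbourhood into
  \<open>A\<close>, but no gap can start inside an open interval contained in
  \<open>A\<close>.\<close>

lemma finite_gaps:
  assumes A: "A \<subseteq> {lo..hi}"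
    and dich: "\<And>p F. F \<in> {at_left p, at_right p} \<Longrightarrow> (\<forall>\<^sub>F t in F. t \<in> A) \<or> (\<forall>\<^sub>F t in F. t \<notin> A)"
  shows "finite (gaps A)"
proof (rule ccontr)
  assume inf: "infinite (gaps A)"
  define P where "P = fst ` gaps A"
  have PA: "P \<subseteq> A" by (auto simp: P_def gaps_def)
  have "q = q'" if "(p, q) \<in> gaps A" "(p, q') \<in> gaps A" for p q q'
  proof (rule ccontr)
    assume "q \<noteq> q'"
    then have "min q q' \<in> {p<..<max q q'} \<inter> A" using that by (auto simp: gaps_def min_def max_def)
    then show False using that by (auto simp: gaps_def max_def disjoint_iff split: if_splits)
  qed
  then have "inj_on fst (gaps A)" by (auto intro!: inj_onI)
  then have "infinite P" unfolding P_def using inf finite_imageD by blast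
  moreover have "bounded P" using PA A bounded_closed_interval[of lo hi] by (metis bounded_subset)
  ultimately obtain p where "p islimpt P" using bounded_infinite_imp_islimpt[of P P] by blast
  then have "\<exists>\<^sub>F t in at p. t \<in> P" by (simp add: islimpt_iff_eventually frequently_def)
  then obtain F where F: "F \<in> {at_left p, at_right p}" "\<exists>\<^sub>F t in F. t \<in> P"
    by (auto simp: frequently_def eventually_at_split)
  have "\<exists>\<^sub>F t in F. t \<in> A" using F(2) by (rule frequently_elim1) (use PA in blast)
  then have "\<not> (\<forall>\<^sub>F t in F. t \<notin> A)" by (simp add: frequently_def)
  then have ev: "\<forall>\<^sub>F t in F. t \<in> A" using dich[OF F(1)] by blast
  have "\<exists>l m. l < m \<and> {l<..<m} \<subseteq> A \<and> (\<forall>\<^sub>F t in F. t \<in> {l<..<m})"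
  proof (cases "F = at_right p")
    case True
    then obtain b where b: "p < b" "\<And>t. p < t \<Longrightarrow> t < b \<Longrightarrow> t \<in> A"
      using ev by (auto simp: eventually_at_right_field)
    then have "\<forall>\<^sub>F t in at_right p. t \<in> {p<..<b}" by (auto simp: eventually_at_right_field)
    then show ?thesis using True b by (intro exI[of _ p] exI[of _ b]) auto
  next
    case False
    then have F: "F = at_left p" using F(1) by simp
    then obtain b where b: "b < p" "\<And>t. b < t \<Longrightarrow> t < p \<Longrightarrow> t \<in> A"
      using ev by (auto simp: eventually_at_left_field)
    then have "\<forall>\<^sub>F t in at_left p. t \<in> {b<..<p}" by (auto simp: eventually_at_left_field)
    then show ?thesis using F b by (intro exI[of _ b] exI[of _ p]) auto
  qed
  then obtain l m where lm: "{l<..<m} \<subseteq> A" "\<forall>\<^sub>F t in F. t \<in> {l<..<m}" by blast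
  obtain t where t: "t \<in> P" "t \<in> {l<..<m}"
    using frequently_ex[OF frequently_eventually_conj[OF F(2) lm(2)]] by blast
  then obtain s where s: "(t, s) \<in> gaps A" by (auto simp: P_def)
  then have "t < min s m" using t by (auto simp: gaps_def)
  then obtain v where "t < v" "v < min s m" using dense by blast
  then have "v \<in> A \<inter> {t<..<s}" using t lm by auto
  then show False using s by (auto simp: gaps_def)
qed

section \<open>Normal series of a group fixing a closed set pointwise\<close>

context germ_affine_action
begin

text \<open>Each gap contributes its two ends, each approached from inside the gap.\<close>

definition end_germs :: "real set \<Rightarrow> (real \<times> real filter) set" where
  "end_germs A = {(p, F). (\<exists>q. (p, q) \<in> gaps A) \<and> F = at_right p \<or> (\<exists>q. (q, p) \<in> gaps A) \<and> F = at_left p}"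

lemma end_germsD:
  "(p, F) \<in> end_germs A \<Longrightarrow> F \<in> {at_left p, at_right p} \<and> p \<in> A"
  by (auto simp: end_germs_def gaps_def)

text \<open>The joint kernel of the linear parts of the germs.\<close>

definition translation_germs :: "real set \<Rightarrow> 'a set" where
  "translation_germs A = {x \<in> carrier G. \<forall>(p, F)\<in>end_germs A. \<exists>\<beta>. has_germ p F x 1 \<beta>}"

text \<open>Being the identity near both ends of a gap means moving only points of a compact subset
  of it. The parameter \<open>J\<close>, the set of gaps in which points may be moved, makes an
  induction over gaps possible.\<close>

definition interior_part :: "real set \<Rightarrow> (real \<times> real) set \<Rightarrow> 'a set" where
  "interior_part A J = {x \<in> carrier G. (\<forall>(p, F)\<in>end_germs A. \<forall>\<^sub>F t in F. T x t = t) \<and>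
     (\<forall>t\<in>{lo..hi}. t \<notin> (\<Union>(p, q)\<in>J. {p<..<q}) \<longrightarrow> T x t = t)}"

end

text \<open>The situation reached after passing to all elements that fix a given common fixed set.
  The group then preserves every gap, and by \<open>A_move\<close> no point of a gap is fixed by the
  whole group.\<close>

locale fixing_action = germ_affine_action +
  fixes A :: "real set"
  assumes A_fix: "\<lbrakk>x \<in> carrier G; t \<in> A\<rbrakk> \<Longrightarrow> T x t = t"
    and A_closed: "closed A" and A_sub: "A \<subseteq> {lo..hi}" and A_ends: "lo \<in> A" "hi \<in> A"
    and A_move: "t \<in> {lo..hi} - A \<Longrightarrow> \<exists>x\<in>carrier G. T x t \<noteq> t"
    and A_gaps: "finite (gaps A)"
begin

lemma T_gap:
  assumes "x \<in> carrier G" "(p, q) \<in> gaps A"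
  shows "T x t \<in> {p<..<q} \<longleftrightarrow> t \<in> {p<..<q}"
proof -
  have "T x p = p" "T x q = q" using assms A_fix by (auto simp: gaps_def)
  then show ?thesis using T_iff(1)[OF assms(1), of p t] T_iff(1)[OF assms(1), of t q] by simp
qed

lemma T_Icc:
  assumes "x \<in> carrier G"
  shows "T x t \<in> {lo..hi} \<longleftrightarrow> t \<in> {lo..hi}"
  using T_iff(2)[OF assms, of lo t] T_iff(2)[OF assms, of t hi] T_ends[OF assms] by simp

lemma has_germ_end:
  assumes "x \<in> carrier G" "(p, F) \<in> end_germs A"
  obtains \<alpha> \<beta> where "has_germ p F x \<alpha> \<beta>"
  using germ[OF assms(1), of p F] A_fix assms end_germsD by (fastforce simp: has_germ_def)

lemma translation_germsI:
  assumes "x \<in> carrier G" "\<And>p F. (p, F) \<in> end_germs A \<Longrightarrow> \<exists>\<beta>. has_germ p F x 1 \<beta>"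
  shows "x \<in> translation_germs A"
  using assms by (auto simp: translation_germs_def)

lemma interior_partI:
  assumes "x \<in> carrier G" "\<And>p F. (p, F) \<in> end_germs A \<Longrightarrow> \<forall>\<^sub>F t in F. T x t = t"
    and "\<And>t. t \<in> {lo..hi} \<Longrightarrow> (\<And>p q. (p, q) \<in> J \<Longrightarrow> t \<notin> {p<..<q}) \<Longrightarrow> T x t = t"
  shows "x \<in> interior_part A J"
  using assms unfolding interior_part_def by blast

lemma interior_partD:
  assumes "x \<in> interior_part A J"
  shows "x \<in> carrier G" "(p, F) \<in> end_germs A \<Longrightarrow> \<forall>\<^sub>F t in F. T x t = t"
    and "t \<in> {lo..hi} \<Longrightarrow> (\<And>p q. (p, q) \<in> J \<Longrightarrow> t \<notin> {p<..<q}) \<Longrightarrow> T x t = t"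
  using assms unfolding interior_part_def by blast+

lemma normal_translation_germs: "translation_germs A \<lhd> G"
  unfolding normal_inv_iff
proof (intro conjI ballI subgroup.intro)
  show "translation_germs A \<subseteq> carrier G" by (auto simp: translation_germs_def)
  show "\<one> \<in> translation_germs A" by (auto simp: translation_germs_def has_germ_def T_one intro!: exI[of _ 0])
next
  fix x y assume "x \<in> translation_germs A" "y \<in> translation_germs A"
  then show "x \<otimes> y \<in> translation_germs A"
    using has_germ_mult[of x _ y _ 1 _ 1] A_fix
    by (fastforce simp: translation_germs_def dest: end_germsD)
next
  fix x assume "x \<in> translation_germs A"
  then show "inv x \<in> translation_germs A"
    using has_germ_inv[of x _ _ 1] A_fix by (fastforce simp: translation_germs_def dest: end_germsD)
next
  fix x y assume x: "x \<in> carrier G" and y: "y \<in> translation_germs A"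
  show "x \<otimes> y \<otimes> inv x \<in> translation_germs A"
  proof (rule translation_germsI)
    show "x \<otimes> y \<otimes> inv x \<in> carrier G" using x y by (simp add: translation_germs_def)
    fix p F assume pF: "(p, F) \<in> end_germs A"
    obtain \<alpha> \<beta> where gx: "has_germ p F x \<alpha> \<beta>" using has_germ_end[OF x pF] .
    obtain \<delta> where gy: "has_germ p F y 1 \<delta>" using y pF by (auto simp: translation_germs_def)
    show "\<exists>\<beta>. has_germ p F (x \<otimes> y \<otimes> inv x) 1 \<beta>"
      by (rule has_germ_conj[OF _ _ _ _ _ gx gy])
        (use x y pF A_fix in \<open>auto simp: translation_germs_def dest: end_germsD\<close>)
  qed
qed

lemma normal_interior_part:
  assumes J: "J \<subseteq> gaps A"
  shows "interior_part A J \<lhd> G"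
  unfolding normal_inv_iff
proof (intro conjI ballI subgroup.intro)
  show "interior_part A J \<subseteq> carrier G" by (auto simp: interior_part_def)
  show "\<one> \<in> interior_part A J" by (auto simp: interior_part_def T_one)
next
  fix x y assume xy: "x \<in> interior_part A J" "y \<in> interior_part A J"
  have "\<forall>\<^sub>F t in F. T (x \<otimes> y) t = t" if "(p, F) \<in> end_germs A" for p F
  proof -
    have "\<forall>\<^sub>F t in F. T x t = t" "\<forall>\<^sub>F t in F. T y t = t" using xy that by (auto simp: interior_part_def)
    then show ?thesis by eventually_elim (use xy in \<open>simp add: T_mult interior_part_def\<close>)
  qed
  then show "x \<otimes> y \<in> interior_part A J"
    using xy unfolding interior_part_def by (auto simp: T_mult)
next
  fix x assume x: "x \<in> interior_part A J"
  have Tfix: "T (inv x) t = t" if "T x t = t" for t using T_inv_fix x that by (auto simp: interior_part_def)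
  have "\<forall>\<^sub>F t in F. T (inv x) t = t" if "(p, F) \<in> end_germs A" for p F
  proof -
    have "\<forall>\<^sub>F t in F. T x t = t" using x that by (auto simp: interior_part_def)
    then show ?thesis by (rule eventually_mono) (rule Tfix)
  qed
  then show "inv x \<in> interior_part A J"
    using x Tfix unfolding interior_part_def by auto
next
  fix x y assume x: "x \<in> carrier G" and y: "y \<in> interior_part A J"
  have yc: "y \<in> carrier G" using y by (simp add: interior_part_def)
  have Tc: "T (x \<otimes> y \<otimes> inv x) t = t" if "T y (T x t) = T x t" for t
    using that x yc by (simp add: T_mult T_inv)
  show "x \<otimes> y \<otimes> inv x \<in> interior_part A J"
    unfolding interior_part_def
  proof (intro CollectI conjI ballI impI)
    show "x \<otimes> y \<otimes> inv x \<in> carrier G" using x yc by simp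
    fix pF assume pF: "pF \<in> end_germs A"
    show "case pF of (p, F) \<Rightarrow> \<forall>\<^sub>F t in F. T (x \<otimes> y \<otimes> inv x) t = t"
    proof (cases pF)
      case (Pair p F)
      then have F: "F \<in> {at_left p, at_right p}" "p \<in> A" using end_germsD pF by auto
      have "\<forall>\<^sub>F t in F. T y t = t" using y pF Pair by (auto simp: interior_part_def)
      from eventually_compose_filterlim[OF this filterlim_T[OF x A_fix[OF x F(2)] F(1)]]
      show ?thesis using Pair Tc by (auto elim: eventually_mono)
    qed
  next
    fix t assume t: "t \<in> {lo..hi}" "t \<notin> (\<Union>(p, q)\<in>J. {p<..<q})"
    then have "T x t \<in> {lo..hi}" "T x t \<notin> (\<Union>(p, q)\<in>J. {p<..<q})"
      using T_Icc[OF x] T_gap[OF x] J by blast+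
    then have "T y (T x t) = T x t" using y unfolding interior_part_def by blast
    then show "T (x \<otimes> y \<otimes> inv x) t = t" by (rule Tc)
  qed
qed

text \<open>Otherwise the images of \<open>c\<close> stay below \<open>d\<close>, and their supremum
  \<open>s\<close> lies in the gap. The group permutes these images, so no element moves
  \<open>s\<close> upwards; applied to inverses as well, this makes \<open>s\<close> a common fixed
  point in a gap, contrary to \<open>A_move\<close>.\<close>

lemma displacement:
  assumes pq: "(p, q) \<in> gaps A" and c: "c \<in> {p<..<q}" and d: "d < q"
  shows "\<exists>k\<in>carrier G. d < T k c"
proof (rule ccontr)
  assume "\<not> ?thesis"
  then have le: "T k c \<le> d" if "k \<in> carrier G" for k using that by force
  define S where "S = (\<lambda>k. T k c) ` carrier G"
  define s where "s = Sup S"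
  have bdd: "bdd_above S" using le by (auto simp: S_def intro!: bdd_aboveI)
  have up: "T k c \<le> s" if "k \<in> carrier G" for k
    unfolding s_def by (rule cSup_upper[OF _ bdd]) (use that in \<open>auto simp: S_def\<close>)
  have "s \<le> d" unfolding s_def by (rule cSup_least) (use le in \<open>auto simp: S_def\<close>)
  moreover have "c \<le> s" using up[of \<one>] by (simp add: T_one)
  ultimately have s: "s \<in> {p<..<q}" using c d by auto
  have mono: "T x s \<le> s" if x: "x \<in> carrier G" for x
  proof -
    have "s \<le> T (inv x) s"
      unfolding s_def
    proof (rule cSup_least)
      show "S \<noteq> {}" by (auto simp: S_def)
      fix v assume "v \<in> S"
      then obtain k where k: "k \<in> carrier G" "v = T k c" by (auto simp: S_def)
      then have "T x v \<le> s" using up[of "k \<otimes> x"] x by (simp add: T_mult)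
      then have "T (inv x) (T x v) \<le> T (inv x) s" using T_iff(2)[of "inv x"] x by simp
      then show "v \<le> T (inv x) (Sup S)" using T_inv(1)[OF x] by (simp add: s_def)
    qed
    then show ?thesis using T_iff(2)[OF x, of s "T (inv x) s"] T_inv(2)[OF x] by simp
  qed
  have "T x s = s" if x: "x \<in> carrier G" for x
    using mono[OF x] mono[of "inv x"] T_iff(2)[OF x, of "T (inv x) s" s] T_inv(2)[OF x] x by auto
  moreover have "s \<in> {lo..hi} - A" using s pq A_sub by (force simp: gaps_def)
  ultimately show False using A_move by blast
qed

text \<open>Gaps are treated one at a time because a single element need not displace compact sets
  in all gaps simultaneously. Displacement in the new gap makes the commutators trivial there;
  whatever they do in the gaps of \<open>J\<close> is absorbed by the induction hypothesis.\<close>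

lemma additive_interior_part:
  assumes hq: "homogeneous_quasimorphism G q D"
    and ker: "homogeneous_quasimorphism.additive_on G q {x \<in> carrier G. \<forall>t\<in>{lo..hi}. T x t = t}"
    and J: "J \<subseteq> gaps A"
  shows "homogeneous_quasimorphism.additive_on G q (interior_part A J)"
proof -
  interpret hq: homogeneous_quasimorphism G q D by fact
  have "finite J" using J A_gaps finite_subset by blast
  then show ?thesis
    using J
  proof (induction J)
    case empty
    show ?case using ker by (auto simp: hq.additive_on_def interior_part_def)
  next
    case (insert pq J)
    obtain p0 q0 where pq: "pq = (p0, q0)" by force
    have gap: "(p0, q0) \<in> gaps A" and JA: "J \<subseteq> gaps A" using insert.prems pq by auto
    have pq0: "p0 < q0" using gap by (simp add: gaps_def)
    let ?M = "interior_part A (insert pq J)"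
    interpret M: normal ?M G by (rule normal_interior_part) fact
    show ?case
    proof (rule hq.additive_on_displaced[OF normal_interior_part[OF JA]])
      show "hq.additive_on (interior_part A J)" using insert.IH JA by blast
      show "subgroup ?M G" by (rule M.subgroup_axioms)
      fix x y assume xM: "x \<in> ?M" and yM: "y \<in> ?M"
      have ends: "(p0, at_right p0) \<in> end_germs A" "(q0, at_left q0) \<in> end_germs A"
        using gap by (auto simp: end_germs_def)
      have "\<forall>\<^sub>F t in at_right p0. T x t = t \<and> T y t = t"
        using interior_partD(2)[OF xM ends(1)] interior_partD(2)[OF yM ends(1)] by eventually_elim simp
      then obtain c' where c': "p0 < c'" "\<And>t. p0 < t \<Longrightarrow> t < c' \<Longrightarrow> T x t = t \<and> T y t = t"
        unfolding eventually_at_right_field by blast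
      have "\<forall>\<^sub>F t in at_left q0. T x t = t \<and> T y t = t"
        using interior_partD(2)[OF xM ends(2)] interior_partD(2)[OF yM ends(2)] by eventually_elim simp
      then obtain d' where d': "d' < q0" "\<And>t. d' < t \<Longrightarrow> t < q0 \<Longrightarrow> T x t = t \<and> T y t = t"
        unfolding eventually_at_left_field by blast
      obtain c where c: "p0 < c" "c < min c' q0" using dense[of p0 "min c' q0"] c' pq0 by auto
      obtain d where d: "max d' p0 < d" "d < q0" using dense[of "max d' p0" q0] d' pq0 by auto
      define Z where "Z = {x, y, x \<otimes> y}"
      have ZM: "Z \<subseteq> ?M" using xM yM by (auto simp: Z_def)
      then have Zc: "Z \<subseteq> carrier G" using M.subset by auto
      have fixZ: "T v t = t" if "v \<in> Z" "T x t = t \<and> T y t = t" for v t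
        using that Zc by (auto simp: Z_def T_mult)
      have low: "T v t = t" if "v \<in> Z" "p0 < t" "t \<le> c" for v t
        by (rule fixZ[OF that(1) c'(2)]) (use that c in auto)
      have high: "T v t = t" if "v \<in> Z" "d \<le> t" "t < q0" for v t
        by (rule fixZ[OF that(1) d'(2)]) (use that d in auto)
      \<comment> \<open>Within this gap \<open>x\<close>, \<open>y\<close> and their product move
        only points between \<open>c\<close> and \<open>d\<close>, and \<open>k\<close> carries
        \<open>c\<close> beyond \<open>d\<close>: the moved set is disjoint from its image.\<close>
      obtain k where k: "k \<in> carrier G" "d < T k c" using displacement[OF gap, of c d] c d by auto
      have "inv k \<otimes> a \<otimes> k \<in> ?M \<and> (\<forall>v\<in>Z. commut G (inv k \<otimes> a \<otimes> k) v \<in> interior_part A J)"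
        if a: "a \<in> Z" for a
      proof (intro conjI ballI)
        define w where "w = inv k \<otimes> a \<otimes> k"
        have wM: "w \<in> ?M" unfolding w_def using M.inv_op_closed1[OF k(1)] a ZM by blast
        then show "inv k \<otimes> a \<otimes> k \<in> ?M" by (simp add: w_def)
        have wc: "w \<in> carrier G" using wM by auto
        \<comment> \<open>Points moved by \<open>w\<close> are images under \<open>k\<close> of
          points moved by \<open>a\<close>, so in this gap they lie above the image of
          \<open>c\<close>, hence above \<open>d\<close>.\<close>
        have w_low: "T w t = t" if "p0 < t" "t < q0" "t \<le> d" for t
        proof -
          have "T k (T (inv k) t) < T k c" using T_inv(2)[OF k(1)] k that by simp
          then have "T (inv k) t < c" using T_iff(1)[OF k(1)] by blast
          moreover have "T (inv k) t \<in> {p0<..<q0}" using T_gap[OF _ gap, of "inv k" t] k that by simp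
          ultimately have "T a (T (inv k) t) = T (inv k) t" using low[OF a] by simp
          then show ?thesis using k a Zc by (auto simp: w_def T_mult T_inv)
        qed
        fix v assume v: "v \<in> Z"
        then have vc: "v \<in> carrier G" using Zc by auto
        \<comment> \<open>In this gap \<open>w\<close> is the identity up to \<open>d\<close> and
          \<open>v\<close> is the identity from \<open>d\<close> on. Each of them preserves both
          sides of \<open>d\<close>.\<close>
        have com: "T (w \<otimes> v) t = T (v \<otimes> w) t" if t: "t \<in> {p0<..<q0}" for t
        proof (cases "t \<le> d")
          case True
          have "T v t \<le> T v d" using T_iff(2)[OF vc] True by simp
          then have "T v t \<le> d" using high[OF v, of d] d by simp
          then show ?thesis using w_low[of t] w_low[of "T v t"] T_gap[OF vc gap, of t] t True vc wc
            by (simp add: T_mult)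
        next
          case False
          have "T w d \<le> T w t" using T_iff(2)[OF wc] False by simp
          then have "d \<le> T w t" using w_low[of d] d by simp
          then show ?thesis using high[OF v, of t] high[OF v, of "T w t"] T_gap[OF wc gap, of t] t False vc wc
            by (simp add: T_mult)
        qed
        have cc: "T (commut G w v) t = t" if t: "t \<in> {p0<..<q0}" for t
        proof -
          define s where "s = T (inv (v \<otimes> w)) t"
          have s: "s \<in> {p0<..<q0}" using T_gap[OF _ gap, of "inv (v \<otimes> w)" t] vc wc t by (simp add: s_def)
          have ts: "T (v \<otimes> w) s = t" using T_inv(2)[of "v \<otimes> w" t] vc wc by (simp add: s_def)
          have "T (commut G w v) t = T (v \<otimes> w \<otimes> commut G w v) s" using ts vc wc by (simp add: T_mult)
          also have "\<dots> = T (w \<otimes> v) s" using mult_commut[OF wc vc] by simp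
          also have "\<dots> = t" using com[OF s] ts by simp
          finally show ?thesis .
        qed
        have cM: "commut G w v \<in> ?M"
          unfolding commut_def using wM v ZM by (intro M.m_closed M.m_inv_closed) auto
        have "commut G w v \<in> interior_part A J"
        proof (rule interior_partI)
          fix t assume t: "t \<in> {lo..hi}" "\<And>p q. (p, q) \<in> J \<Longrightarrow> t \<notin> {p<..<q}"
          show "T (commut G w v) t = t"
          proof (cases "t \<in> {p0<..<q0}")
            case False
            then show ?thesis using t pq by (intro interior_partD(3)[OF cM]) auto
          qed (rule cc)
        qed (fact interior_partD(1)[OF cM], rule interior_partD(2)[OF cM])
        then show "commut G (inv k \<otimes> a \<otimes> k) v \<in> interior_part A J" by (simp add: w_def)
      qed
      then show "\<exists>k\<in>carrier G. \<forall>u\<in>{x, y, x \<otimes> y}. inv k \<otimes> u \<otimes> k \<in> ?M \<and>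
          (\<forall>v\<in>{x, y, x \<otimes> y}. commut G (inv k \<otimes> u \<otimes> k) v \<in> interior_part A J)"
        using k(1) unfolding Z_def by blast
    qed
  qed
qed

text \<open>Additivity climbs the normal series in two steps: commutators of translation germs are
  trivial germs, and commutators of arbitrary affine germs are translation germs.\<close>

lemma additive_carrier:
  assumes hq: "homogeneous_quasimorphism G q D"
    and ker: "homogeneous_quasimorphism.additive_on G q {x \<in> carrier G. \<forall>t\<in>{lo..hi}. T x t = t}"
  shows "homogeneous_quasimorphism.additive_on G q (carrier G)"
proof -
  interpret hq: homogeneous_quasimorphism G q D by fact
  interpret N1: normal "translation_germs A" G by (rule normal_translation_germs)
  have fixA: "T x t = t" if "x \<in> carrier G" "t \<in> {lo..hi}" "\<And>p q. (p, q) \<in> gaps A \<Longrightarrow> t \<notin> {p<..<q}" for x t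
  proof (rule ccontr)
    assume "T x t \<noteq> t"
    then have "t \<notin> A" using A_fix that(1) by blast
    then show False using gap_cover[OF A_closed A_sub A_ends that(2)] that(3) by blast
  qed
  have "hq.additive_on (translation_germs A)"
  proof (rule hq.additive_on_commut)
    show "interior_part A (gaps A) \<lhd> G" by (rule normal_interior_part) simp
    show "hq.additive_on (interior_part A (gaps A))" by (rule additive_interior_part[OF hq ker]) simp
    show "translation_germs A \<subseteq> carrier G" by (rule N1.subset)
    fix x y assume xy: "x \<in> translation_germs A" "y \<in> translation_germs A"
    then have c: "x \<in> carrier G" "y \<in> carrier G" by auto
    have "\<forall>\<^sub>F t in F. T (commut G x y) t = t" if pF: "(p, F) \<in> end_germs A" for p F
    proof (rule trivial_germ)
      have p: "p \<in> A" "F \<in> {at_left p, at_right p}" using end_germsD[OF pF] by auto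
      show "F \<in> {at_left p, at_right p}" by fact
      show "commut G x y \<in> carrier G" using c by simp
      then show "T (commut G x y) p = p" using A_fix p by blast
      obtain \<beta> \<delta> where "has_germ p F x 1 \<beta>" "has_germ p F y 1 \<delta>"
        using xy pF unfolding translation_germs_def by blast
      from has_germ_commut[OF c(1) A_fix[OF c(1) p(1)] c(2) A_fix[OF c(2) p(1)] p(2) this]
      show "has_germ p F (commut G x y) 1 0" by simp
    qed
    then show "commut G x y \<in> interior_part A (gaps A)"
      by (intro interior_partI commut_closed c fixA)
  qed
  then show ?thesis
  proof (rule hq.additive_on_commut[OF normal_translation_germs])
    fix x y assume c: "x \<in> carrier G" "y \<in> carrier G"
    have "\<exists>\<beta>. has_germ p F (commut G x y) 1 \<beta>" if pF: "(p, F) \<in> end_germs A" for p F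
    proof -
      have p: "p \<in> A" "F \<in> {at_left p, at_right p}" using end_germsD[OF pF] by auto
      obtain \<alpha> \<beta> where gx: "has_germ p F x \<alpha> \<beta>" using has_germ_end[OF c(1) pF] .
      obtain \<gamma> \<delta> where gy: "has_germ p F y \<gamma> \<delta>" using has_germ_end[OF c(2) pF] .
      from has_germ_commut[OF c(1) A_fix[OF c(1) p(1)] c(2) A_fix[OF c(2) p(1)] p(2) gx gy]
      show ?thesis by blast
    qed
    then show "commut G x y \<in> translation_germs A" by (intro translation_germsI commut_closed c)
  qed simp
qed

end

lemma (in germ_affine_action) germ_affine_action_subgroup:
  assumes "subgroup H G"
  shows "germ_affine_action (G\<lparr>carrier := H\<rparr>) T u r lo hi"
proof -
  interpret H: subgroup H G by fact
  interpret H': group "G\<lparr>carrier := H\<rparr>" by (rule subgroup_imp_group) fact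
  show ?thesis
  proof
    show "\<exists>\<alpha> \<beta>. \<alpha> \<noteq> 0 \<and> (\<forall>\<^sub>F t in F. u (T x t - p) = \<alpha> * u (t - p) + \<beta>)"
      if "x \<in> carrier (G\<lparr>carrier := H\<rparr>)" "T x p = p" "F \<in> {at_left p, at_right p}" for x p F
      using germ[OF _ that(2,3)] that(1) by simp
  qed (simp_all add: T_mult T_one T_mono T_cont T_ends r_pos u_inj)
qed

text \<open>The action need not be faithful, and displacement says nothing about elements acting
  trivially on the interval; additivity on these is therefore a hypothesis. In a central extension
  the whole centre acts trivially.\<close>

theorem (in germ_affine_action) additive_of_additive_kernel:
  assumes hq: "homogeneous_quasimorphism G q D"
    and ker: "homogeneous_quasimorphism.additive_on G q {x \<in> carrier G. \<forall>t\<in>{lo..hi}. T x t = t}"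
    and lohi: "lo \<le> hi"
  shows "homogeneous_quasimorphism.additive_on G q (carrier G)"
proof -
  interpret hq: homogeneous_quasimorphism G q D by fact
  show ?thesis
    unfolding hq.additive_on_def
  proof (intro ballI)
    fix a b assume ab: "a \<in> carrier G" "b \<in> carrier G"
    define A where "A = {t \<in> {lo..hi}. T a t = t \<and> T b t = t}"
    \<comment> \<open>A subgroup containing \<open>a\<close> and \<open>b\<close> whose common fixed
      points in the interval are exactly \<open>A\<close>, since off \<open>A\<close> already
      \<open>a\<close> or \<open>b\<close> moves the point.\<close>
    define H where "H = {x \<in> carrier G. \<forall>t\<in>A. T x t = t}"
    have sub: "subgroup H G"
      by (rule subgroup.intro) (auto simp: H_def T_mult T_one T_inv_fix)
    let ?H = "G\<lparr>carrier := H\<rparr>"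
    interpret H: group ?H by (rule subgroup_imp_group[OF sub])
    interpret qH: homogeneous_quasimorphism ?H q D by (rule hq.homogeneous_quasimorphism_subgroup[OF sub])
    have HG: "x \<in> carrier G" if "x \<in> H" for x using that by (simp add: H_def)
    have dich: "(\<forall>\<^sub>F t in F. t \<in> A) \<or> (\<forall>\<^sub>F t in F. t \<notin> A)" if F: "F \<in> {at_left p, at_right p}" for p F
    proof -
      have "(\<forall>\<^sub>F t in F. t \<in> {lo..hi} \<and> T a t = t \<and> T b t = t) \<or>
            (\<forall>\<^sub>F t in F. \<not> (t \<in> {lo..hi} \<and> T a t = t \<and> T b t = t))"
        by (intro eventually_conj_or_not eventually_Icc_or_not[OF F]
            fix_or_move[OF ab(1) F] fix_or_move[OF ab(2) F])
      then show ?thesis by (simp add: A_def)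
    qed
    have "closed ({lo..hi} \<inter> {t. T a t = t} \<inter> {t. T b t = t})"
      by (intro closed_Int closed_Collect_eq T_cont ab continuous_on_id closed_atLeastAtMost)
    moreover have "A = {lo..hi} \<inter> {t. T a t = t} \<inter> {t. T b t = t}" by (auto simp: A_def)
    ultimately have closed: "closed A" by simp
    interpret S: germ_affine_action ?H T u r lo hi by (rule germ_affine_action_subgroup[OF sub])
    interpret F: fixing_action ?H T u r lo hi A
    proof
      show "finite (gaps A)" by (rule finite_gaps[OF _ dich]) (auto simp: A_def)
      show "closed A" by (rule closed)
      have "a \<in> H" "b \<in> H" using ab by (auto simp: H_def A_def)
      then show "\<exists>x\<in>carrier ?H. T x t \<noteq> t" if "t \<in> {lo..hi} - A" for t
        using that by (auto simp: A_def)
    qed (use lohi T_ends ab in \<open>auto simp: H_def A_def\<close>)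
    have "qH.additive_on (carrier ?H)"
      by (rule F.additive_carrier[OF qH.homogeneous_quasimorphism_axioms])
        (use ker HG in \<open>auto simp: qH.additive_on_def hq.additive_on_def\<close>)
    then have "\<forall>x\<in>H. \<forall>y\<in>H. q (x \<otimes> y) = q x + q y" by (simp add: qH.additive_on_def)
    moreover have "a \<in> H" "b \<in> H" using ab by (auto simp: H_def A_def)
    ultimately show "q (a \<otimes> b) = q a + q b" by blast
  qed
qed

section \<open>Central extensions and cocycles relative to a subgroup\<close>

text \<open>The unit carries a correction because \<omega> is not assumed to be normalised.\<close>

definition central_ext ::
  "('a, 'm) monoid_scheme \<Rightarrow> ('a \<Rightarrow> 'a \<Rightarrow> real) \<Rightarrow> ('a \<times> real) monoid" where
  "central_ext G \<omega> =
     \<lparr>partial_object.carrier = carrier G \<times> UNIV,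
      monoid.mult = (\<lambda>(g, s) (h, t). (g \<otimes>\<^bsub>G\<^esub> h, s + t + \<omega> g h)),
      monoid.one = (\<one>\<^bsub>G\<^esub>, - \<omega> \<one>\<^bsub>G\<^esub> \<one>\<^bsub>G\<^esub>)\<rparr>"

lemma central_ext_simps:
  "carrier (central_ext G \<omega>) = carrier G \<times> UNIV"
  "(g, s) \<otimes>\<^bsub>central_ext G \<omega>\<^esub> (h, t) = (g \<otimes>\<^bsub>G\<^esub> h, s + t + \<omega> g h)"
  "\<one>\<^bsub>central_ext G \<omega>\<^esub> = (\<one>\<^bsub>G\<^esub>, - \<omega> \<one>\<^bsub>G\<^esub> \<one>\<^bsub>G\<^esub>)"
  by (simp_all add: central_ext_def)

lemma fst_mult_central_ext: "fst (x \<otimes>\<^bsub>central_ext G \<omega>\<^esub> y) = fst x \<otimes>\<^bsub>G\<^esub> fst y"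
  by (cases x; cases y) (simp add: central_ext_simps)

locale bounded_cocycle = group G for G (structure) +
  fixes \<omega> :: "'a \<Rightarrow> 'a \<Rightarrow> real"
  assumes cocycle: "\<omega> \<in> bounded_cocycles2 G"
begin

abbreviation "E \<equiv> central_ext G \<omega>"

lemma cocycle_eq:
  "\<lbrakk>a \<in> carrier G; b \<in> carrier G; c \<in> carrier G\<rbrakk> \<Longrightarrow> \<omega> b c + \<omega> a (b \<otimes> c) = \<omega> (a \<otimes> b) c + \<omega> a b"
  using bounded_cocycles2D(2)[OF cocycle, of a b c] by linarith

lemma cocycle_one:
  assumes "g \<in> carrier G"
  shows "\<omega> \<one> g = \<omega> \<one> \<one>" "\<omega> g \<one> = \<omega> \<one> \<one>"
  using cocycle_eq[of \<one> \<one> g] cocycle_eq[of g \<one> \<one>] assms by simp_all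

lemma group_central_ext: "group E"
proof (rule groupI)
  fix x assume "x \<in> carrier E"
  then obtain g s where x: "x = (g, s)" "g \<in> carrier G" by (auto simp: central_ext_simps)
  then show "\<one>\<^bsub>E\<^esub> \<otimes>\<^bsub>E\<^esub> x = x" by (simp add: central_ext_simps cocycle_one(1)[OF x(2)])
  show "\<exists>y\<in>carrier E. y \<otimes>\<^bsub>E\<^esub> x = \<one>\<^bsub>E\<^esub>"
    using x by (intro bexI[of _ "(inv g, - s - \<omega> \<one> \<one> - \<omega> (inv g) g)"]) (auto simp: central_ext_simps)
next
  fix x y z assume xyz: "x \<in> carrier E" "y \<in> carrier E" "z \<in> carrier E"
  then show "x \<otimes>\<^bsub>E\<^esub> y \<otimes>\<^bsub>E\<^esub> z = x \<otimes>\<^bsub>E\<^esub> (y \<otimes>\<^bsub>E\<^esub> z)"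
    using cocycle_eq[of "fst x" "fst y" "fst z"]
    by (cases x; cases y; cases z) (simp add: central_ext_simps m_assoc)
qed (auto simp: central_ext_simps)

lemma cocycle_bound: obtains C where "0 \<le> C" "\<And>g h. \<bar>\<omega> g h\<bar> \<le> C"
proof -
  obtain C where C: "\<forall>g h. \<bar>\<omega> g h\<bar> \<le> C" using cocycle by (auto simp: bounded_cocycles2_def)
  moreover have "0 \<le> C" using C[rule_format, of \<one> \<one>] by linarith
  ultimately show thesis using that by blast
qed

text \<open>The second coordinate is a quasimorphism whose defect is bounded by the bound of
  \<omega>. After homogenisation it is exact on the central copy of the reals, and commutation with
  this copy gives exact translation behaviour on each fibre.\<close>

lemma central_ext_quasimorphism:
  obtains q D where "homogeneous_quasimorphism E q (4 * D)"
    and "\<And>g t. g \<in> carrier G \<Longrightarrow> q (g, t) = q (g, 0) + t"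
    and "\<And>g. g \<in> carrier G \<Longrightarrow> \<bar>q (g, 0)\<bar> \<le> D"
proof -
  interpret E: group E by (rule group_central_ext)
  obtain D where D: "\<And>g h. \<bar>\<omega> g h\<bar> \<le> D" using cocycle_bound by metis
  have "\<bar>snd (x \<otimes>\<^bsub>E\<^esub> y) - snd x - snd y\<bar> \<le> D" for x y
    by (cases x; cases y) (simp add: central_ext_simps D)
  then obtain q where hq: "homogeneous_quasimorphism E q (4 * D)"
    and qD: "\<And>x. x \<in> carrier E \<Longrightarrow> \<bar>q x - snd x\<bar> \<le> D"
    using E.homogenization[of snd D] by blast
  interpret hq: homogeneous_quasimorphism E q "4 * D" by (rule hq)
  \<comment> \<open>Subtracting \<open>\<omega> \<one> \<one>\<close> makes \<open>z\<close> a
    homomorphism from the reals onto the kernel of the extension.\<close>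
  define z where "z = (\<lambda>t. (\<one>, t - \<omega> \<one> \<one>))"
  have zc: "z t \<in> carrier E" for t by (simp add: z_def central_ext_simps)
  have snd_z: "snd (z t) = t - \<omega> \<one> \<one>" for t by (simp add: z_def)
  have zpow: "z t [^]\<^bsub>E\<^esub> n = z (real n * t)" for t and n :: nat
    by (induction n) (auto simp: z_def central_ext_simps algebra_simps)
  have qz: "q (z t) = t" for t
  proof -
    have "q (z t) - t = 0"
    proof (rule bounded_multiples_imp_zero)
      fix n :: nat
      show "\<bar>real n * (q (z t) - t)\<bar> \<le> D + \<bar>\<omega> \<one> \<one>\<bar>"
        using qD[OF zc, of "real n * t"] hq.q_pow[OF zc, of t n]
        by (simp add: zpow snd_z algebra_simps)
    qed
    then show ?thesis by simp
  qed
  have "q (g, t) = q (g, 0) + t" if g: "g \<in> carrier G" for g t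
  proof -
    have gc: "(g, 0) \<in> carrier E" using g by (simp add: central_ext_simps)
    have mult: "(g, 0) \<otimes>\<^bsub>E\<^esub> z t = (g, t)" "z t \<otimes>\<^bsub>E\<^esub> (g, 0) = (g, t)"
      using g by (simp_all add: z_def central_ext_simps cocycle_one[OF g])
    then show ?thesis using hq.q_mult_commuting[OF gc zc[of t]] qz by simp
  qed
  moreover have "\<bar>q (g, 0)\<bar> \<le> D" if "g \<in> carrier G" for g
    using qD[of "(g, 0)"] that by (simp add: central_ext_simps)
  ultimately show thesis using that hq by blast
qed

end

lemma (in bounded_cocycle) subgroup_central_ext:
  assumes "subgroup H G"
  shows "subgroup (H \<times> UNIV) E"
proof -
  interpret H: subgroup H G by fact
  interpret E: group E by (rule group_central_ext)
  show ?thesis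
  proof (rule E.subgroupI)
    show "H \<times> UNIV \<subseteq> carrier E" using H.subset by (auto simp: central_ext_simps)
    show "H \<times> UNIV \<noteq> {}" using H.one_closed by blast
    show "x \<otimes>\<^bsub>E\<^esub> y \<in> H \<times> UNIV" if "x \<in> H \<times> UNIV" "y \<in> H \<times> UNIV" for x y
      using that by (auto simp: central_ext_simps)
    show "inv\<^bsub>E\<^esub> x \<in> H \<times> UNIV" if x: "x \<in> H \<times> UNIV" for x
    proof -
      have xc: "x \<in> carrier E" "fst x \<in> H" using x H.subset by (auto simp: central_ext_simps)
      then have k: "fst (inv\<^bsub>E\<^esub> x) \<in> carrier G" using E.inv_closed[of x] by (auto simp: central_ext_simps)
      have "fst x \<otimes> fst (inv\<^bsub>E\<^esub> x) = fst (x \<otimes>\<^bsub>E\<^esub> inv\<^bsub>E\<^esub> x)" by (simp add: fst_mult_central_ext)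
      also have "\<dots> = \<one>" using xc by (simp add: central_ext_simps(3))
      finally have "fst (inv\<^bsub>E\<^esub> x) = inv (fst x)"
        using k xc H.subset by (metis H.mem_carrier inv_equality inv_inv inv_closed inv_comm)
      then have "fst (inv\<^bsub>E\<^esub> x) \<in> H" using xc by simp
      then show ?thesis by (metis SigmaI UNIV_I prod.collapse)
    qed
  qed
qed

definition relative_cocycles :: "('a, 'm) monoid_scheme \<Rightarrow> 'a set \<Rightarrow> ('a \<Rightarrow> 'a \<Rightarrow> real) set" where
  "relative_cocycles G H =
     {v \<in> bounded_cocycles2 G. \<forall>h\<in>H. \<forall>g\<in>carrier G. v h g = 0 \<and> v g h = 0}"

text \<open>
  The homogeneous quasimorphism \<open>q\<close> on the central extension picks out the copy \<open>H \<inter> ker q\<close> of \<open>H\<close>.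
  Since \<open>q\<close> is invariant under conjugation, \<open>h s h' \<mapsto> lift h \<cdot> (s, 0) \<cdot> lift h'\<close> is well defined, and
  this section of the extension is equivariant under \<open>H\<close> on both sides.
\<close>

lemma (in bounded_cocycle) relative_representative:
  assumes H: "subgroup H G" and s: "s \<in> carrier G - H"
    and cover: "\<And>g. g \<in> carrier G - H \<Longrightarrow> \<exists>h\<in>H. \<exists>h'\<in>H. g = h \<otimes> s \<otimes> h'"
    and add: "\<And>q D. homogeneous_quasimorphism E q D \<Longrightarrow>
                homogeneous_quasimorphism.additive_on E q (H \<times> UNIV)"
  obtains \<psi> C where "\<And>g. g \<in> carrier G \<Longrightarrow> \<bar>\<psi> g\<bar> \<le> C"
    and "\<And>h g. \<lbrakk>h \<in> H; g \<in> carrier G\<rbrakk> \<Longrightarrow> \<omega> h g + \<psi> h + \<psi> g - \<psi> (h \<otimes> g) = 0"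
    and "\<And>h g. \<lbrakk>h \<in> H; g \<in> carrier G\<rbrakk> \<Longrightarrow> \<omega> g h + \<psi> g + \<psi> h - \<psi> (g \<otimes> h) = 0"
proof -
  interpret H: subgroup H G by fact
  interpret E: group E by (rule group_central_ext)
  obtain q D where hq: "homogeneous_quasimorphism E q (4 * D)"
    and qt: "\<And>g t. g \<in> carrier G \<Longrightarrow> q (g, t) = q (g, 0) + t"
    and qD: "\<And>g. g \<in> carrier G \<Longrightarrow> \<bar>q (g, 0)\<bar> \<le> D"
    using central_ext_quasimorphism by metis
  interpret hq: homogeneous_quasimorphism E q "4 * D" by (rule hq)
  have addH: "hq.additive_on (H \<times> UNIV)" by (rule add[OF hq])
  obtain C where C: "0 \<le> C" "\<And>g h. \<bar>\<omega> g h\<bar> \<le> C" using cocycle_bound by metis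
  define lift where "lift = (\<lambda>h. (h, - q (h, 0)))"
  define S where "S = (s, 0 :: real)"
  have Sc: "S \<in> carrier E" using s by (simp add: S_def central_ext_simps)
  have liftc: "lift h \<in> carrier E" if "h \<in> H" for h using that by (simp add: lift_def central_ext_simps)
  have q_lift: "q (lift h) = 0" if "h \<in> H" for h
    using qt[of h "- q (h, 0)"] that by (simp add: lift_def)
  have liftI: "x = lift (fst x)" if "x \<in> carrier E" "q x = 0" for x
    using qt[of "fst x" "snd x"] that by (cases x) (auto simp: lift_def central_ext_simps)
  have fst_lift: "fst (lift h) = h" for h by (simp add: lift_def)
  have lift_mult: "lift h \<otimes>\<^bsub>E\<^esub> lift h' = lift (h \<otimes> h')" if "h \<in> H" "h' \<in> H" for h h'
  proof -
    have "q (lift h \<otimes>\<^bsub>E\<^esub> lift h') = 0"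
      using addH that q_lift by (auto simp: hq.additive_on_def lift_def)
    then show ?thesis
      using liftI[of "lift h \<otimes>\<^bsub>E\<^esub> lift h'"] liftc that by (simp add: fst_mult_central_ext fst_lift)
  qed
  have well_def: "lift h \<otimes>\<^bsub>E\<^esub> S \<otimes>\<^bsub>E\<^esub> lift h' = lift k \<otimes>\<^bsub>E\<^esub> S \<otimes>\<^bsub>E\<^esub> lift k'"
    if HH: "h \<in> H" "h' \<in> H" "k \<in> H" "k' \<in> H" and eq: "h \<otimes> s \<otimes> h' = k \<otimes> s \<otimes> k'" for h h' k k'
  proof -
    note sc = s[THEN DiffD1] and Hc = HH[THEN H.mem_carrier]
    \<comment> \<open>\<open>m\<close> measures the ambiguity of the decomposition. The equation
      forces the conjugate of \<open>m\<close> by \<open>s\<close> back into \<open>H\<close>, and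
      since conjugation preserves \<open>q = 0\<close>, the conjugate of \<open>lift m\<close> is
      again a lift.\<close>
    define m where "m = inv k \<otimes> h"
    define w where "w = inv\<^bsub>E\<^esub> S \<otimes>\<^bsub>E\<^esub> lift m \<otimes>\<^bsub>E\<^esub> S"
    have m: "m \<in> H" using HH by (simp add: m_def)
    have mc: "lift m \<in> carrier E" by (rule liftc[OF m])
    have wc: "w \<in> carrier E" using Sc mc by (simp add: w_def)
    have Sw: "S \<otimes>\<^bsub>E\<^esub> w = lift m \<otimes>\<^bsub>E\<^esub> S" using Sc mc by (simp add: w_def E.m_assoc E.inv_cancel)
    have "q w = 0" using hq.q_conj[OF Sc mc] q_lift[OF m] by (simp add: w_def)
    then have w: "w = lift (fst w)" using liftI wc by blast
    have fw: "fst w \<in> carrier G" using wc by (auto simp: central_ext_simps)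
    have "s \<otimes> fst w = m \<otimes> s" using arg_cong[OF Sw, of fst] by (simp add: fst_mult_central_ext S_def fst_lift)
    moreover have "m \<otimes> s = s \<otimes> (k' \<otimes> inv h')"
    proof -
      have "m \<otimes> s = inv k \<otimes> (h \<otimes> s \<otimes> h') \<otimes> inv h'"
        using sc Hc by (simp add: m_def m_assoc)
      also have "\<dots> = s \<otimes> (k' \<otimes> inv h')" unfolding eq using sc Hc by (simp add: m_assoc inv_cancel)
      finally show ?thesis .
    qed
    ultimately have fw': "fst w = k' \<otimes> inv h'" using fw sc Hc inv_cancel(2)[of s] by (metis inv_closed m_closed)
    have "lift h = lift k \<otimes>\<^bsub>E\<^esub> lift m" using HH m Hc by (simp add: lift_mult m_def inv_cancel)
    then have "lift h \<otimes>\<^bsub>E\<^esub> S \<otimes>\<^bsub>E\<^esub> lift h' = lift k \<otimes>\<^bsub>E\<^esub> (S \<otimes>\<^bsub>E\<^esub> w) \<otimes>\<^bsub>E\<^esub> lift h'"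
      using HH liftc Sc mc by (simp add: Sw E.m_assoc)
    also have "\<dots> = lift k \<otimes>\<^bsub>E\<^esub> S \<otimes>\<^bsub>E\<^esub> (w \<otimes>\<^bsub>E\<^esub> lift h')"
      using HH liftc Sc wc by (simp add: E.m_assoc)
    also have "w \<otimes>\<^bsub>E\<^esub> lift h' = lift k'"
      using HH Hc by (subst w) (simp add: fw' lift_mult m_assoc)
    finally show ?thesis .
  qed
  define \<sigma> where "\<sigma> = (\<lambda>g. if g \<in> H then lift g
     else (let (h, h') = SOME (h, h'). h \<in> H \<and> h' \<in> H \<and> g = h \<otimes> s \<otimes> h' in lift h \<otimes>\<^bsub>E\<^esub> S \<otimes>\<^bsub>E\<^esub> lift h'))"
  have notH: "h \<otimes> s \<otimes> h' \<notin> H" if "h \<in> H" "h' \<in> H" for h h'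
  proof
    assume "h \<otimes> s \<otimes> h' \<in> H"
    then have "inv h \<otimes> (h \<otimes> s \<otimes> h') \<otimes> inv h' \<in> H" using that by simp
    moreover have "inv h \<otimes> (h \<otimes> s \<otimes> h') \<otimes> inv h' = s" using that s by (simp add: m_assoc inv_cancel)
    ultimately show False using s by simp
  qed
  have \<sigma>_s: "\<sigma> (h \<otimes> s \<otimes> h') = lift h \<otimes>\<^bsub>E\<^esub> S \<otimes>\<^bsub>E\<^esub> lift h'" if HH: "h \<in> H" "h' \<in> H" for h h'
  proof -
    define P where "P = (\<lambda>(k, k'). k \<in> H \<and> k' \<in> H \<and> h \<otimes> s \<otimes> h' = k \<otimes> s \<otimes> k')"
    obtain k k' where k: "(SOME p. P p) = (k, k')" by force
    have "P (h, h')" using HH by (simp add: P_def)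
    then have "P (k, k')" using someI[of P] k by metis
    then show ?thesis
      using well_def[OF HH, of k k'] k notH[OF HH] by (auto simp: \<sigma>_def P_def)
  qed
  have \<sigma>_H: "\<sigma> h = lift h" if "h \<in> H" for h using that by (simp add: \<sigma>_def)
  have cases_G: "g \<in> H \<or> (\<exists>h\<in>H. \<exists>h'\<in>H. g = h \<otimes> s \<otimes> h')" if "g \<in> carrier G" for g
    using cover that by blast
  have \<sigma>_left: "\<sigma> (h \<otimes> g) = lift h \<otimes>\<^bsub>E\<^esub> \<sigma> g" if h: "h \<in> H" and g: "g \<in> carrier G" for h g
    using cases_G[OF g]
  proof (elim disjE bexE)
    fix k k' assume k: "k \<in> H" "k' \<in> H" and gk: "g = k \<otimes> s \<otimes> k'"
    have "h \<otimes> g = (h \<otimes> k) \<otimes> s \<otimes> k'" using h k s by (simp add: gk m_assoc)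
    then have "\<sigma> (h \<otimes> g) = (lift h \<otimes>\<^bsub>E\<^esub> lift k) \<otimes>\<^bsub>E\<^esub> S \<otimes>\<^bsub>E\<^esub> lift k'"
      using \<sigma>_s[of "h \<otimes> k" k'] h k by (simp add: lift_mult)
    then show ?thesis using h k liftc Sc by (simp add: gk \<sigma>_s E.m_assoc)
  qed (use h in \<open>simp add: \<sigma>_H lift_mult\<close>)
  have \<sigma>_right: "\<sigma> (g \<otimes> h) = \<sigma> g \<otimes>\<^bsub>E\<^esub> lift h" if h: "h \<in> H" and g: "g \<in> carrier G" for h g
    using cases_G[OF g]
  proof (elim disjE bexE)
    fix k k' assume k: "k \<in> H" "k' \<in> H" and gk: "g = k \<otimes> s \<otimes> k'"
    have "g \<otimes> h = k \<otimes> s \<otimes> (k' \<otimes> h)" using h k s by (simp add: gk m_assoc)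
    then have "\<sigma> (g \<otimes> h) = lift k \<otimes>\<^bsub>E\<^esub> S \<otimes>\<^bsub>E\<^esub> (lift k' \<otimes>\<^bsub>E\<^esub> lift h)"
      using \<sigma>_s[of k "k' \<otimes> h"] h k by (simp add: lift_mult)
    then show ?thesis using h k liftc Sc by (simp add: gk \<sigma>_s E.m_assoc)
  qed (use h in \<open>simp add: \<sigma>_H lift_mult\<close>)
  define \<psi> where "\<psi> = (\<lambda>g. snd (\<sigma> g))"
  have \<sigma>: "\<sigma> g = (g, \<psi> g)" if g: "g \<in> carrier G" for g
    using cases_G[OF g]
    by (elim disjE bexE) (auto simp: \<sigma>_s \<sigma>_H \<psi>_def fst_mult_central_ext fst_lift S_def intro!: prod_eqI)
  show thesis
  proof
    fix g assume g: "g \<in> carrier G"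
    \<comment> \<open>The product of two lifts and \<open>S\<close> contributes one \<open>D\<close>
      for each lift and one \<open>C\<close> for each of the two multiplications.\<close>
    show "\<bar>\<psi> g\<bar> \<le> 2 * D + 2 * C"
      using cases_G[OF g]
    proof (elim disjE bexE)
      assume "g \<in> H"
      then show ?thesis using qD[OF g] C(1) abs_ge_zero[of "q (g, 0)"] by (simp add: \<psi>_def \<sigma>_H lift_def)
    next
      fix h h' assume h: "h \<in> H" "h' \<in> H" "g = h \<otimes> s \<otimes> h'"
      then show ?thesis
        using qD[of h] qD[of h'] C(2)[of h s] C(2)[of "h \<otimes> s" h']
        by (simp add: \<psi>_def \<sigma>_s lift_def S_def central_ext_simps)
    qed
  next
    fix h g assume h: "h \<in> H" and g: "g \<in> carrier G"
    have "\<sigma> (h \<otimes> g) = \<sigma> h \<otimes>\<^bsub>E\<^esub> \<sigma> g" "\<sigma> (g \<otimes> h) = \<sigma> g \<otimes>\<^bsub>E\<^esub> \<sigma> h"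
      using \<sigma>_left[OF h g] \<sigma>_right[OF h g] \<sigma>_H[OF h] by simp_all
    then show "\<omega> h g + \<psi> h + \<psi> g - \<psi> (h \<otimes> g) = 0" "\<omega> g h + \<psi> g + \<psi> h - \<psi> (g \<otimes> h) = 0"
      using h g by (simp_all add: \<sigma> central_ext_simps)
  qed
qed

section \<open>Cohomology when triples have two orbits\<close>

lemma half_not_Ints: "(1 / 2 :: real) \<notin> \<int>"
proof
  assume "(1 / 2 :: real) \<in> \<int>"
  then obtain n :: int where "1 / 2 = (of_int n :: real)" by (auto elim: Ints_cases)
  then have "(1 :: real) = of_int (2 * n)" by simp
  then have "1 = 2 * n" by linarith
  then show False by presburger
qed

section \<open>Bounded classes handled through representatives\<close>

lemma bounded_coboundaries2_lin:
  assumes "a \<in> bounded_coboundaries2 G"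
  shows "b \<in> bounded_coboundaries2 G \<Longrightarrow> (\<lambda>g h. a g h + b g h) \<in> bounded_coboundaries2 G"
    and "(\<lambda>g h. r * a g h) \<in> bounded_coboundaries2 G"
proof -
  obtain \<phi> C where \<phi>: "a = coboundary2 G \<phi>" "\<forall>g\<in>carrier G. \<bar>\<phi> g\<bar> \<le> C"
    using assms by (auto simp: bounded_coboundaries2_def)
  have "\<forall>g\<in>carrier G. \<bar>r * \<phi> g\<bar> \<le> \<bar>r\<bar> * C" using \<phi> by (simp add: abs_mult mult_left_mono)
  then show "(\<lambda>g h. r * a g h) \<in> bounded_coboundaries2 G"
    by (intro bounded_coboundaries2I[of _ G "\<lambda>g. r * \<phi> g"]) (auto simp: \<phi> coboundary2_linear)
  assume "b \<in> bounded_coboundaries2 G"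
  then obtain \<psi> D where \<psi>: "b = coboundary2 G \<psi>" "\<forall>g\<in>carrier G. \<bar>\<psi> g\<bar> \<le> D"
    by (auto simp: bounded_coboundaries2_def)
  have "\<forall>g\<in>carrier G. \<bar>\<phi> g + \<psi> g\<bar> \<le> C + D"
    using \<phi>(2) \<psi>(2) by (meson abs_triangle_ineq add_mono order_trans)
  then show "(\<lambda>g h. a g h + b g h) \<in> bounded_coboundaries2 G"
    by (intro bounded_coboundaries2I[of _ G "\<lambda>g. \<phi> g + \<psi> g"]) (auto simp: \<phi> \<psi> coboundary2_linear)
qed

lemma zero_bounded_coboundary: "(\<lambda>g h. 0) \<in> bounded_coboundaries2 G"
  by (rule bounded_coboundaries2I[of _ _ "\<lambda>g. 0" 0]) (auto simp: coboundary2_def fun_eq_iff)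

lemma mem_bounded_class2:
  "x \<in> bounded_class2 G \<omega> \<longleftrightarrow> (\<lambda>g h. x g h - \<omega> g h) \<in> bounded_coboundaries2 G"
proof -
  have "x = (\<lambda>g h. b g h + \<omega> g h) \<longleftrightarrow> b = (\<lambda>g h. x g h - \<omega> g h)" for b
    by (auto simp: fun_eq_iff)
  then show ?thesis
    by (auto simp: bounded_class2_def a_r_coset_def' cocycle_space_simps)
qed

lemma bounded_class2_eqI:
  assumes "(\<lambda>g h. \<omega>' g h - \<omega> g h) \<in> bounded_coboundaries2 G"
  shows "bounded_class2 G \<omega>' = bounded_class2 G \<omega>"
proof (rule Set.set_eqI)
  fix x
  have neg: "(\<lambda>g h. (-1) * (\<omega>' g h - \<omega> g h)) \<in> bounded_coboundaries2 G"
    by (rule bounded_coboundaries2_lin(2)[OF assms])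
  show "x \<in> bounded_class2 G \<omega>' \<longleftrightarrow> x \<in> bounded_class2 G \<omega>"
    unfolding mem_bounded_class2
    using bounded_coboundaries2_lin(1)[OF _ assms, of "\<lambda>g h. x g h - \<omega>' g h"]
      bounded_coboundaries2_lin(1)[OF _ neg, of "\<lambda>g h. x g h - \<omega> g h"] by auto
qed

lemma bounded_H2_carrier: "carrier (bounded_H2 G) = bounded_class2 G ` bounded_cocycles2 G"
  by (auto simp: bounded_H2_def Let_def A_RCOSETS_def' cocycle_space_simps bounded_class2_def)

lemma bounded_H2_zero: "\<zero>\<^bsub>bounded_H2 G\<^esub> = bounded_coboundaries2 G"
  by (simp add: bounded_H2_def Let_def)

lemma bounded_H2_smult:
  "r \<odot>\<^bsub>bounded_H2 G\<^esub> bounded_class2 G \<omega> = bounded_class2 G (\<lambda>g h. r * \<omega> g h)"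
proof -
  have "r \<odot>\<^bsub>bounded_H2 G\<^esub> X = (\<Union>x\<in>X. bounded_class2 G (\<lambda>g h. r * x g h))" for X
    by (simp add: bounded_H2_def Let_def bounded_class2_def cocycle_space_simps)
  moreover have "\<omega> \<in> bounded_class2 G \<omega>"
    by (simp add: mem_bounded_class2 zero_bounded_coboundary)
  moreover have "bounded_class2 G (\<lambda>g h. r * x g h) = bounded_class2 G (\<lambda>g h. r * \<omega> g h)"
    if "x \<in> bounded_class2 G \<omega>" for x
    using bounded_coboundaries2_lin(2)[OF that[unfolded mem_bounded_class2], of r]
    by (intro bounded_class2_eqI) (simp add: right_diff_distrib)
  ultimately show ?thesis by (metis (no_types, lifting) SUP_eq_const empty_iff)
qed

lemma (in vectorspace) one_dimensional:
  assumes c: "c \<in> carrier V" "c \<noteq> \<zero>\<^bsub>V\<^esub>" and sc: "\<And>x. x \<in> carrier V \<Longrightarrow> \<exists>r\<in>carrier K. x = r \<odot>\<^bsub>V\<^esub> c"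
  shows "span {c} = carrier V" "dim = 1"
proof -
  have "x \<in> span {c}" if x: "x \<in> carrier V" for x
  proof -
    obtain r where r: "r \<in> carrier K" "x = r \<odot>\<^bsub>V\<^esub> c" using sc x by blast
    then have "x = lincomb (\<lambda>_. r) {c}" using c by (simp add: lincomb_def)
    then show ?thesis using r c by (auto simp: span_def intro!: exI[of _ "\<lambda>_. r"] exI[of _ "{c}"])
  qed
  then show "span {c} = carrier V" using span_is_subset2[of "{c}"] c by auto
  then show "dim = 1" using c by (intro dim1I) auto
qed

lemma (in group) relative_cocycles_lin:
  assumes "v \<in> relative_cocycles G H"
  shows "w \<in> relative_cocycles G H \<Longrightarrow> (\<lambda>g h. v g h + w g h) \<in> relative_cocycles G H"
    and "(\<lambda>g h. r * v g h) \<in> relative_cocycles G H"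
  using assms by (auto simp: relative_cocycles_def bounded_cocycles2_add bounded_cocycles2_smult)

text \<open>
  Think of \<open>H\<close> as the stabiliser of a point \<open>y\<close> for a right action: a relative cocycle \<open>v g\<^sub>1 g\<^sub>2\<close>
  is an invariant function of the triple \<open>(y, y g\<^sub>2, y g\<^sub>1 g\<^sub>2)\<close>. The pairs \<open>(p\<^sub>1, p\<^sub>2)\<close> and
  \<open>(p\<^sub>1\<^sup>-\<^sup>1, p\<^sub>1 p\<^sub>2)\<close> represent the two orbits of distinct triples.
\<close>

locale two_triple_orbits = group G for G (structure) +
  fixes H :: "'a set" and p1 p2 :: 'a
  assumes H: "subgroup H G"
    and p1: "p1 \<in> carrier G" "p1 \<notin> H" and p2: "p2 \<in> carrier G" "p2 \<notin> H" and p12: "p1 \<otimes> p2 \<notin> H"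
    and double_coset: "\<lbrakk>g \<in> carrier G; g \<notin> H\<rbrakk> \<Longrightarrow> \<exists>h\<in>H. \<exists>h'\<in>H. g = h \<otimes> p1 \<otimes> h'"
    and triple_orbit: "\<lbrakk>g1 \<in> carrier G; g2 \<in> carrier G; g1 \<notin> H; g2 \<notin> H; g1 \<otimes> g2 \<notin> H\<rbrakk> \<Longrightarrow>
          \<exists>a b. (a, b) \<in> {(p1, p2), (inv p1, p1 \<otimes> p2)} \<and> (\<exists>h\<^sub>1\<in>H. \<exists>h\<^sub>2\<in>H. \<exists>k\<in>H.
            g2 \<otimes> k = h\<^sub>1 \<otimes> b \<and> g1 \<otimes> g2 \<otimes> k = h\<^sub>2 \<otimes> (a \<otimes> b))"
begin

sublocale H: subgroup H G by (rule H)

text \<open>With one of its three arguments in \<open>H\<close>, the cocycle identity loses two of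
  its four terms.\<close>

lemma relative_cocycle_shift:
  assumes v: "v \<in> relative_cocycles G H" and g: "g1 \<in> carrier G" "g2 \<in> carrier G" and h: "h \<in> H"
  shows "v (h \<otimes> g1) g2 = v g1 g2" "v (g1 \<otimes> h) g2 = v g1 (h \<otimes> g2)" "v g1 (g2 \<otimes> h) = v g1 g2"
proof -
  have hc: "h \<in> carrier G" using h by simp
  have eq: "v b c - v (a \<otimes> b) c + v a (b \<otimes> c) - v a b = 0"
    if "a \<in> carrier G" "b \<in> carrier G" "c \<in> carrier G" for a b c
    using v bounded_cocycles2D(2)[of v G a b c] that by (simp add: relative_cocycles_def)
  have zero: "v h g = 0" "v g h = 0" if "g \<in> carrier G" for g
    using v h that by (auto simp: relative_cocycles_def)
  show "v (h \<otimes> g1) g2 = v g1 g2" using eq[OF hc g] zero g by simp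
  show "v (g1 \<otimes> h) g2 = v g1 (h \<otimes> g2)" using eq[OF g(1) hc g(2)] zero g by simp
  show "v g1 (g2 \<otimes> h) = v g1 g2" using eq[OF g hc] zero g by simp
qed

text \<open>The cocycle identity at \<open>inv p1\<close>, \<open>p1\<close>, \<open>p2\<close>,
  where the product of the first two is the unit. It ties the values on both orientations to the
  value on a degenerate triple that returns to the base point.\<close>

lemma relative_cocycle_sum:
  assumes v: "v \<in> relative_cocycles G H"
  shows "v p1 p2 + v (inv p1) (p1 \<otimes> p2) = v (inv p1) p1"
  using bounded_cocycles2D(2)[of v G "inv p1" p1 p2] v p1 p2 by (simp add: relative_cocycles_def)

text \<open>A relative cocycle has just two degrees of freedom: by the shift rules distinct triples
  reduce to the two representatives, and degenerate triples reduce to their sum or to 0.\<close>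

lemma relative_cocycle_eq_zero:
  assumes v: "v \<in> relative_cocycles G H"
    and pos: "v p1 p2 = 0" and neg: "v (inv p1) (p1 \<otimes> p2) = 0"
  shows "v = (\<lambda>g h. 0)"
proof (intro ext)
  note shift = relative_cocycle_shift[OF v]
  fix g1 g2
  consider "g1 \<notin> carrier G \<or> g2 \<notin> carrier G" | "g1 \<in> carrier G" "g2 \<in> carrier G" "g1 \<in> H \<or> g2 \<in> H"
    | "g1 \<in> carrier G" "g2 \<in> carrier G" "g1 \<notin> H" "g2 \<notin> H" "g1 \<otimes> g2 \<in> H"
    | "g1 \<in> carrier G" "g2 \<in> carrier G" "g1 \<notin> H" "g2 \<notin> H" "g1 \<otimes> g2 \<notin> H" by blast
  then show "v g1 g2 = 0"
  proof cases
    case 1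
    then show ?thesis using v bounded_cocycles2D(1)[of v G g1 g2] by (auto simp: relative_cocycles_def)
  next
    case 2
    then show ?thesis using v by (auto simp: relative_cocycles_def)
  next
    case 3
    \<comment> \<open>Here the third point of the triple is the base point again, so the triple is
      governed by the pair orbit, that is, by the double coset of \<open>p1\<close>.\<close>
    obtain h h' where h: "h \<in> H" "h' \<in> H" "g2 = h \<otimes> p1 \<otimes> h'" using double_coset 3 by blast
    define k where "k = g1 \<otimes> g2"
    have k: "k \<in> H" using 3 by (simp add: k_def)
    have g1: "g1 = (k \<otimes> inv h') \<otimes> (inv p1 \<otimes> inv h)"
    proof -
      have "g1 = k \<otimes> inv g2" using 3 by (simp add: k_def m_assoc)
      then show ?thesis using h k p1 by (simp add: inv_mult_group m_assoc)
    qed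
    have "v g1 g2 = v (inv p1 \<otimes> inv h) (h \<otimes> (p1 \<otimes> h'))"
      using shift(1)[of "inv p1 \<otimes> inv h" g2 "k \<otimes> inv h'"] h k p1 g1 by (simp add: m_assoc)
    also have "\<dots> = v (inv p1) (p1 \<otimes> h')"
      using shift(2)[of "inv p1" "h \<otimes> (p1 \<otimes> h')" "inv h"] h p1 by (simp add: inv_cancel)
    also have "\<dots> = v (inv p1) p1" using shift(3)[of "inv p1" p1 h'] h(2) p1 by simp
    also have "\<dots> = 0" using relative_cocycle_sum[OF v] pos neg by simp
    finally show ?thesis .
  next
    case 4
    from triple_orbit[OF 4] obtain a b where ab: "(a, b) \<in> {(p1, p2), (inv p1, p1 \<otimes> p2)}"
      and ex: "\<exists>h1\<in>H. \<exists>h2\<in>H. \<exists>k\<in>H. g2 \<otimes> k = h1 \<otimes> b \<and> g1 \<otimes> g2 \<otimes> k = h2 \<otimes> (a \<otimes> b)"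
      by (elim exE conjE) (rule that)
    from ex obtain h1 h2 k where hk: "h1 \<in> H" "h2 \<in> H" "k \<in> H" "g2 \<otimes> k = h1 \<otimes> b"
        "g1 \<otimes> g2 \<otimes> k = h2 \<otimes> (a \<otimes> b)"
      by blast
    have abc: "a \<in> carrier G" "b \<in> carrier G" using ab p1 p2 by auto
    have hc: "h1 \<in> carrier G" "h2 \<in> carrier G" "k \<in> carrier G" using hk by auto
    have "(g1 \<otimes> h1) \<otimes> b = g1 \<otimes> g2 \<otimes> k" using hk(4) hc 4 abc by (simp add: m_assoc)
    also have "\<dots> = (h2 \<otimes> a) \<otimes> b" using hk(5) hc abc by (simp add: m_assoc)
    finally have eq: "g1 \<otimes> h1 = h2 \<otimes> a" using hc abc 4 by (simp add: right_cancel)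
    have "v g1 g2 = v g1 (g2 \<otimes> k)" using shift(3)[of g1 g2 k] 4(1,2) hk(3) by simp
    also have "\<dots> = v (g1 \<otimes> h1) b" using shift(2)[of g1 b h1] 4(1) hk(1) abc by (simp add: hk(4))
    also have "\<dots> = v a b" using shift(1)[of a b h2] hk(2) abc by (simp add: eq)
    also have "\<dots> = 0" using ab pos neg by auto
    finally show ?thesis .
  qed
qed

lemma inv_notin: "inv p1 \<notin> H"
  using p1 H.m_inv_closed by (metis inv_inv)

text \<open>The primitive is the invariant function of pairs equal to 1 off the diagonal. On a
  distinct triple its coboundary is 1 + 1 - 1, whatever the orientation.\<close>

lemma coboundary_indicator:
  defines "d \<equiv> coboundary2 G (\<lambda>g. if g \<in> H then 0 else 1)"
  shows "d \<in> relative_cocycles G H" "d \<in> bounded_coboundaries2 G"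
    and "d p1 p2 = 1" "d (inv p1) (p1 \<otimes> p2) = 1"
proof -
  show B: "d \<in> bounded_coboundaries2 G"
    unfolding d_def by (rule bounded_coboundaries2I[OF refl, where C = 1]) simp
  have coset: "h \<otimes> g \<in> H \<longleftrightarrow> g \<in> H" "g \<otimes> h \<in> H \<longleftrightarrow> g \<in> H" if h: "h \<in> H" and g: "g \<in> carrier G" for g h
  proof -
    have "inv h \<otimes> (h \<otimes> g) = g" "(g \<otimes> h) \<otimes> inv h = g" using h g by (simp_all add: inv_cancel m_assoc)
    then show "h \<otimes> g \<in> H \<longleftrightarrow> g \<in> H" "g \<otimes> h \<in> H \<longleftrightarrow> g \<in> H"
      using h by (metis H.m_closed H.m_inv_closed)+
  qed
  have "d \<in> bounded_cocycles2 G"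
    using B submodule.subset[OF bounded_coboundaries2_submodule] by (auto simp: cocycle_space_simps)
  then show "d \<in> relative_cocycles G H"
    by (auto simp: relative_cocycles_def d_def coboundary2_def coset)
  show "d p1 p2 = 1" "d (inv p1) (p1 \<otimes> p2) = 1"
    using p1 p2 p12 inv_notin by (auto simp: d_def coboundary2_def inv_cancel)
qed

text \<open>Vanishing of \<open>e\<close> along \<open>H\<close> makes the bounded primitive a
  homomorphism on \<open>H\<close>, hence 0 there, and constant on the single nontrivial double
  coset. With this constant c, the two values are 2c and c.\<close>

lemma relative_coboundary_trivial:
  assumes e: "e \<in> relative_cocycles G H" "e \<in> bounded_coboundaries2 G"
  shows "e (inv p1) p1 = 2 * e p1 p2"
proof -
  obtain \<phi> C where \<phi>: "e = coboundary2 G \<phi>" and C: "\<And>g. g \<in> carrier G \<Longrightarrow> \<bar>\<phi> g\<bar> \<le> C"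
    using e(2) by (auto simp: bounded_coboundaries2_def)
  have mult: "\<phi> (h \<otimes> g) = \<phi> h + \<phi> g" "\<phi> (g \<otimes> h) = \<phi> g + \<phi> h" if "h \<in> H" "g \<in> carrier G" for g h
  proof -
    have "e h g = 0" "e g h = 0" using e(1) that by (auto simp: relative_cocycles_def)
    then show "\<phi> (h \<otimes> g) = \<phi> h + \<phi> g" "\<phi> (g \<otimes> h) = \<phi> g + \<phi> h"
      using that by (simp_all add: \<phi> coboundary2_def)
  qed
  have zero: "\<phi> h = 0" if h: "h \<in> H" for h
  proof (rule bounded_multiples_imp_zero)
    fix n :: nat
    have "\<phi> (h [^] n) = real n * \<phi> h \<and> h [^] n \<in> H"
    proof (induction n)
      case 0
      show ?case using mult(1)[of \<one> \<one>] by simp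
    next
      case (Suc n)
      then show ?case using h mult(1)[of "h [^] n" h] by (simp add: algebra_simps)
    qed
    then show "\<bar>real n * \<phi> h\<bar> \<le> C" using C[of "h [^] n"] by simp
  qed
  have const: "\<phi> g = \<phi> p1" if g: "g \<in> carrier G" "g \<notin> H" for g
  proof -
    obtain h h' where h: "h \<in> H" "h' \<in> H" "g = h \<otimes> p1 \<otimes> h'" using double_coset g by blast
    then show ?thesis using mult(2)[of h' "h \<otimes> p1"] mult(1)[of h p1] zero[of h] zero[of h'] p1 by simp
  qed
  show ?thesis
    using p1 p2 inv_notin zero[of \<one>] const[of p2] const[of "p1 \<otimes> p2"] const[of "inv p1"] p12
    by (simp add: \<phi> coboundary2_def)
qed

text \<open>Here \<open>e\<close> is a relative representative of the class of
  \<open>\<omega>\<^sub>0\<close>. Integrality against the value \<open>1 / 2\<close> shows that the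
  class is nonzero, and the two degrees of freedom of relative cocycles, one of them a coboundary,
  show that it spans.\<close>

theorem bounded_H2_one_dimensional:
  assumes \<omega>0: "\<omega>\<^sub>0 \<in> bounded_cocycles2 G"
    and e: "e \<in> relative_cocycles G H" "(\<lambda>g h. e g h - \<omega>\<^sub>0 g h) \<in> bounded_coboundaries2 G"
    and int: "e p1 p2 \<in> \<int>" and one: "e (inv p1) p1 = 1"
    and add: "\<And>\<omega> q D. \<lbrakk>\<omega> \<in> bounded_cocycles2 G; homogeneous_quasimorphism (central_ext G \<omega>) q D\<rbrakk> \<Longrightarrow>
                homogeneous_quasimorphism.additive_on (central_ext G \<omega>) q (H \<times> UNIV)"
  shows "vectorspace.dim class_ring (bounded_H2 G) = 1"
    and "module.span class_ring (bounded_H2 G) {bounded_class2 G \<omega>\<^sub>0} = carrier (bounded_H2 G)"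
proof -
  interpret V: vectorspace class_ring "bounded_H2 G" by (rule bounded_H2_vectorspace)
  have class_e: "bounded_class2 G e = bounded_class2 G \<omega>\<^sub>0" by (rule bounded_class2_eqI[OF e(2)])
  have half: "e p1 p2 \<noteq> 1 / 2" using int half_not_Ints by metis
  have nz: "bounded_class2 G \<omega>\<^sub>0 \<noteq> \<zero>\<^bsub>bounded_H2 G\<^esub>"
  proof
    assume "bounded_class2 G \<omega>\<^sub>0 = \<zero>\<^bsub>bounded_H2 G\<^esub>"
    then have "(\<lambda>g h. 0) \<in> bounded_class2 G e"
      by (simp add: bounded_H2_zero class_e zero_bounded_coboundary)
    then have "(\<lambda>g h. (-1) * (0 - e g h)) \<in> bounded_coboundaries2 G"
      unfolding mem_bounded_class2 by (rule bounded_coboundaries2_lin(2))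
    then have "e \<in> bounded_coboundaries2 G" by simp
    then show False using relative_coboundary_trivial[OF e(1)] one half by simp
  qed
  have span: "\<exists>r. x = r \<odot>\<^bsub>bounded_H2 G\<^esub> bounded_class2 G \<omega>\<^sub>0" if "x \<in> carrier (bounded_H2 G)" for x
  proof -
    obtain \<omega> where \<omega>: "\<omega> \<in> bounded_cocycles2 G" "x = bounded_class2 G \<omega>"
      using \<open>x \<in> carrier (bounded_H2 G)\<close> by (auto simp: bounded_H2_carrier)
    interpret c: bounded_cocycle G \<omega> by unfold_locales (rule \<omega>)
    obtain \<psi> C where \<psi>: "\<And>g. g \<in> carrier G \<Longrightarrow> \<bar>\<psi> g\<bar> \<le> C"
      and rel: "\<And>h g. \<lbrakk>h \<in> H; g \<in> carrier G\<rbrakk> \<Longrightarrow> \<omega> h g + \<psi> h + \<psi> g - \<psi> (h \<otimes> g) = 0"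
        "\<And>h g. \<lbrakk>h \<in> H; g \<in> carrier G\<rbrakk> \<Longrightarrow> \<omega> g h + \<psi> g + \<psi> h - \<psi> (g \<otimes> h) = 0"
    proof (rule c.relative_representative[OF H, of p1])
      show "p1 \<in> carrier G - H" using p1 by simp
      show "\<exists>h\<in>H. \<exists>h'\<in>H. g = h \<otimes> p1 \<otimes> h'" if "g \<in> carrier G - H" for g
        using double_coset that by simp
      show "homogeneous_quasimorphism.additive_on (central_ext G \<omega>) q (H \<times> UNIV)"
        if "homogeneous_quasimorphism (central_ext G \<omega>) q D" for q D
        by (rule add[OF \<omega>(1) that])
    qed blast
    define b where "b = coboundary2 G \<psi>"
    have b: "b \<in> bounded_coboundaries2 G"
      unfolding b_def by (rule bounded_coboundaries2I[OF refl, where C = C]) (simp add: \<psi>)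
    define v where "v = (\<lambda>g h. \<omega> g h + b g h)"
    have "b \<in> bounded_cocycles2 G"
      using b submodule.subset[OF bounded_coboundaries2_submodule] by (auto simp: cocycle_space_simps)
    then have "v \<in> bounded_cocycles2 G" unfolding v_def by (rule bounded_cocycles2_add[OF \<omega>(1)])
    moreover have "v h g = 0 \<and> v g h = 0" if "h \<in> H" "g \<in> carrier G" for h g
      using rel[OF that] that by (simp add: v_def b_def coboundary2_def algebra_simps)
    ultimately have v: "v \<in> relative_cocycles G H" by (simp add: relative_cocycles_def)
    define d where "d = coboundary2 G (\<lambda>g. if g \<in> H then 0 else 1)"
    note d = coboundary_indicator[folded d_def]
    \<comment> \<open>\<open>l\<close> matches the difference between the two orientations, to which
      \<open>d\<close> contributes nothing; \<open>m\<close> then corrects the common value.\<close>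
    define l where "l = (v p1 p2 - v (inv p1) (p1 \<otimes> p2)) / (e p1 p2 - e (inv p1) (p1 \<otimes> p2))"
    define m where "m = v p1 p2 - l * e p1 p2"
    \<comment> \<open>The two values of \<open>e\<close> add up to 1, so they could only agree if
      both were \<open>1 / 2\<close>.\<close>
    have diff: "e p1 p2 - e (inv p1) (p1 \<otimes> p2) \<noteq> 0"
      using relative_cocycle_sum[OF e(1)] one half by auto
    then have "l * (e p1 p2 - e (inv p1) (p1 \<otimes> p2)) = v p1 p2 - v (inv p1) (p1 \<otimes> p2)"
      by (simp add: l_def)
    then have l: "l * e p1 p2 - l * e (inv p1) (p1 \<otimes> p2) = v p1 p2 - v (inv p1) (p1 \<otimes> p2)"
      by (simp add: right_diff_distrib)
    define w where "w = (\<lambda>g h. v g h + ((- l) * e g h + (- m) * d g h))"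
    have "w \<in> relative_cocycles G H"
      unfolding w_def by (intro relative_cocycles_lin v e(1) d(1))
    moreover have "w p1 p2 = 0" "w (inv p1) (p1 \<otimes> p2) = 0"
      using d(3,4) l by (simp_all add: w_def m_def)
    ultimately have w0: "w = (\<lambda>g h. 0)" by (rule relative_cocycle_eq_zero)
    have "\<omega> g h - l * e g h = m * d g h + (-1) * b g h" for g h
      using fun_cong[OF fun_cong[OF w0, of g], of h] by (simp add: w_def v_def)
    moreover have "(\<lambda>g h. m * d g h + (-1) * b g h) \<in> bounded_coboundaries2 G"
      by (intro bounded_coboundaries2_lin d(2) b)
    ultimately have "bounded_class2 G \<omega> = bounded_class2 G (\<lambda>g h. l * e g h)"
      by (intro bounded_class2_eqI) simp
    then have "x = l \<odot>\<^bsub>bounded_H2 G\<^esub> bounded_class2 G \<omega>\<^sub>0"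
      using \<omega>(2) by (simp add: bounded_H2_smult flip: class_e)
    then show ?thesis ..
  qed
  have cc: "bounded_class2 G \<omega>\<^sub>0 \<in> carrier (bounded_H2 G)" using \<omega>0 by (simp add: bounded_H2_carrier)
  show "vectorspace.dim class_ring (bounded_H2 G) = 1"
    "module.span class_ring (bounded_H2 G) {bounded_class2 G \<omega>\<^sub>0} = carrier (bounded_H2 G)"
    using V.one_dimensional[OF cc nz] span by simp_all
qed

end

section \<open>Lifts and the based Euler cocycle\<close>

lemma Ints_abs_less_one: "x \<in> \<int> \<Longrightarrow> \<bar>x :: real\<bar> < 1 \<Longrightarrow> x = 0"
  by (auto elim!: Ints_cases)

lemma circle_proj_eq_iff: "circle_proj x = circle_proj y \<longleftrightarrow> x - y \<in> \<int>"
  by (simp add: circle.abs_eq_iff)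

lemma circle_proj_add_int [simp]: "circle_proj (x + of_int n) = circle_proj x"
  by (simp add: circle_proj_eq_iff)

lemma circle_proj_diff_int [simp]: "circle_proj (x - of_int n) = circle_proj x"
  by (simp add: circle_proj_eq_iff)

lemma circle_proj_cases: obtains t where "y = circle_proj t"
  by (metis Quotient_abs_rep Quotient_circle)

lemma circle_proj_cases_from:
  obtains t where "y = circle_proj t" "a \<le> t" "t < a + 1"
proof -
  obtain b where b: "y = circle_proj b" by (rule circle_proj_cases)
  have "y = circle_proj (b - of_int \<lfloor>b - a\<rfloor>)" by (simp add: b)
  moreover have "a \<le> b - of_int \<lfloor>b - a\<rfloor>" "b - of_int \<lfloor>b - a\<rfloor> < a + 1" by linarith+
  ultimately show thesis by (rule that)
qed

definition lifts :: "(real \<Rightarrow> real) set" where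
  "lifts = carrier homeo_real_lifts"

lemma lifts_iff:
  "F \<in> lifts \<longleftrightarrow> (\<exists>F'. homeomorphism UNIV UNIV F F') \<and> strict_mono F \<and>
     (\<forall>x. \<forall>n::int. F (x + of_int n) = F x + of_int n)"
  by (simp add: lifts_def homeo_real_lifts_def)

lemma is_lift_iff: "is_lift F f \<longleftrightarrow> F \<in> lifts \<and> (\<forall>x. f (circle_proj x) = circle_proj (F x))"
  by (simp add: is_lift_def lifts_def)

lemma lifts_props:
  assumes "F \<in> lifts"
  shows "F (x + of_int n) = F x + of_int n" "F (x + 1) = F x + 1" "F (x - of_int n) = F x - of_int n"
    "F x < F y \<longleftrightarrow> x < y" "F x \<le> F y \<longleftrightarrow> x \<le> y" "continuous_on UNIV F"
proof -
  have sh: "F (x + of_int n) = F x + of_int n" for n :: int using assms by (simp add: lifts_iff)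
  show "F (x + of_int n) = F x + of_int n" by (rule sh)
  show "F (x + 1) = F x + 1" using sh[of 1] by simp
  show "F (x - of_int n) = F x - of_int n" using sh[of "- n"] by simp
  show "F x < F y \<longleftrightarrow> x < y" "F x \<le> F y \<longleftrightarrow> x \<le> y"
    using assms by (simp_all add: lifts_iff strict_mono_less strict_mono_less_eq)
  show "continuous_on UNIV F" using assms by (auto simp: lifts_iff homeomorphism_def)
qed

lemma translation_in_lifts: "(\<lambda>x. x + of_int n) \<in> lifts"
proof -
  have "homeomorphism UNIV UNIV (\<lambda>x::real. x + of_int n) (\<lambda>x. x - of_int n)"
    by (rule homeomorphismI) (auto intro!: continuous_intros)
  then show ?thesis by (auto simp: lifts_iff strict_mono_def)
qed

lemma id_in_lifts: "id \<in> lifts"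
  using translation_in_lifts[of 0] by (simp add: id_def)

lemma comp_in_lifts:
  assumes "F \<in> lifts" "H \<in> lifts"
  shows "H \<circ> F \<in> lifts"
  using assms unfolding lifts_iff
  by (auto simp: strict_mono_def intro: homeomorphism_compose)

lemma lifts_inverse:
  assumes F: "F \<in> lifts"
  obtains F' where "F' \<in> lifts" "\<And>x. F' (F x) = x" "\<And>x. F (F' x) = x"
proof -
  obtain F' where F': "homeomorphism UNIV UNIV F F'" using F by (auto simp: lifts_iff)
  then have inv: "F' (F x) = x" "F (F' x) = x" for x by (auto simp: homeomorphism_def)
  have "strict_mono F'"
    by (rule strict_monoI) (metis F inv(2) lifts_props(4))
  moreover have "F' (x + of_int n) = F' x + of_int n" for x and n :: int
    by (metis F inv lifts_props(1))
  moreover have "homeomorphism UNIV UNIV F' F" by (rule homeomorphism_symD[OF F'])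
  ultimately have "F' \<in> lifts" by (auto simp: lifts_iff)
  then show thesis using that inv by blast
qed

lemma group_homeo_real_lifts: "group homeo_real_lifts"
proof (rule groupI)
  fix F assume "F \<in> carrier homeo_real_lifts"
  then obtain F' where "F' \<in> lifts" "\<And>x. F (F' x) = x" by (metis lifts_def lifts_inverse)
  then show "\<exists>H\<in>carrier homeo_real_lifts. H \<otimes>\<^bsub>homeo_real_lifts\<^esub> F = \<one>\<^bsub>homeo_real_lifts\<^esub>"
    by (intro bexI[of _ F']) (auto simp: lifts_def homeo_real_lifts_def fun_eq_iff)
qed (use comp_in_lifts id_in_lifts in \<open>auto simp: homeo_real_lifts_def lifts_def comp_assoc\<close>)

lemma is_lift_comp: "is_lift F f \<Longrightarrow> is_lift H g \<Longrightarrow> is_lift (H \<circ> F) (g \<circ> f)"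
  by (simp add: is_lift_iff comp_in_lifts)

lemma is_lift_shift:
  assumes "is_lift F f"
  shows "is_lift (\<lambda>x. F x + of_int n) f"
  using comp_in_lifts[OF _ translation_in_lifts[of n], of F] assms by (simp add: is_lift_iff comp_def)

text \<open>The difference of two lifts is continuous and integer-valued, hence constant.\<close>

lemma is_lift_unique:
  assumes "is_lift F f" "is_lift H f"
  obtains n :: int where "\<And>x. H x = F x + of_int n"
proof -
  have int: "H x - F x \<in> \<int>" for x
    using assms unfolding is_lift_iff by (metis circle_proj_eq_iff)
  have "(\<lambda>x. H x - F x) constant_on UNIV"
  proof (rule continuous_discrete_range_constant)
    show "continuous_on UNIV (\<lambda>x. H x - F x)"
      using assms by (intro continuous_intros) (auto simp: is_lift_iff lifts_props)
    fix x
    have "1 \<le> norm (H y - F y - (H x - F x))" if "H y - F y \<noteq> H x - F x" for y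
      using Ints_abs_less_one[OF Ints_diff[OF int[of y] int[of x]]] that by force
    then show "\<exists>e>0. \<forall>y. y \<in> UNIV \<and> H y - F y \<noteq> H x - F x \<longrightarrow> e \<le> norm (H y - F y - (H x - F x))"
      by (intro exI[of _ 1]) auto
  qed simp
  then obtain c where c: "\<And>x. H x - F x = c" by (auto simp: constant_on_def)
  then have "c \<in> \<int>" using int[of 0] by simp
  then obtain n where "c = of_int n" by (auto elim: Ints_cases)
  then have "H x = F x + of_int n" for x using c[of x] by linarith
  then show thesis by (rule that)
qed

lemma group_homeo_circle: "group homeo_circle"
proof (rule groupI)
  fix f assume "f \<in> carrier homeo_circle"
  then obtain f' F where f': "homeomorphism UNIV UNIV f f'" and F: "is_lift F f"
    by (auto simp: homeo_circle_def)
  obtain F' where F': "F' \<in> lifts" "\<And>x. F' (F x) = x" "\<And>x. F (F' x) = x"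
    using F lifts_inverse[of F] by (auto simp: is_lift_iff)
  have inv: "f' (f x) = x" "f (f' x) = x" for x using f' by (auto simp: homeomorphism_def)
  have "f' (circle_proj x) = circle_proj (F' x)" for x
    using F F'(3)[of x] inv(1)[of "circle_proj (F' x)"] by (simp add: is_lift_iff)
  then have "is_lift F' f'" using F' by (simp add: is_lift_iff)
  then have "f' \<in> carrier homeo_circle" using homeomorphism_symD[OF f'] by (auto simp: homeo_circle_def)
  then show "\<exists>h\<in>carrier homeo_circle. h \<otimes>\<^bsub>homeo_circle\<^esub> f = \<one>\<^bsub>homeo_circle\<^esub>"
    using inv by (intro bexI[of _ f']) (auto simp: homeo_circle_def fun_eq_iff)
next
  fix f g assume "f \<in> carrier homeo_circle" "g \<in> carrier homeo_circle"
  then show "f \<otimes>\<^bsub>homeo_circle\<^esub> g \<in> carrier homeo_circle"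
    using homeomorphism_compose is_lift_comp by (fastforce simp: homeo_circle_def)
next
  have "is_lift id id" by (simp add: is_lift_iff id_in_lifts)
  moreover have "homeomorphism UNIV UNIV id (id :: circle \<Rightarrow> circle)" by (simp add: homeomorphism_def)
  ultimately show "\<one>\<^bsub>homeo_circle\<^esub> \<in> carrier homeo_circle" by (auto simp: homeo_circle_def)
qed (auto simp: homeo_circle_def comp_assoc)

lemma canonical_lift:
  assumes "f \<in> carrier homeo_circle"
  shows "is_lift (canonical_lift f) f" "0 \<le> canonical_lift f 0" "canonical_lift f 0 < 1"
proof -
  obtain F where F: "is_lift F f" using assms by (auto simp: homeo_circle_def)
  define H where "H = (\<lambda>x. F x + of_int (- \<lfloor>F 0\<rfloor>))"
  have H: "is_lift H f \<and> 0 \<le> H 0 \<and> H 0 < 1"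
  proof (intro conjI)
    show "is_lift H f" unfolding H_def by (rule is_lift_shift[OF F])
    show "0 \<le> H 0" "H 0 < 1" unfolding H_def by linarith+
  qed
  have "K = H" if K: "is_lift K f \<and> 0 \<le> K 0 \<and> K 0 < 1" for K
  proof -
    obtain n :: int where n: "\<And>x. K x = H x + of_int n" using is_lift_unique[of H f K] H K by blast
    then have "n = 0" using n[of 0] H K by linarith
    then show ?thesis using n by (simp add: fun_eq_iff)
  qed
  with H have "is_lift (canonical_lift f) f \<and> 0 \<le> canonical_lift f 0 \<and> canonical_lift f 0 < 1"
    unfolding canonical_lift_def by (rule theI)
  then show "is_lift (canonical_lift f) f" "0 \<le> canonical_lift f 0" "canonical_lift f 0 < 1" by auto
qed

text \<open>Pointwise form of the defining equation in the group of lifts. The product there applies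
  \<open>f\<close> first, and integer translations commute with lifts.\<close>

lemma euler_cocycle:
  assumes f: "f \<in> carrier homeo_circle" and g: "g \<in> carrier homeo_circle"
  shows "canonical_lift g (canonical_lift f x) = canonical_lift (g \<circ> f) x + of_int (euler_cocycle f g)"
proof -
  interpret L: group homeo_real_lifts by (rule group_homeo_real_lifts)
  interpret C: group homeo_circle by (rule group_homeo_circle)
  have fg: "f \<otimes>\<^bsub>homeo_circle\<^esub> g = g \<circ> f" by (simp add: homeo_circle_def)
  then have gf: "g \<circ> f \<in> carrier homeo_circle" using C.m_closed[OF f g] by simp
  define F where "F = canonical_lift f"
  define H where "H = canonical_lift g"
  define K where "K = canonical_lift (g \<circ> f)"
  define \<tau> where "\<tau> = (\<lambda>(n::int) x::real. x + of_int n)"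
  have lf: "is_lift F f" "is_lift H g" "is_lift K (g \<circ> f)"
    using canonical_lift f g gf by (auto simp: F_def H_def K_def)
  obtain n :: int where n: "\<And>x. (H \<circ> F) x = K x + of_int n"
    using is_lift_unique[OF lf(3) is_lift_comp[OF lf(1,2)]] by blast
  have car: "F \<in> carrier homeo_real_lifts" "H \<in> carrier homeo_real_lifts" "K \<in> carrier homeo_real_lifts"
    "\<tau> m \<in> carrier homeo_real_lifts" for m
    using lf translation_in_lifts by (auto simp: is_lift_def lifts_def \<tau>_def)
  have "F \<otimes>\<^bsub>homeo_real_lifts\<^esub> H = \<tau> n \<otimes>\<^bsub>homeo_real_lifts\<^esub> K"
    using n lifts_props(1)[of K _ n] lf(3)
    by (auto simp: homeo_real_lifts_def \<tau>_def fun_eq_iff is_lift_iff)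
  then have "F \<otimes>\<^bsub>homeo_real_lifts\<^esub> H \<otimes>\<^bsub>homeo_real_lifts\<^esub> inv\<^bsub>homeo_real_lifts\<^esub> K = \<tau> n"
    using car by (simp add: L.m_assoc)
  moreover have "\<tau> n = \<tau> m \<longleftrightarrow> m = n" for m by (auto simp: \<tau>_def fun_eq_iff)
  moreover have "euler_cocycle f g =
      (THE m. F \<otimes>\<^bsub>homeo_real_lifts\<^esub> H \<otimes>\<^bsub>homeo_real_lifts\<^esub> inv\<^bsub>homeo_real_lifts\<^esub> K = \<tau> m)"
    by (simp only: euler_cocycle_def fg F_def H_def K_def \<tau>_def)
  ultimately have "euler_cocycle f g = n" by simp
  then show ?thesis using n[of x] by (simp add: F_def H_def K_def)
qed

text \<open>The lift normalised to send \<open>b\<close> into \<open>[b, b + 1)\<close>. With the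
  base at \<open>b\<close> instead of 0, the chosen lifts of elements fixing
  \<open>circle_proj b\<close> fix \<open>b\<close> itself.\<close>

definition based_lift :: "real \<Rightarrow> (circle \<Rightarrow> circle) \<Rightarrow> real \<Rightarrow> real" where
  "based_lift b g x = canonical_lift g x - of_int \<lfloor>canonical_lift g b - b\<rfloor>"

text \<open>The failure of based lifts to be multiplicative, read off at \<open>b\<close>; it is the
  same integer at every point.\<close>

definition based_euler :: "real \<Rightarrow> (circle \<Rightarrow> circle) \<Rightarrow> (circle \<Rightarrow> circle) \<Rightarrow> real" where
  "based_euler b f g = based_lift b g (based_lift b f b) - based_lift b (g \<circ> f) b"

lemma based_lift:
  assumes "g \<in> carrier homeo_circle"
  shows "is_lift (based_lift b g) g" "b \<le> based_lift b g b" "based_lift b g b < b + 1"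
    "based_lift b g \<in> lifts"
proof -
  have "is_lift (\<lambda>x. canonical_lift g x + of_int (- \<lfloor>canonical_lift g b - b\<rfloor>)) g"
    by (intro is_lift_shift canonical_lift assms)
  then show l: "is_lift (based_lift b g) g" by (simp add: based_lift_def[abs_def])
  show "based_lift b g \<in> lifts" using l by (simp add: is_lift_iff)
  show "b \<le> based_lift b g b" "based_lift b g b < b + 1" unfolding based_lift_def by linarith+
qed

lemma homeo_circle_mult: "f \<otimes>\<^bsub>homeo_circle\<^esub> g = g \<circ> f" "\<one>\<^bsub>homeo_circle\<^esub> = id"
  by (simp_all add: homeo_circle_def)

lemma comp_in_homeo_circle:
  "f \<in> carrier homeo_circle \<Longrightarrow> g \<in> carrier homeo_circle \<Longrightarrow> g \<circ> f \<in> carrier homeo_circle"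
  using monoid.m_closed[OF group.is_monoid[OF group_homeo_circle]] by (metis homeo_circle_mult(1))

text \<open>Rebasing changes each lift by an integer translation, so the cocycle changes by the
  coboundary of these integers.\<close>

lemma based_euler_eq:
  fixes b :: real
  assumes f: "f \<in> carrier homeo_circle" and g: "g \<in> carrier homeo_circle"
  defines "\<phi> \<equiv> \<lambda>g. of_int \<lfloor>canonical_lift g b - b\<rfloor>"
  shows "based_euler b f g = of_int (euler_cocycle f g) - \<phi> f - \<phi> g + \<phi> (g \<circ> f)"
proof -
  have "canonical_lift g \<in> lifts" using canonical_lift(1)[OF g] by (simp add: is_lift_iff)
  then show ?thesis
    using euler_cocycle[OF f g, of b]
    by (simp add: based_euler_def based_lift_def \<phi>_def lifts_props(3))
qed

lemma based_euler_Ints: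
  "f \<in> carrier homeo_circle \<Longrightarrow> g \<in> carrier homeo_circle \<Longrightarrow> based_euler b f g \<in> \<int>"
  by (simp add: based_euler_eq)

lemma based_lift_comp:
  assumes f: "f \<in> carrier homeo_circle" and g: "g \<in> carrier homeo_circle"
  shows "based_lift b g (based_lift b f x) = based_lift b (g \<circ> f) x + based_euler b f g"
proof -
  obtain n :: int where n: "\<And>x. (based_lift b g \<circ> based_lift b f) x = based_lift b (g \<circ> f) x + of_int n"
    using is_lift_unique[OF based_lift(1)[OF comp_in_homeo_circle[OF f g]]
        is_lift_comp[OF based_lift(1)[OF f] based_lift(1)[OF g]]] by blast
  then have "based_euler b f g = of_int n" by (simp add: based_euler_def)
  then show ?thesis using n[of x] by simp
qed

lemma based_lift_shift:
  assumes "g \<in> carrier homeo_circle" "z \<in> \<int>"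
  shows "based_lift b g (x + z) = based_lift b g x + z"
  using assms lifts_props(1)[OF based_lift(4)[OF assms(1)]] by (auto elim!: Ints_cases)

text \<open>The image of \<open>b\<close> under three successive lifts is computed with both
  bracketings; integers produced on the way pass through the outer lift.\<close>

lemma based_euler_cocycle:
  assumes f: "f \<in> carrier homeo_circle" and g: "g \<in> carrier homeo_circle" and h: "h \<in> carrier homeo_circle"
  shows "based_euler b g h - based_euler b (g \<circ> f) h + based_euler b f (h \<circ> g) - based_euler b f g = 0"
proof -
  have "based_lift b h (based_lift b g (based_lift b f b)) =
      based_lift b (h \<circ> g \<circ> f) b + based_euler b f (h \<circ> g) + based_euler b g h"
    using based_lift_comp[OF g h, of b "based_lift b f b"] based_lift_comp[OF f comp_in_homeo_circle[OF g h], of b b]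
    by simp
  moreover have "based_lift b h (based_lift b g (based_lift b f b)) =
      based_lift b (h \<circ> (g \<circ> f)) b + based_euler b (g \<circ> f) h + based_euler b f g"
    using f g h by (simp add: based_lift_comp comp_in_homeo_circle based_lift_shift based_euler_Ints)
  ultimately show ?thesis by (simp add: comp_assoc)
qed

lemma based_lift_mono:
  assumes "g \<in> carrier homeo_circle"
  shows "based_lift b g x < based_lift b g y \<longleftrightarrow> x < y" "based_lift b g x \<le> based_lift b g y \<longleftrightarrow> x \<le> y"
  using lifts_props(4,5)[OF based_lift(4)[OF assms]] by auto

lemma based_lift_le:
  assumes f: "f \<in> carrier homeo_circle" and g: "g \<in> carrier homeo_circle"
  shows "based_lift b g b \<le> based_lift b g (based_lift b f b)"
    "based_lift b g (based_lift b f b) < based_lift b g b + 1"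
proof -
  show "based_lift b g b \<le> based_lift b g (based_lift b f b)"
    using based_lift(2)[OF f, of b] by (simp add: based_lift_mono(2)[OF g])
  have "based_lift b g (based_lift b f b) < based_lift b g (b + 1)"
    using based_lift(3)[OF f, of b] by (simp add: based_lift_mono(1)[OF g])
  then show "based_lift b g (based_lift b f b) < based_lift b g b + 1"
    using based_lift_shift[OF g Ints_1] by simp
qed

lemma based_euler_bound:
  assumes f: "f \<in> carrier homeo_circle" and g: "g \<in> carrier homeo_circle"
  shows "\<bar>based_euler b f g\<bar> \<le> 2"
  using based_lift(2,3)[OF g, of b] based_lift(2,3)[OF comp_in_homeo_circle[OF f g], of b]
    based_lift_le[OF f g, of b] by (simp add: based_euler_def)

lemma based_lift_fixed:
  assumes g: "g \<in> carrier homeo_circle"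
  shows "g (circle_proj b) = circle_proj b \<longleftrightarrow> based_lift b g b = b"
proof -
  have "g (circle_proj b) = circle_proj (based_lift b g b)" using based_lift(1)[OF g] by (simp add: is_lift_iff)
  then have "g (circle_proj b) = circle_proj b \<longleftrightarrow> based_lift b g b - b \<in> \<int>"
    by (simp add: circle_proj_eq_iff)
  then show ?thesis
    using Ints_abs_less_one[of "based_lift b g b - b"] based_lift(2,3)[OF g, of b] by auto
qed

text \<open>Since the lift of \<open>h\<close> fixes \<open>b\<close>, the value is a difference of
  two numbers in the same half-open unit interval, and it is an integer. This is what makes the
  based cocycle relative.\<close>

lemma based_euler_stabilizer:
  assumes h: "h \<in> carrier homeo_circle" "h (circle_proj b) = circle_proj b" and g: "g \<in> carrier homeo_circle"
  shows "based_euler b h g = 0" "based_euler b g h = 0"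
proof -
  have hb: "based_lift b h b = b" using based_lift_fixed[OF h(1)] h(2) by simp
  show "based_euler b h g = 0"
  proof (rule Ints_abs_less_one)
    show "\<bar>based_euler b h g\<bar> < 1"
      using based_lift(2,3)[OF g, of b] based_lift(2,3)[OF comp_in_homeo_circle[OF h(1) g], of b]
      by (simp add: based_euler_def hb)
  qed (rule based_euler_Ints[OF h(1) g])
  show "based_euler b g h = 0"
  proof (rule Ints_abs_less_one)
    show "\<bar>based_euler b g h\<bar> < 1"
      using based_lift_le[OF g h(1), of b] based_lift(2,3)[OF comp_in_homeo_circle[OF g h(1)], of b]
      by (simp add: based_euler_def hb)
  qed (rule based_euler_Ints[OF g h(1)])
qed

lemma based_lift_id: "based_lift b id x = x"
proof -
  have id: "id \<in> carrier homeo_circle"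
    using monoid.one_closed[OF group.is_monoid[OF group_homeo_circle]] by (simp add: homeo_circle_mult)
  have "is_lift id id" by (simp add: is_lift_iff id_in_lifts)
  then obtain n :: int where n: "\<And>x. based_lift b id x = x + of_int n"
    using is_lift_unique[OF _ based_lift(1)[OF id]] by (metis id_apply)
  then have "n = 0" using based_lift(2,3)[OF id, of b] by simp
  then show ?thesis using n by simp
qed

text \<open>The based lift of the identity is the identity, so the value is the total displacement
  of \<open>b\<close> under both lifts. Each lift moves \<open>b\<close> upwards by less than a full
  turn, and together they close up after exactly one.\<close>

lemma based_euler_inverse:
  assumes f: "f \<in> carrier homeo_circle" and g: "g \<in> carrier homeo_circle" and inv: "g \<circ> f = id"
    and move: "g (circle_proj b) \<noteq> circle_proj b"
  shows "based_euler b f g = 1"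
proof -
  have g_b: "b < based_lift b g b"
    using based_lift_fixed[OF g, of b] move based_lift(2)[OF g, of b] by simp
  then have "0 < based_euler b f g" "based_euler b f g < 2"
    using based_lift_le[OF f g, of b] based_lift(3)[OF g, of b]
    by (simp_all add: based_euler_def inv based_lift_id)
  then have "based_euler b f g - 1 = 0"
    using based_euler_Ints[OF f g, of b] by (intro Ints_abs_less_one) auto
  then show ?thesis by simp
qed

text \<open>A bound uniform in \<open>g\<close>: it makes the coboundary caused by rebasing a
  coboundary of a bounded function.\<close>

lemma canonical_lift_near:
  assumes "g \<in> carrier homeo_circle"
  shows "\<bar>of_int \<lfloor>canonical_lift g b - b\<rfloor> :: real\<bar> \<le> 3"
proof -
  note c = canonical_lift[OF assms]
  have l: "canonical_lift g \<in> lifts" using c(1) by (simp add: is_lift_iff)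
  have "canonical_lift g (0 + of_int \<lfloor>b\<rfloor>) \<le> canonical_lift g b"
    "canonical_lift g b \<le> canonical_lift g (0 + of_int (\<lfloor>b\<rfloor> + 1))"
    unfolding lifts_props(5)[OF l] by linarith+
  then have "of_int \<lfloor>b\<rfloor> \<le> canonical_lift g b" "canonical_lift g b \<le> 1 + of_int (\<lfloor>b\<rfloor> + 1)"
    using c(2,3) unfolding lifts_props(1)[OF l] by linarith+
  then show ?thesis by linarith
qed

section \<open>Germs of piecewise linear and piecewise projective maps\<close>

lemma sin_pi_eq_0_iff: "sin (pi * x) = 0 \<longleftrightarrow> x \<in> \<int>"
proof -
  have "sin (pi * x) = 0 \<longleftrightarrow> (\<exists>i::int. pi * x = of_int i * pi)" by (simp add: sin_zero_iff_int2)
  also have "\<dots> \<longleftrightarrow> (\<exists>i::int. x = of_int i)" by (auto simp: mult.commute)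
  finally show ?thesis by (auto elim: Ints_cases)
qed

lemma sin_pi_neq_0: "x \<noteq> 0 \<Longrightarrow> \<bar>x\<bar> < 1 \<Longrightarrow> sin (pi * x) \<noteq> 0"
  using Ints_abs_less_one by (auto simp: sin_pi_eq_0_iff)

lemma inj_on_cot_pi: "inj_on (\<lambda>s. cot (pi * s)) ({- 1/2<..<1/2} - {0})"
proof (rule inj_onI)
  fix x y :: real
  assume x: "x \<in> {- 1/2<..<1/2} - {0}" and y: "y \<in> {- 1/2<..<1/2} - {0}"
    and eq: "cot (pi * x) = cot (pi * y)"
  have "sin (pi * x) \<noteq> 0" "sin (pi * y) \<noteq> 0" using x y by (intro sin_pi_neq_0; auto simp: abs_less_iff)+
  then have "sin (pi * (x - y)) = 0"
    using eq by (simp add: cot_def sin_diff right_diff_distrib frac_eq_eq mult.commute)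
  then have "x - y = 0" using x y by (intro Ints_abs_less_one) (auto simp: sin_pi_eq_0_iff)
  then show "x = y" by simp
qed

text \<open>Removes the ambiguity modulo 1 when an identity on the circle is lifted to the line near
  a point.\<close>

lemma tendsto_Ints_eventually_eq:
  fixes f :: "'a \<Rightarrow> real"
  assumes F: "F \<noteq> bot" and lim: "(f \<longlongrightarrow> c) F" and int: "\<forall>\<^sub>F x in F. f x \<in> \<int>"
  shows "\<forall>\<^sub>F x in F. f x = c"
proof -
  have c: "c \<in> \<int>" using Lim_in_closed_set[OF closed_Ints int F lim] .
  have "\<forall>\<^sub>F x in F. dist (f x) c < 1" using lim by (rule tendstoD) simp
  with int show ?thesis
  proof eventually_elim
    case (elim x)
    then have "f x - c = 0" using c by (intro Ints_abs_less_one) (auto simp: dist_real_def)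
    then show ?case by simp
  qed
qed

lemma one_sided_neq_bot: "F \<in> {at_left p, at_right p} \<Longrightarrow> F \<noteq> bot" for p :: real
  using trivial_limit_at_left_real[of p] trivial_limit_at_right_real[of p] by (elim insertE) simp_all

text \<open>The arcs may overlap and are given only up to integer translation. Near \<open>p\<close>
  finitely many translates cover the line, so one of them is met arbitrarily close to
  \<open>p\<close> from the given side; being an interval, it contains a one-sided
  neighbourhood.\<close>

lemma piecewise_one_sided:
  assumes f: "piecewise P f" and F: "F \<in> {at_left p, at_right p}"
  obtains s e and n :: int where "P f s e" "\<forall>\<^sub>F t in F. t - of_int n \<in> {s..e}"
proof -
  obtain I where I: "finite I" "\<And>s e. (s, e) \<in> I \<Longrightarrow> P f s e"
    and cover: "(\<Union>(s, e)\<in>I. circle_proj ` {s..e}) = UNIV"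
    using f unfolding piecewise_def by blast
  \<comment> \<open>The integer range contains every translate of an arc that meets the interval
    from \<open>p - 1\<close> to \<open>p + 1\<close>.\<close>
  define K where "K = (SIGMA i:I. {\<lfloor>p - 1 - snd i\<rfloor>..\<lceil>p + 1 - fst i\<rceil>})"
  have nb: "F \<noteq> bot" by (rule one_sided_neq_bot[OF F])
  have id: "((\<lambda>t. t) \<longlongrightarrow> p) F" using F by auto
  have "\<forall>\<^sub>F t in F. t \<in> {p - 1<..<p + 1}"
    using order_tendstoD[OF id, of "p - 1"] order_tendstoD[OF id, of "p + 1"]
    by (simp add: eventually_conj_iff)
  then have "\<forall>\<^sub>F t in F. \<exists>k\<in>K. t - of_int (snd k) \<in> {fst (fst k)..snd (fst k)}"
  proof (rule eventually_mono)
    fix t assume t: "t \<in> {p - 1<..<p + 1}"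
    have "circle_proj t \<in> (\<Union>(s, e)\<in>I. circle_proj ` {s..e})" using cover by simp
    then obtain s e t' where se: "(s, e) \<in> I" "t' \<in> {s..e}" "circle_proj t = circle_proj t'" by auto
    then obtain n where n: "t - t' = of_int n" by (auto simp: circle_proj_eq_iff elim: Ints_cases)
    have "((s, e), n) \<in> K"
      using t se(1,2) n by (auto simp: K_def floor_le_iff le_ceiling_iff)
    then show "\<exists>k\<in>K. t - of_int (snd k) \<in> {fst (fst k)..snd (fst k)}"
      using se(2) n by (intro bexI[of _ "((s, e), n)"]) auto
  qed
  then have "\<exists>\<^sub>F t in F. \<exists>k\<in>K. t - of_int (snd k) \<in> {fst (fst k)..snd (fst k)}"
    by (rule eventually_frequently[OF nb])
  moreover have "finite K" using I(1) by (simp add: K_def)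
  ultimately obtain k where k: "k \<in> K" "\<exists>\<^sub>F t in F. t - of_int (snd k) \<in> {fst (fst k)..snd (fst k)}"
    by (auto simp: frequently_bex_finite_distrib)
  obtain s e n where [simp]: "k = ((s, e), n)" by (metis surj_pair)
  have iff: "t - of_int n \<in> {s..e} \<longleftrightarrow> t \<in> {s + of_int n..e + of_int n}" for t by auto
  have "\<exists>\<^sub>F t in F. t \<in> {s + of_int n..e + of_int n}"
    using k(2) by (simp only: iff fst_conv snd_conv \<open>k = ((s, e), n)\<close>)
  then have "\<not> (\<forall>\<^sub>F t in F. t \<notin> {s + of_int n..e + of_int n})"
    unfolding frequently_def .
  then have "\<forall>\<^sub>F t in F. t - of_int n \<in> {s..e}"
    unfolding iff using eventually_Icc_or_not[OF F] by blast
  moreover have "P f s e" using k(1) I(2) by (simp add: K_def)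
  ultimately show thesis by (rule that[rotated])
qed

text \<open>With \<open>(sin, cos)\<close> as homogeneous coordinates and denominators cleared, the
  relation also holds at the poles and is continuous in both variables.\<close>

lemma moebius_circle:
  assumes "circle_to_projline (circle_proj y) = Defs.moebius a b c d (circle_to_projline (circle_proj x))"
  shows "sin (pi * y) * (c * sin (pi * x) + d * cos (pi * x)) =
         cos (pi * y) * (a * sin (pi * x) + b * cos (pi * x))"
proof (cases "cos (pi * x) = 0")
  case True
  then have "if c = 0 then cos (pi * y) = 0 else cos (pi * y) \<noteq> 0 \<and> sin (pi * y) / cos (pi * y) = a / c"
    using assms by (auto simp: circle_to_projline.abs_eq tan_def split: if_splits)
  then show ?thesis using True by (auto simp: field_simps split: if_splits)
next
  case False
  define M where "M = a * tan (pi * x) + b"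
  define N where "N = c * tan (pi * x) + d"
  have MN: "a * sin (pi * x) + b * cos (pi * x) = M * cos (pi * x)"
    "c * sin (pi * x) + d * cos (pi * x) = N * cos (pi * x)"
    using False by (simp_all add: M_def N_def tan_def field_simps)
  have "if N = 0 then cos (pi * y) = 0 else cos (pi * y) \<noteq> 0 \<and> sin (pi * y) / cos (pi * y) = M / N"
    using assms False by (auto simp: circle_to_projline.abs_eq M_def N_def tan_def split: if_splits)
  then have "sin (pi * y) * N = cos (pi * y) * M" by (auto simp: field_simps split: if_splits)
  then show ?thesis unfolding MN by simp
qed

context
  fixes L :: "real \<Rightarrow> real" and f :: "circle \<Rightarrow> circle" and p :: real and F :: "real filter"
  assumes L: "is_lift L f" and p: "L p = p" and F: "F \<in> {at_left p, at_right p}"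
begin

lemma one_sided_filter:
  shows "F \<noteq> bot" "((\<lambda>t. t) \<longlongrightarrow> p) F" "(L \<longlongrightarrow> p) F"
    "\<forall>\<^sub>F t in F. t \<noteq> p" "\<forall>\<^sub>F t in F. L t \<noteq> p"
proof -
  have l: "L \<in> lifts" using L by (simp add: is_lift_iff)
  show "F \<noteq> bot" by (rule one_sided_neq_bot[OF F])
  show "((\<lambda>t. t) \<longlongrightarrow> p) F" using F by auto
  have "isCont L p" using lifts_props(6)[OF l] by (simp add: continuous_on_eq_continuous_at)
  then have "(L \<longlongrightarrow> p) (at p)" using p by (simp add: isCont_def)
  then have "(L \<longlongrightarrow> p) (at p within S)" for S by (rule tendsto_within_subset) simp
  then show "(L \<longlongrightarrow> p) F" using F by auto
  show *: "\<forall>\<^sub>F t in F. t \<noteq> p" using F by (auto simp: eventually_at_filter)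
  have "L t \<noteq> p" if "t \<noteq> p" for t
    using lifts_props(4)[OF l, of t p] lifts_props(4)[OF l, of p t] p that by force
  with * show "\<forall>\<^sub>F t in F. L t \<noteq> p" by (rule eventually_mono)
qed

text \<open>Because \<open>p\<close> is fixed, the affine branch is multiplication by
  \<open>a\<close> around \<open>p\<close>, so in the coordinate \<open>inverse\<close> it is linear
  without translation part. Injectivity of the lift gives a nonzero slope.\<close>

lemma linear_germ:
  assumes "piecewise_linear f"
  shows "\<exists>\<alpha> \<beta>. \<alpha> \<noteq> 0 \<and> (\<forall>\<^sub>F t in F. inverse (L t - p) = \<alpha> * inverse (t - p) + \<beta>)"
proof -
  note Fs = one_sided_filter
  obtain s e and n :: int where arc: "affine_on_arc f s e" "\<forall>\<^sub>F t in F. t - of_int n \<in> {s..e}"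
    using piecewise_one_sided assms F unfolding piecewise_linear_def by metis
  obtain a b where ab: "\<And>t. t \<in> {s..e} \<Longrightarrow> f (circle_proj t) = circle_proj (a * t + b)"
    using arc(1) unfolding affine_on_arc_def by blast
  define c where "c = p - a * p + (a * of_int n - b)"
  have "\<forall>\<^sub>F t in F. L t - a * t + (a * of_int n - b) \<in> \<int>"
    using arc(2)
  proof (rule eventually_mono)
    fix t assume "t - of_int n \<in> {s..e}"
    from ab[OF this] have "circle_proj (L t) = circle_proj (a * (t - of_int n) + b)"
      using L by (simp add: is_lift_iff)
    then have "L t - (a * (t - of_int n) + b) \<in> \<int>" by (simp add: circle_proj_eq_iff)
    then show "L t - a * t + (a * of_int n - b) \<in> \<int>" by (simp add: algebra_simps)
  qed
  moreover have "((\<lambda>t. L t - a * t + (a * of_int n - b)) \<longlongrightarrow> c) F"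
    unfolding c_def by (intro tendsto_intros Fs)
  ultimately have "\<forall>\<^sub>F t in F. L t - a * t + (a * of_int n - b) = c"
    by (intro tendsto_Ints_eventually_eq Fs)
  then have lin: "\<forall>\<^sub>F t in F. L t - p = a * (t - p)"
    by (rule eventually_mono) (simp add: c_def algebra_simps)
  have "\<forall>\<^sub>F t in F. L t - p = a * (t - p) \<and> L t \<noteq> p"
    using lin Fs(5) by eventually_elim simp
  then have "\<exists>t. L t - p = a * (t - p) \<and> L t \<noteq> p"
    using Fs(1) eventually_happens' by blast
  then have "a \<noteq> 0" by auto
  moreover have "\<forall>\<^sub>F t in F. inverse (L t - p) = inverse a * inverse (t - p) + 0"
    using lin by (rule eventually_mono) simp
  ultimately show ?thesis by (intro exI[of _ "inverse a"] exI[of _ 0]) simp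
qed

text \<open>After rotating \<open>p\<close> to 0, the matrix fixes 0 and is lower triangular. In the
  reciprocal of the tangent such a map is affine.\<close>

lemma projective_germ:
  assumes "piecewise_projective f"
  shows "\<exists>\<alpha> \<beta>. \<alpha> \<noteq> 0 \<and> (\<forall>\<^sub>F t in F. cot (pi * (L t - p)) = \<alpha> * cot (pi * (t - p)) + \<beta>)"
proof -
  note Fs = one_sided_filter
  obtain s e and n :: int where arc: "projective_on_arc f s e" "\<forall>\<^sub>F t in F. t - of_int n \<in> {s..e}"
    using piecewise_one_sided assms F unfolding piecewise_projective_def by metis
  obtain a b c d where det: "a * d - b * c = 1"
    and moe: "\<And>t. t \<in> {s..e} \<Longrightarrow> circle_to_projline (f (circle_proj t)) =
                    Defs.moebius a b c d (circle_to_projline (circle_proj t))"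
    using arc(1) unfolding projective_on_arc_def by blast
  define sp where "sp = sin (pi * p)"
  define cp where "cp = cos (pi * p)"
  have unit: "sp * sp + cp * cp = 1" unfolding sp_def cp_def by (simp flip: power2_eq_square)
  \<comment> \<open>\<open>A\<close>, \<open>B\<close>, \<open>C\<close>, \<open>D\<close> are the
    entries of the matrix conjugated by the rotation through \<open>pi * p\<close>.\<close>
  define A where "A = cp * (a * cp - b * sp) - sp * (c * cp - d * sp)"
  define B where "B = cp * (a * sp + b * cp) - sp * (c * sp + d * cp)"
  define C where "C = cp * (c * cp - d * sp) + sp * (a * cp - b * sp)"
  define D where "D = cp * (c * sp + d * cp) + sp * (a * sp + b * cp)"
  have "A * D - B * C = (a * d - b * c) * ((sp * sp + cp * cp) * (sp * sp + cp * cp))"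
    by (simp add: A_def B_def C_def D_def algebra_simps)
  then have det': "A * D - B * C = 1" by (simp add: det unit)
  let ?S = "\<lambda>t. pi * (L t - p)" and ?s = "\<lambda>t. pi * (t - p)"
  have rel: "\<forall>\<^sub>F t in F. sin (?S t) * (sin (?s t) * C + cos (?s t) * D) =
      cos (?S t) * (sin (?s t) * A + cos (?s t) * B)"
    using arc(2)
  proof (rule eventually_mono)
    fix t assume "t - of_int n \<in> {s..e}"
    from moe[OF this] have "circle_to_projline (circle_proj (L t)) =
        Defs.moebius a b c d (circle_to_projline (circle_proj t))"
      using L by (simp add: is_lift_iff)
    then have eq: "sin (pi * L t) * (c * sin (pi * t) + d * cos (pi * t)) =
        cos (pi * L t) * (a * sin (pi * t) + b * cos (pi * t))" by (rule moebius_circle)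
    have "pi * L t = ?S t + pi * p" "pi * t = ?s t + pi * p" by (simp_all add: algebra_simps)
    then have expand: "sin (pi * L t) = sin (?S t) * cp + cos (?S t) * sp"
      "cos (pi * L t) = cos (?S t) * cp - sin (?S t) * sp"
      "sin (pi * t) = sin (?s t) * cp + cos (?s t) * sp"
      "cos (pi * t) = cos (?s t) * cp - sin (?s t) * sp"
      unfolding sp_def cp_def by (metis sin_add, metis cos_add, metis sin_add, metis cos_add)
    have "X * (x * C + y * D) - Y * (x * A + y * B) =
        (X * cp + Y * sp) * (c * (x * cp + y * sp) + d * (y * cp - x * sp)) -
        (Y * cp - X * sp) * (a * (x * cp + y * sp) + b * (y * cp - x * sp))" for X Y x y
      by (simp add: A_def B_def C_def D_def algebra_simps)
    then have "sin (?S t) * (sin (?s t) * C + cos (?s t) * D) - cos (?S t) * (sin (?s t) * A + cos (?s t) * B) = 0"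
      using eq unfolding expand by simp
    then show "sin (?S t) * (sin (?s t) * C + cos (?s t) * D) = cos (?S t) * (sin (?s t) * A + cos (?s t) * B)"
      by simp
  qed
  \<comment> \<open>At \<open>p\<close> both angles vanish: the left side of the relation tends to 0
    and the right side to \<open>B\<close>.\<close>
  have "((\<lambda>t. sin (?S t) * (sin (?s t) * C + cos (?s t) * D)) \<longlongrightarrow>
      sin (pi * (p - p)) * (sin (pi * (p - p)) * C + cos (pi * (p - p)) * D)) F"
    by (intro tendsto_intros Fs)
  moreover have "((\<lambda>t. cos (?S t) * (sin (?s t) * A + cos (?s t) * B)) \<longlongrightarrow>
      cos (pi * (p - p)) * (sin (pi * (p - p)) * A + cos (pi * (p - p)) * B)) F"
    by (intro tendsto_intros Fs)
  ultimately have B: "B = 0"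
    using tendsto_unique[OF Fs(1)] tendsto_cong[OF rel] by fastforce
  with det' have AD: "A \<noteq> 0" "D \<noteq> 0" by auto
  have "\<forall>\<^sub>F t in F. dist t p < 1" "\<forall>\<^sub>F t in F. dist (L t) p < 1" using Fs by (auto intro: tendstoD)
  with rel Fs(4,5) have "\<forall>\<^sub>F t in F. cot (?S t) = D / A * cot (?s t) + C / A"
  proof eventually_elim
    case (elim t)
    have "sin (?s t) \<noteq> 0" "sin (?S t) \<noteq> 0"
      using elim(2-5) sin_pi_neq_0[of "t - p"] sin_pi_neq_0[of "L t - p"] by (simp_all add: dist_real_def)
    then show ?case using elim(1) AD B by (simp add: cot_def field_simps)
  qed
  then show ?thesis using AD by (intro exI[of _ "D / A"] exI[of _ "C / A"]) simp
qed

end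

section \<open>Groups acting on the circle\<close>

locale circle_group =
  fixes G :: "(circle \<Rightarrow> circle) set"
  assumes G: "subgroup G homeo_circle"
begin

abbreviation "\<Gamma> \<equiv> homeo_circle\<lparr>carrier := G\<rparr>"

lemma group_\<Gamma>: "group \<Gamma>"
  by (rule group.subgroup_imp_group[OF group_homeo_circle G])

sublocale \<Gamma>: group \<Gamma> by (rule group_\<Gamma>)

lemma \<Gamma>_mult: "g \<otimes>\<^bsub>\<Gamma>\<^esub> h = h \<circ> g"
  by (simp add: homeo_circle_mult)

lemma G_homeo: "g \<in> G \<Longrightarrow> g \<in> carrier homeo_circle"
  using subgroup.subset[OF G] by blast

lemma G_comp: "g \<in> G \<Longrightarrow> h \<in> G \<Longrightarrow> h \<circ> g \<in> G"
  using \<Gamma>.m_closed[of g h] by (simp add: homeo_circle_mult)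

lemma G_inv:
  assumes "g \<in> G"
  shows "inv\<^bsub>\<Gamma>\<^esub> g \<in> G" "(inv\<^bsub>\<Gamma>\<^esub> g) (g x) = x" "g ((inv\<^bsub>\<Gamma>\<^esub> g) x) = x"
proof -
  have g: "g \<in> carrier \<Gamma>" using assms by simp
  show "inv\<^bsub>\<Gamma>\<^esub> g \<in> G" using \<Gamma>.inv_closed[OF g] by simp
  show "(inv\<^bsub>\<Gamma>\<^esub> g) (g x) = x" "g ((inv\<^bsub>\<Gamma>\<^esub> g) x) = x"
    using fun_cong[OF \<Gamma>.r_inv[OF g], of x] fun_cong[OF \<Gamma>.l_inv[OF g], of x]
    by (simp_all add: homeo_circle_mult)
qed

definition stab :: "circle \<Rightarrow> (circle \<Rightarrow> circle) set" where
  "stab x = {g \<in> G. g x = x}"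

lemma subgroup_stab: "subgroup (stab x) \<Gamma>"
proof (rule \<Gamma>.subgroupI)
  have "id \<in> G" using \<Gamma>.one_closed by (simp add: homeo_circle_mult)
  then show "stab x \<noteq> {}" by (auto simp: stab_def)
  show "inv\<^bsub>\<Gamma>\<^esub> g \<in> stab x" if "g \<in> stab x" for g
    using that G_inv(1)[of g] G_inv(2)[of g x] by (simp add: stab_def)
qed (auto simp: stab_def homeo_circle_mult G_comp)

lemma stab_coset:
  assumes "g \<in> G" "k \<in> G" "g x = k x"
  shows "\<exists>h\<in>stab x. g = h \<otimes>\<^bsub>\<Gamma>\<^esub> k"
proof (rule bexI)
  show "g = (inv\<^bsub>\<Gamma>\<^esub> k \<circ> g) \<otimes>\<^bsub>\<Gamma>\<^esub> k" by (simp add: homeo_circle_mult fun_eq_iff G_inv(3)[OF assms(2)])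
  show "inv\<^bsub>\<Gamma>\<^esub> k \<circ> g \<in> stab x"
    using assms G_comp[OF assms(1) G_inv(1)[OF assms(2)]] by (simp add: stab_def G_inv(2))
qed

text \<open>Cutting the circle at the fixed point turns the stabiliser into a group acting on
  \<open>[b, b + 1]\<close>. Its based lifts compose exactly because the based Euler cocycle
  vanishes on it, and the extension acts through its first component.\<close>

lemma additive_on_stab:
  assumes pw: "(\<forall>f\<in>G. piecewise_linear f) \<or> (\<forall>f\<in>G. piecewise_projective f)"
    and \<omega>: "\<omega> \<in> bounded_cocycles2 \<Gamma>" and hq: "homogeneous_quasimorphism (central_ext \<Gamma> \<omega>) q D"
  shows "homogeneous_quasimorphism.additive_on (central_ext \<Gamma> \<omega>) q (stab (circle_proj b) \<times> UNIV)"
proof -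
  define H where "H = stab (circle_proj b)"
  have HG: "h \<in> G" if "h \<in> H" for h using that by (simp add: H_def stab_def)
  interpret c: bounded_cocycle \<Gamma> \<omega> by unfold_locales (rule \<omega>)
  interpret hq: homogeneous_quasimorphism "central_ext \<Gamma> \<omega>" q D by (rule hq)
  let ?E = "central_ext \<Gamma> \<omega>\<lparr>carrier := H \<times> UNIV\<rparr>"
  have sub: "subgroup (H \<times> UNIV) (central_ext \<Gamma> \<omega>)"
    unfolding H_def by (rule c.subgroup_central_ext[OF subgroup_stab])
  define T where "T = (\<lambda>x :: (circle \<Rightarrow> circle) \<times> real. based_lift b (fst x))"
  have Tb: "T x b = b" if "x \<in> H \<times> UNIV" for x
    using that based_lift_fixed[OF G_homeo, of "fst x" b] by (auto simp: T_def H_def stab_def)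
  have T_lift: "is_lift (T x) (fst x)" "T x \<in> lifts" if "x \<in> H \<times> UNIV" for x
    using based_lift(1,4)[OF G_homeo, of "fst x" b] that HG by (auto simp: T_def)
  have "\<exists>(u :: real \<Rightarrow> real) r. 0 < r \<and> inj_on u ({- r<..<r} - {0}) \<and>
      (\<forall>x\<in>H \<times> UNIV. \<forall>p. \<forall>F\<in>{at_left p, at_right p}. T x p = p \<longrightarrow>
        (\<exists>\<alpha> \<beta>. \<alpha> \<noteq> 0 \<and> (\<forall>\<^sub>F t in F. u (T x t - p) = \<alpha> * u (t - p) + \<beta>)))"
    using pw
  proof
    assume pl: "\<forall>f\<in>G. piecewise_linear f"
    have "inj_on inverse ({- 1<..<1 :: real} - {0})" by (rule inj_onI) simp
    moreover have "\<exists>\<alpha> \<beta>. \<alpha> \<noteq> 0 \<and> (\<forall>\<^sub>F t in F. inverse (T x t - p) = \<alpha> * inverse (t - p) + \<beta>)"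
      if "x \<in> H \<times> UNIV" "F \<in> {at_left p, at_right p}" "T x p = p" for x p F
      by (rule linear_germ[OF T_lift(1)[OF that(1)] that(3,2)]) (use that pl HG in auto)
    ultimately show ?thesis by (intro exI[of _ inverse] exI[of _ 1]) auto
  next
    assume pp: "\<forall>f\<in>G. piecewise_projective f"
    have "\<exists>\<alpha> \<beta>. \<alpha> \<noteq> 0 \<and> (\<forall>\<^sub>F t in F. cot (pi * (T x t - p)) = \<alpha> * cot (pi * (t - p)) + \<beta>)"
      if "x \<in> H \<times> UNIV" "F \<in> {at_left p, at_right p}" "T x p = p" for x p F
      by (rule projective_germ[OF T_lift(1)[OF that(1)] that(3,2)]) (use that pp HG in auto)
    then show ?thesis using inj_on_cot_pi by (intro exI[of _ "\<lambda>s. cot (pi * s)"] exI[of _ "1 / 2"]) auto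
  qed
  then obtain u :: "real \<Rightarrow> real" and r where r: "0 < r" and u: "inj_on u ({- r<..<r} - {0})"
    and germ: "\<And>x p F. \<lbrakk>x \<in> H \<times> UNIV; F \<in> {at_left p, at_right p}; T x p = p\<rbrakk> \<Longrightarrow>
        \<exists>\<alpha> \<beta>. \<alpha> \<noteq> 0 \<and> (\<forall>\<^sub>F t in F. u (T x t - p) = \<alpha> * u (t - p) + \<beta>)"
    by blast
  interpret E': group ?E by (rule group.subgroup_imp_group[OF c.group_central_ext sub])
  interpret germ_affine_action ?E T u r b "b + 1"
  proof
    fix x y t assume xy: "x \<in> carrier ?E" "y \<in> carrier ?E"
    have "based_lift b (fst y) (based_lift b (fst x) t) = based_lift b (fst y \<circ> fst x) t"
      using based_lift_comp[of "fst x" "fst y" b t] based_euler_stabilizer(1)[of "fst x" b "fst y"]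
        xy G_homeo by (auto simp: H_def stab_def)
    moreover have "fst (x \<otimes>\<^bsub>?E\<^esub> y) = fst y \<circ> fst x"
      using fst_mult_central_ext[of \<Gamma> \<omega> x y] by (simp add: homeo_circle_mult)
    ultimately show "T (x \<otimes>\<^bsub>?E\<^esub> y) t = T y (T x t)" by (simp add: T_def)
  next
    fix t show "T \<one>\<^bsub>?E\<^esub> t = t"
      by (simp add: T_def central_ext_simps(3) homeo_circle_mult based_lift_id)
  next
    fix x assume x: "x \<in> carrier ?E"
    then have xH: "x \<in> H \<times> UNIV" by simp
    show "strict_mono (T x)" "continuous_on UNIV (T x)" "T x (b + 1) = b + 1"
      using lifts_props(2,4,6)[OF T_lift(2)[OF xH]] Tb[OF xH] by (auto intro: strict_monoI)
    show "T x b = b" by (rule Tb[OF xH])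
  next
    fix x p F assume "x \<in> carrier ?E" "T x p = p" "F \<in> {at_left p, at_right p}"
    then show "\<exists>\<alpha> \<beta>. \<alpha> \<noteq> 0 \<and> (\<forall>\<^sub>F t in F. u (T x t - p) = \<alpha> * u (t - p) + \<beta>)"
      by (intro germ) auto
  qed (use r u in auto)
  interpret q': homogeneous_quasimorphism ?E q D by (rule hq.homogeneous_quasimorphism_subgroup[OF sub])
  \<comment> \<open>An element fixing a whole fundamental interval has first component
    \<open>id\<close>; any two such elements commute.\<close>
  have "q'.additive_on {x \<in> carrier ?E. \<forall>t\<in>{b..b + 1}. T x t = t}"
    unfolding q'.additive_on_def
  proof (intro ballI q'.q_mult_commuting)
    fix x y assume x: "x \<in> {x \<in> carrier ?E. \<forall>t\<in>{b..b + 1}. T x t = t}"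
      and y: "y \<in> {x \<in> carrier ?E. \<forall>t\<in>{b..b + 1}. T x t = t}"
    then show "x \<in> carrier ?E" "y \<in> carrier ?E" by simp_all
    have "fst x = id" if x: "x \<in> {x \<in> carrier ?E. \<forall>t\<in>{b..b + 1}. T x t = t}" for x
    proof
      fix z
      obtain t where t: "z = circle_proj t" "b \<le> t" "t < b + 1" by (rule circle_proj_cases_from)
      have "fst x z = circle_proj (T x t)" using T_lift(1)[of x] x t(1) by (simp add: is_lift_iff)
      then show "fst x z = id z" using x t by simp
    qed
    then have "fst x = id" "fst y = id" using x y by blast+
    then show "x \<otimes>\<^bsub>?E\<^esub> y = y \<otimes>\<^bsub>?E\<^esub> x"
      by (cases x; cases y) (simp add: central_ext_simps(2))
  qed
  then have "q'.additive_on (carrier ?E)"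
    by (rule additive_of_additive_kernel[OF q'.homogeneous_quasimorphism_axioms]) simp
  then have "\<forall>x\<in>H \<times> UNIV. \<forall>y\<in>H \<times> UNIV. q (x \<otimes>\<^bsub>central_ext \<Gamma> \<omega>\<^esub> y) = q x + q y"
    unfolding q'.additive_on_def by simp
  then show ?thesis unfolding hq.additive_on_def H_def .
qed

end

section \<open>Circular order of pairs and triples\<close>

lemma circularly_ordered2:
  assumes "x \<noteq> y"
  shows "circularly_ordered [x, y]"
proof -
  obtain s where s: "x = circle_proj s" by (rule circle_proj_cases)
  obtain t where t: "y = circle_proj t" "s \<le> t" "t < s + 1" by (rule circle_proj_cases_from)
  then have "s < t" using assms s by (cases "s = t") auto
  then show ?thesis using s t by (auto simp: circularly_ordered_def intro!: exI[of _ "[s, t]"])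
qed

lemma circularly_ordered3_cases:
  assumes "x \<noteq> y" "x \<noteq> z" "y \<noteq> z"
  shows "circularly_ordered [x, y, z] \<or> circularly_ordered [x, z, y]"
proof -
  obtain s where s: "x = circle_proj s" by (rule circle_proj_cases)
  obtain t where t: "y = circle_proj t" "s \<le> t" "t < s + 1" by (rule circle_proj_cases_from)
  obtain u where u: "z = circle_proj u" "s \<le> u" "u < s + 1" by (rule circle_proj_cases_from)
  have "s < t" "s < u" "t \<noteq> u" using assms s t u by (auto simp: order.strict_iff_order)
  then consider "s < t" "t < u" | "s < u" "u < t" by linarith
  then show ?thesis
  proof cases
    case 1
    then have "circularly_ordered [x, y, z]"
      using s t u by (auto simp: circularly_ordered_def intro!: exI[of _ "[s, t, u]"])
    then show ?thesis ..
  next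
    case 2
    then have "circularly_ordered [x, z, y]"
      using s t u by (auto simp: circularly_ordered_def intro!: exI[of _ "[s, u, t]"])
    then show ?thesis ..
  qed
qed

lemma circularly_ordered3_distinct:
  assumes "circularly_ordered [x, y, z]"
  shows "x \<noteq> y" "x \<noteq> z" "y \<noteq> z"
proof -
  obtain ts where ts: "[x, y, z] = map circle_proj ts" "sorted_wrt (<) ts" "\<forall>t\<in>set ts. t < hd ts + 1"
    using assms unfolding circularly_ordered_def by (elim exE conjE) (rule that)
  then obtain s t u where "ts = [s, t, u]" by (auto simp: Cons_eq_map_conv)
  then have p: "x = circle_proj s" "y = circle_proj t" "z = circle_proj u"
    and o: "s < t" "t < u" "u < s + 1" using ts by auto
  have "circle_proj v \<noteq> circle_proj w" if "v < w" "w < v + 1" for v w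
    using Ints_abs_less_one[of "v - w"] that by (auto simp: circle_proj_eq_iff)
  then show "x \<noteq> y" "x \<noteq> z" "y \<noteq> z" unfolding p using o by auto
qed

theorem theorem1p6:
  fixes G :: "(circle \<Rightarrow> circle) set" and Y :: "circle set"
  assumes "subgroup G homeo_circle"
    and "(\<forall>f\<in>G. piecewise_linear f) \<or> (\<forall>f\<in>G. piecewise_projective f)"
    and "is_orbit G Y"
    and "transitive_on_circ_tuples G 2 Y"
    and "transitive_on_circ_tuples G 3 Y"
  shows "let \<Gamma> = homeo_circle\<lparr>carrier := G\<rparr> in
         vectorspace class_ring (bounded_H2 \<Gamma>) \<and>
         vectorspace.dim class_ring (bounded_H2 \<Gamma>) = 1 \<and>
         module.span class_ring (bounded_H2 \<Gamma>) {real_euler_class \<Gamma> (\<lambda>g. g)}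
           = carrier (bounded_H2 \<Gamma>)"
proof -
  interpret circle_group G by (rule circle_group.intro[OF assms(1)])
  obtain xs where "xs \<in> circ_tuples 3 Y"
    using assms(5) by (auto simp: transitive_on_circ_tuples_def)
  then obtain x y z where Y: "x \<in> Y" "y \<in> Y" "z \<in> Y" and pos: "circularly_ordered [x, y, z]"
    by (auto simp: circ_tuples_def numeral_3_eq_3 length_Suc_conv)
  note dist = circularly_ordered3_distinct[OF pos]
  obtain b where b: "x = circle_proj b" by (rule circle_proj_cases)
  obtain y0 where y0: "Y = {g y0 | g. g \<in> G}" using assms(3) by (auto simp: is_orbit_def)
  have gY: "g v \<in> Y" if "g \<in> G" "v \<in> Y" for g v
  proof -
    obtain h where h: "h \<in> G" "v = h y0" using \<open>v \<in> Y\<close> unfolding y0 by blast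
    then have "g v = (g \<circ> h) y0" by simp
    then show ?thesis using G_comp[OF h(1) \<open>g \<in> G\<close>] unfolding y0 by blast
  qed
  have orbit: "\<exists>g\<in>G. g x = v" if v: "v \<in> Y" for v
  proof -
    obtain g h where gh: "g \<in> G" "x = g y0" "h \<in> G" "v = h y0" using Y(1) v unfolding y0 by blast
    then show ?thesis
      using G_comp[OF G_inv(1)[OF gh(1)] gh(3)] G_inv(2)[OF gh(1)] by (intro bexI[of _ "h \<circ> inv\<^bsub>\<Gamma>\<^esub> g"]) simp_all
  qed
  \<comment> \<open>Transitivity on pairs, used with the first entry kept at \<open>x\<close>: the
    stabiliser of \<open>x\<close> is transitive on the rest of the orbit, which gives the single
    nontrivial double coset.\<close>
  have trans2: "\<exists>g\<in>G. g x = x \<and> g v = w" if "v \<in> Y" "w \<in> Y" "x \<noteq> v" "x \<noteq> w" for v w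
  proof -
    have "[x, v] \<in> circ_tuples 2 Y" "[x, w] \<in> circ_tuples 2 Y"
      using that Y circularly_ordered2 by (auto simp: circ_tuples_def)
    then obtain g where "g \<in> G" "map g [x, v] = [x, w]"
      using assms(4) unfolding transitive_on_circ_tuples_def by blast
    then show ?thesis by auto
  qed
  have trans3: "\<exists>g\<in>G. g x = x \<and> g v = y \<and> g w = z"
    if "v \<in> Y" "w \<in> Y" "circularly_ordered [x, v, w]" for v w
  proof -
    have "[x, v, w] \<in> circ_tuples 3 Y" "[x, y, z] \<in> circ_tuples 3 Y"
      using that Y pos by (auto simp: circ_tuples_def)
    then obtain g where "g \<in> G" "map g [x, v, w] = [x, y, z]"
      using assms(5) unfolding transitive_on_circ_tuples_def by blast
    then show ?thesis by auto
  qed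
  obtain p2 where p2G: "p2 \<in> G" "p2 x = y" using orbit[OF Y(2)] by blast
  obtain k where k: "k \<in> G" "k x = z" using orbit[OF Y(3)] by blast
  \<comment> \<open>Chosen so that the model triple \<open>(x, y, z)\<close> becomes
    \<open>(x, p2 x, p2 (p1 x))\<close>, the triple of the pair \<open>(p1, p2)\<close>.\<close>
  define p1 where "p1 = inv\<^bsub>\<Gamma>\<^esub> p2 \<circ> k"
  have p1G: "p1 \<in> G" unfolding p1_def by (rule G_comp[OF k(1) G_inv(1)[OF p2G(1)]])
  have p12x: "p2 (p1 x) = z" using k G_inv(3)[OF p2G(1)] by (simp add: p1_def)
  have p1_move: "p1 x \<noteq> x" using p12x p2G(2) dist by auto
  interpret two_triple_orbits \<Gamma> "stab x" p1 p2
  proof (rule two_triple_orbits.intro[OF group_\<Gamma> two_triple_orbits_axioms.intro])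
    show "subgroup (stab x) \<Gamma>" by (rule subgroup_stab)
    show "p1 \<in> carrier \<Gamma>" "p2 \<in> carrier \<Gamma>" using p1G p2G by simp_all
    show "p1 \<notin> stab x" "p2 \<notin> stab x" using p1_move p2G dist by (auto simp: stab_def)
    show "p1 \<otimes>\<^bsub>\<Gamma>\<^esub> p2 \<notin> stab x" using p12x dist by (simp add: stab_def homeo_circle_mult)
  next
    fix g assume "g \<in> carrier \<Gamma>" "g \<notin> stab x"
    then have g: "g \<in> G" "g x \<noteq> x" by (auto simp: stab_def)
    obtain h where h: "h \<in> G" "h x = x" "h (g x) = p1 x"
      using trans2[of "g x" "p1 x"] gY[OF g(1) Y(1)] gY[OF p1G Y(1)] g(2) p1_move by metis
    obtain h' where h': "h' \<in> stab x" "h \<circ> g = h' \<otimes>\<^bsub>\<Gamma>\<^esub> p1"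
      using stab_coset[OF G_comp[OF g(1) h(1)] p1G, of x] h(3) by auto
    have "g = h' \<otimes>\<^bsub>\<Gamma>\<^esub> p1 \<otimes>\<^bsub>\<Gamma>\<^esub> inv\<^bsub>\<Gamma>\<^esub> h"
      unfolding h'(2)[symmetric] by (simp add: homeo_circle_mult fun_eq_iff G_inv(2)[OF h(1)])
    moreover have "inv\<^bsub>\<Gamma>\<^esub> h \<in> stab x"
      by (rule subgroup.m_inv_closed[OF subgroup_stab]) (use h in \<open>simp add: stab_def\<close>)
    ultimately show "\<exists>h\<in>stab x. \<exists>h'\<in>stab x. g = h \<otimes>\<^bsub>\<Gamma>\<^esub> p1 \<otimes>\<^bsub>\<Gamma>\<^esub> h'" using h'(1) by blast
  next
    fix g1 g2 assume "g1 \<in> carrier \<Gamma>" "g2 \<in> carrier \<Gamma>" "g1 \<notin> stab x" "g2 \<notin> stab x"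
      and g12: "g1 \<otimes>\<^bsub>\<Gamma>\<^esub> g2 \<notin> stab x"
    then have g: "g1 \<in> G" "g2 \<in> G" "g1 x \<noteq> x" "g2 x \<noteq> x" by (auto simp: stab_def)
    define u where "u = g2 x"
    define v where "v = g2 (g1 x)"
    have "v \<noteq> x" using g12 g G_comp by (auto simp: stab_def homeo_circle_mult v_def)
    moreover have "u \<noteq> v"
      using G_inv(2)[OF g(2), of x] G_inv(2)[OF g(2), of "g1 x"] g(3) by (auto simp: u_def v_def)
    ultimately have uv: "circularly_ordered [x, u, v] \<or> circularly_ordered [x, v, u]"
      using circularly_ordered3_cases[of x u v] g(4) by (auto simp: u_def)
    have uvY: "u \<in> Y" "v \<in> Y" using g Y(1) gY by (auto simp: u_def v_def)
    \<comment> \<open>\<open>h\<close> carries \<open>(x, u, v)\<close> to the triple of the pair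
      \<open>(a, c)\<close>. Elements with the same value at \<open>x\<close> differ by a left
      factor from the stabiliser, which turns equal points into the required equations in the
      group.\<close>
    have factor: "\<exists>h1\<in>stab x. \<exists>h2\<in>stab x. \<exists>h\<in>stab x.
        g2 \<otimes>\<^bsub>\<Gamma>\<^esub> h = h1 \<otimes>\<^bsub>\<Gamma>\<^esub> c \<and> g1 \<otimes>\<^bsub>\<Gamma>\<^esub> g2 \<otimes>\<^bsub>\<Gamma>\<^esub> h = h2 \<otimes>\<^bsub>\<Gamma>\<^esub> (a \<otimes>\<^bsub>\<Gamma>\<^esub> c)"
      if h: "h \<in> G" "h x = x" "h u = c x" "h v = c (a x)" and ac: "a \<in> G" "c \<in> G" for h a c
    proof -
      obtain h1 where "h1 \<in> stab x" "h \<circ> g2 = h1 \<otimes>\<^bsub>\<Gamma>\<^esub> c"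
        using stab_coset[OF G_comp[OF g(2) h(1)] ac(2), of x] h(3) by (auto simp: u_def)
      moreover obtain h2 where "h2 \<in> stab x" "h \<circ> (g2 \<circ> g1) = h2 \<otimes>\<^bsub>\<Gamma>\<^esub> (c \<circ> a)"
        using stab_coset[OF G_comp[OF G_comp[OF g(1,2)] h(1)] G_comp[OF ac], of x] h(4) by (auto simp: v_def)
      moreover have "h \<in> stab x" using h by (simp add: stab_def)
      ultimately show ?thesis unfolding \<Gamma>_mult by blast
    qed
    show "\<exists>a c. (a, c) \<in> {(p1, p2), (inv\<^bsub>\<Gamma>\<^esub> p1, p1 \<otimes>\<^bsub>\<Gamma>\<^esub> p2)} \<and> (\<exists>h1\<in>stab x. \<exists>h2\<in>stab x. \<exists>h\<in>stab x.
        g2 \<otimes>\<^bsub>\<Gamma>\<^esub> h = h1 \<otimes>\<^bsub>\<Gamma>\<^esub> c \<and> g1 \<otimes>\<^bsub>\<Gamma>\<^esub> g2 \<otimes>\<^bsub>\<Gamma>\<^esub> h = h2 \<otimes>\<^bsub>\<Gamma>\<^esub> (a \<otimes>\<^bsub>\<Gamma>\<^esub> c))"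
      using uv
    proof
      assume "circularly_ordered [x, u, v]"
      then obtain h where "h \<in> G" "h x = x" "h u = y" "h v = z" using trans3 uvY by blast
      then show ?thesis
        using factor[of h p2 p1] p1G p2G p12x by (intro exI[of _ p1] exI[of _ p2] conjI) auto
    next
      \<comment> \<open>The other orientation has the model triple \<open>(x, z, y)\<close>: the
        composite sends \<open>x\<close> to \<open>z\<close>, and preceding it by the inverse of
        \<open>p1\<close> leaves \<open>p2\<close>, which sends \<open>x\<close> to
        \<open>y\<close>.\<close>
      assume "circularly_ordered [x, v, u]"
      then obtain h where "h \<in> G" "h x = x" "h v = y" "h u = z" using trans3 uvY by blast
      then show ?thesis
        using factor[of h "p1 \<otimes>\<^bsub>\<Gamma>\<^esub> p2" "inv\<^bsub>\<Gamma>\<^esub> p1"] p1G p2G p12x G_inv[OF p1G] G_comp[OF p1G p2G(1)]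
        by (intro exI[of _ "inv\<^bsub>\<Gamma>\<^esub> p1"] exI[of _ "p1 \<otimes>\<^bsub>\<Gamma>\<^esub> p2"] conjI) (auto simp: homeo_circle_mult)
    qed
  qed
  define e where "e = (\<lambda>g h. if g \<in> G \<and> h \<in> G then based_euler b g h else 0)"
  define eu where "eu = (\<lambda>g h. if g \<in> G \<and> h \<in> G then real_of_int (euler_cocycle g h) else 0)"
  define \<phi> where "\<phi> = (\<lambda>g. real_of_int \<lfloor>canonical_lift g b - b\<rfloor>)"
  have e_cocycle: "e \<in> bounded_cocycles2 \<Gamma>"
  proof (rule bounded_cocycles2I)
    show "\<forall>g h. \<bar>e g h\<bar> \<le> 2" using based_euler_bound G_homeo by (auto simp: e_def)
    fix f g h assume "f \<in> carrier \<Gamma>" "g \<in> carrier \<Gamma>" "h \<in> carrier \<Gamma>"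
    then show "e g h - e (f \<otimes>\<^bsub>\<Gamma>\<^esub> g) h + e f (g \<otimes>\<^bsub>\<Gamma>\<^esub> h) - e f g = 0"
      using based_euler_cocycle[of f g h b] G_homeo G_comp by (simp add: e_def homeo_circle_mult)
  qed (auto simp: e_def)
  have e_rel: "e \<in> relative_cocycles \<Gamma> (stab x)"
    using e_cocycle based_euler_stabilizer[of _ b] G_homeo
    by (auto simp: relative_cocycles_def e_def stab_def b)
  have d_eq: "e g h - eu g h = coboundary2 \<Gamma> (\<lambda>g. - \<phi> g) g h" for g h
    using based_euler_eq[of g h b] G_homeo
    by (simp add: e_def eu_def coboundary2_def homeo_circle_mult \<phi>_def)
  have "\<bar>- \<phi> g\<bar> \<le> 3" if "g \<in> carrier \<Gamma>" for g
    using canonical_lift_near[of g b] G_homeo that by (simp add: \<phi>_def)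
  then have d: "(\<lambda>g h. e g h - eu g h) \<in> bounded_coboundaries2 \<Gamma>"
    unfolding d_eq by (intro bounded_coboundaries2I[of _ _ "\<lambda>g. - \<phi> g" 3]) auto
  \<comment> \<open>That \<open>eu\<close> is a bounded cocycle is inherited from \<open>e\<close>,
    from which it differs by a bounded coboundary.\<close>
  have "(\<lambda>g h. (-1) * (e g h - eu g h)) \<in> bounded_cocycles2 \<Gamma>"
    using bounded_coboundaries2_lin(2)[OF d, of "-1"]
      submodule.subset[OF \<Gamma>.bounded_coboundaries2_submodule] by (auto simp: cocycle_space_simps)
  from bounded_cocycles2_add[OF e_cocycle this] have eu: "eu \<in> bounded_cocycles2 \<Gamma>" by simp
  have "e p1 p2 \<in> \<int>" using p1G p2G based_euler_Ints G_homeo by (simp add: e_def)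
  moreover have "e (inv\<^bsub>\<Gamma>\<^esub> p1) p1 = 1"
    using based_euler_inverse[of "inv\<^bsub>\<Gamma>\<^esub> p1" p1 b] p1G p1_move G_inv[OF p1G] G_homeo b
    by (simp add: e_def fun_eq_iff)
  ultimately have "vectorspace.dim class_ring (bounded_H2 \<Gamma>) = 1"
    "module.span class_ring (bounded_H2 \<Gamma>) {bounded_class2 \<Gamma> eu} = carrier (bounded_H2 \<Gamma>)"
    using bounded_H2_one_dimensional[OF eu e_rel d] additive_on_stab[OF assms(2)] unfolding b by blast+
  moreover have "real_euler_class \<Gamma> (\<lambda>g. g) = bounded_class2 \<Gamma> eu"
    by (simp add: real_euler_class_def eu_def)
  ultimately show ?thesis
    using \<Gamma>.bounded_H2_vectorspace by (simp add: Let_def)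
qed

end
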